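(* Let $L$ be a language (with relation symbols and set-valued function symbols) and let $\mathcal K$ be a free amalgamation class of $L$-structures. Then the class $\vec{\mathcal K}$ of all orderings of structures in $\mathcal K$ is a Ramsey class.
   Context: A language $L=L_{\mathcal R}\cup L_{\mathcal F}$ consists of relation symbols $R\in L_{\mathcal R}$ and function symbols $F\in L_{\mathcal F}$, each with an arity. An $L$-structure $\mathbf A$ has a vertex set $A$ (finite or countable, possibly empty), relations $R_{\mathbf A}\subseteq A^{\mathrm{arity}(R)}$ for $R\in L_{\mathcal R}$, and set-valued functions $F_{\mathbf A}:A^{\mathrm{arity}(F)}\to \mathscr P(A)$ (power set of $A$) for $F\in L_{\mathcal F}$. An embedding $f:\mathbf A\to\mathbf B$ is an injective map $f:A\to B$ such that $(x_1,\dots,x_a)\in R_{\mathbf A}\iff (f(x_1),\dots,f(x_a))\in R_{\mathbf B}$ for every relation symbol $R$ of arity $a$, and $f(F_{\mathbf A}(x_1,\dots,x_a))=F_{\mathbf B}(f(x_1),\dots,f(x_a))$ (image of a set on the left) for every function symbol $F$ of arity $a$. If an embedding is an inclusion, $\mathbf A$ is a substructure of $\mathbf B$; in particular a substructure is closed under all functions: $F_{\mathbf B}(\bar t)\subseteq A$ for every tuple $\bar t$ of vertices of $A$. Isomorphisms are bijective embeddings. Let $\alpha_i:\mathbf A\to\mathbf B_i$ ($i=1,2$) be embeddings. An amalgamation of $\mathbf B_1,\mathbf B_2$ over $\mathbf A$ with respect to $\alpha_1,\alpha_2$ is a structure $\mathbf C$ with embeddings $\beta_i:\mathbf B_i\to\mathbf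 C$ such that $\beta_1\circ\alpha_1=\beta_2\circ\alpha_2$. It is free if $\beta_1(x_1)=\beta_2(x_2)$ only when $x_1\in\alpha_1(A)$ and $x_2\in\alpha_2(A)$ (so that the two images meet exactly in the image of $A$), $C=\beta_1(B_1)\cup\beta_2(B_2)$, and whenever a tuple $\bar t$ of vertices of $\mathbf C$ contains vertices of both $\beta_1(B_1\setminus\alpha_1(A))$ and $\beta_2(B_2\setminus\alpha_2(A))$, then $\bar t$ is in no relation of $\mathbf C$ and $F_{\mathbf C}(\bar t)=\emptyset$ for every function symbol $F$ of arity $|\bar t|$. A class $\mathcal K$ of finite structures is an amalgamation class if it is hereditary (closed under substructures), has the joint embedding property (any two members embed into a common member), and has the amalgamation property (for all embeddings $\alpha_i:\mathbf A\to\mathbf B_i$ between members there is an amalgamation of $\mathbf B_1,\mathbf B_2$ over $\mathbf A$ with respect to $\alpha_1,\alpha_2$ in $\mathcal K$). It is a free amalgamation class if the amalgamation can always be chosen to be the free one. $\vec L$ is $L$ extended by one binary relation symbol $\leq$. An ordering of an $L$-structure $\mathbf A$ is an $\vec L$-structure $\vec{\mathbf A}$ extending $\mathbf A$ by an arbitrary linear order $\leq_{\mathbf A}$ of its vertices. $\vec{\mathcal K}$ is the class of all orderings of structures in $\mathcal K$. $\binom{\mathbf B}{\mathbf A}$ denotes the set of all substructures of $\mathbf B$ isomorphic to $\mathbf A$. A class $\mathcal C$ is a Ramsey class if for all $\mathbf A,\mathbf B\in\mathcal C$ and every positive integer $k$ there is $\mathbf C\in\mathcal C$ such that for every partition of $\binom{\mathbf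 C}{\mathbf A}$ into $k$ classes there is $\widetilde{\mathbf B}\in\binom{\mathbf C}{\mathbf B}$ such that $\binom{\widetilde{\mathbf B}}{\mathbf A}$ is contained in one class of the partition. *)

theory Defs
  imports "HOL-Library.Countable_Set" "HOL-Library.Disjoint_Sets"
begin

section \<open>Languages and structures\<close>

text \<open>
  The symbols form sets rather than whole types, so that either kind of symbol may be absent.
\<close>

record ('r, 'f) language =
  rel_syms :: "'r set"
  fun_syms :: "'f set"
  rel_arity :: "'r \<Rightarrow> nat"
  fun_arity :: "'f \<Rightarrow> nat"

record ('a, 'r, 'f) lstructure =
  verts :: "'a set"
  rels :: "'r \<Rightarrow> 'a list set"
  fn :: "'f \<Rightarrow> 'a list \<Rightarrow> 'a set"

definition tuples :: "'a set \<Rightarrow> nat \<Rightarrow> 'a list set" where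
  "tuples A n = {t. length t = n \<and> set t \<subseteq> A}"

text \<open>
  The record fields are total. Off the language and off the tuples of the right arity they are
  required to be empty, so that equality of records is equality of structures. This matters because
  substructures are later counted and partitioned as records.
\<close>

definition is_structure :: "('r, 'f) language \<Rightarrow> ('a, 'r, 'f) lstructure \<Rightarrow> bool" where
  "is_structure L A \<longleftrightarrow>
     countable (verts A) \<and>
     (\<forall>R\<in>rel_syms L. rels A R \<subseteq> tuples (verts A) (rel_arity L R)) \<and>
     (\<forall>R. R \<notin> rel_syms L \<longrightarrow> rels A R = {}) \<and>
     (\<forall>F\<in>fun_syms L. \<forall>t\<in>tuples (verts A) (fun_arity L F). fn A F t \<subseteq> verts A) \<and>
     (\<forall>F t. \<not> (F \<in> fun_syms L \<and> t \<in> tuples (verts A) (fun_arity L F)) \<longrightarrow> fn A F t = {})"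

text \<open>The values of an embedding outside the vertex set of its domain are irrelevant.\<close>

definition embedding ::
  "('r, 'f) language \<Rightarrow> ('a \<Rightarrow> 'b) \<Rightarrow> ('a, 'r, 'f) lstructure \<Rightarrow> ('b, 'r, 'f) lstructure \<Rightarrow> bool" where
  "embedding L f A B \<longleftrightarrow>
     is_structure L A \<and> is_structure L B \<and>
     f ` verts A \<subseteq> verts B \<and> inj_on f (verts A) \<and>
     (\<forall>R\<in>rel_syms L. \<forall>t\<in>tuples (verts A) (rel_arity L R).
        t \<in> rels A R \<longleftrightarrow> map f t \<in> rels B R) \<and>
     (\<forall>F\<in>fun_syms L. \<forall>t\<in>tuples (verts A) (fun_arity L F).
        f ` fn A F t = fn B F (map f t))"

definition substructure ::
  "('r, 'f) language \<Rightarrow> ('a, 'r, 'f) lstructure \<Rightarrow> ('a, 'r, 'f) lstructure \<Rightarrow> bool" where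
  "substructure L A B \<longleftrightarrow> embedding L (\<lambda>x. x) A B"

definition isomorphic ::
  "('r, 'f) language \<Rightarrow> ('a, 'r, 'f) lstructure \<Rightarrow> ('b, 'r, 'f) lstructure \<Rightarrow> bool" where
  "isomorphic L A B \<longleftrightarrow> (\<exists>f. embedding L f A B \<and> bij_betw f (verts A) (verts B))"

section \<open>Amalgamation classes\<close>

definition amalgamation ::
  "('r, 'f) language \<Rightarrow> ('a, 'r, 'f) lstructure \<Rightarrow> ('b, 'r, 'f) lstructure \<Rightarrow> ('c, 'r, 'f) lstructure \<Rightarrow>
   ('a \<Rightarrow> 'b) \<Rightarrow> ('a \<Rightarrow> 'c) \<Rightarrow> ('d, 'r, 'f) lstructure \<Rightarrow> ('b \<Rightarrow> 'd) \<Rightarrow> ('c \<Rightarrow> 'd) \<Rightarrow> bool" where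
  "amalgamation L A B1 B2 \<alpha>1 \<alpha>2 C \<beta>1 \<beta>2 \<longleftrightarrow>
     embedding L \<beta>1 B1 C \<and> embedding L \<beta>2 B2 C \<and>
     (\<forall>x\<in>verts A. \<beta>1 (\<alpha>1 x) = \<beta>2 (\<alpha>2 x))"

definition free_amalgamation ::
  "('r, 'f) language \<Rightarrow> ('a, 'r, 'f) lstructure \<Rightarrow> ('b, 'r, 'f) lstructure \<Rightarrow> ('c, 'r, 'f) lstructure \<Rightarrow>
   ('a \<Rightarrow> 'b) \<Rightarrow> ('a \<Rightarrow> 'c) \<Rightarrow> ('d, 'r, 'f) lstructure \<Rightarrow> ('b \<Rightarrow> 'd) \<Rightarrow> ('c \<Rightarrow> 'd) \<Rightarrow> bool" where
  "free_amalgamation L A B1 B2 \<alpha>1 \<alpha>2 C \<beta>1 \<beta>2 \<longleftrightarrow>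
     amalgamation L A B1 B2 \<alpha>1 \<alpha>2 C \<beta>1 \<beta>2 \<and>
     (\<forall>x1\<in>verts B1. \<forall>x2\<in>verts B2.
        \<beta>1 x1 = \<beta>2 x2 \<longrightarrow> x1 \<in> \<alpha>1 ` verts A \<and> x2 \<in> \<alpha>2 ` verts A) \<and>
     verts C = \<beta>1 ` verts B1 \<union> \<beta>2 ` verts B2 \<and>
     (\<forall>t. set t \<subseteq> verts C \<and>
          set t \<inter> \<beta>1 ` (verts B1 - \<alpha>1 ` verts A) \<noteq> {} \<and>
          set t \<inter> \<beta>2 ` (verts B2 - \<alpha>2 ` verts A) \<noteq> {} \<longrightarrow>
          (\<forall>R\<in>rel_syms L. t \<notin> rels C R) \<and>
          (\<forall>F\<in>fun_syms L. fun_arity L F = length t \<longrightarrow> fn C F t = {}))"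

definition hereditary :: "('r, 'f) language \<Rightarrow> ('a, 'r, 'f) lstructure set \<Rightarrow> bool" where
  "hereditary L K \<longleftrightarrow> (\<forall>B\<in>K. \<forall>A. substructure L A B \<longrightarrow> A \<in> K)"

definition joint_embedding_property :: "('r, 'f) language \<Rightarrow> ('a, 'r, 'f) lstructure set \<Rightarrow> bool" where
  "joint_embedding_property L K \<longleftrightarrow>
     (\<forall>A\<in>K. \<forall>B\<in>K. \<exists>C\<in>K. (\<exists>f. embedding L f A C) \<and> (\<exists>g. embedding L g B C))"

definition amalgamation_property :: "('r, 'f) language \<Rightarrow> ('a, 'r, 'f) lstructure set \<Rightarrow> bool" where
  "amalgamation_property L K \<longleftrightarrow>
     (\<forall>A\<in>K. \<forall>B1\<in>K. \<forall>B2\<in>K. \<forall>\<alpha>1 \<alpha>2. embedding L \<alpha>1 A B1 \<and> embedding L \<alpha>2 A B2 \<longrightarrow>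
        (\<exists>C\<in>K. \<exists>\<beta>1 \<beta>2. amalgamation L A B1 B2 \<alpha>1 \<alpha>2 C \<beta>1 \<beta>2))"

definition free_amalgamation_property :: "('r, 'f) language \<Rightarrow> ('a, 'r, 'f) lstructure set \<Rightarrow> bool" where
  "free_amalgamation_property L K \<longleftrightarrow>
     (\<forall>A\<in>K. \<forall>B1\<in>K. \<forall>B2\<in>K. \<forall>\<alpha>1 \<alpha>2. embedding L \<alpha>1 A B1 \<and> embedding L \<alpha>2 A B2 \<longrightarrow>
        (\<exists>C\<in>K. \<exists>\<beta>1 \<beta>2. free_amalgamation L A B1 B2 \<alpha>1 \<alpha>2 C \<beta>1 \<beta>2))"

text \<open>
  Classes are sets of structures with vertices in an arbitrary type. They are not required to be
  closed under isomorphism; classes closed under isomorphism are a special case.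
\<close>

definition amalgamation_class :: "('r, 'f) language \<Rightarrow> ('a, 'r, 'f) lstructure set \<Rightarrow> bool" where
  "amalgamation_class L K \<longleftrightarrow>
     (\<forall>A\<in>K. is_structure L A \<and> finite (verts A)) \<and>
     hereditary L K \<and> joint_embedding_property L K \<and> amalgamation_property L K"

definition free_amalgamation_class :: "('r, 'f) language \<Rightarrow> ('a, 'r, 'f) lstructure set \<Rightarrow> bool" where
  "free_amalgamation_class L K \<longleftrightarrow> amalgamation_class L K \<and> free_amalgamation_property L K"

section \<open>Orderings\<close>

text \<open>The new binary symbol is \<^const>\<open>None\<close>; the old relation symbols \<open>R\<close> become \<open>Some R\<close>.\<close>

definition ordered_language :: "('r, 'f) language \<Rightarrow> ('r option, 'f) language" where
  "ordered_language L =
     \<lparr>rel_syms = insert None (Some ` rel_syms L),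
      fun_syms = fun_syms L,
      rel_arity = case_option 2 (rel_arity L),
      fun_arity = fun_arity L\<rparr>"

definition is_ordering ::
  "('r, 'f) language \<Rightarrow> ('a, 'r, 'f) lstructure \<Rightarrow> ('a, 'r option, 'f) lstructure \<Rightarrow> bool" where
  "is_ordering L A A' \<longleftrightarrow>
     is_structure (ordered_language L) A' \<and>
     verts A' = verts A \<and> (\<forall>R. rels A' (Some R) = rels A R) \<and> fn A' = fn A \<and>
     linear_order_on (verts A) {(x, y). [x, y] \<in> rels A' None}"

definition orderings ::
  "('r, 'f) language \<Rightarrow> ('a, 'r, 'f) lstructure set \<Rightarrow> ('a, 'r option, 'f) lstructure set" where
  "orderings L K = {A'. \<exists>A\<in>K. is_ordering L A A'}"

section \<open>Ramsey classes\<close>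

definition copies ::
  "('r, 'f) language \<Rightarrow> ('a, 'r, 'f) lstructure \<Rightarrow> ('a, 'r, 'f) lstructure \<Rightarrow> ('a, 'r, 'f) lstructure set"
where
  "copies L B A = {A'. substructure L A' B \<and> isomorphic L A A'}"

text \<open>
  A partition into \<open>k\<close> classes is an indexed family of \<open>k\<close> disjoint classes, some of which may be
  empty (a colouring with \<open>k\<close> colours). With nonempty classes the condition would be vacuous
  whenever there are fewer than \<open>k\<close> copies.
\<close>

definition ramsey_class :: "('r, 'f) language \<Rightarrow> ('a, 'r, 'f) lstructure set \<Rightarrow> bool" where
  "ramsey_class L \<C> \<longleftrightarrow>
     (\<forall>A\<in>\<C>. \<forall>B\<in>\<C>. \<forall>k::nat. k > 0 \<longrightarrow>
        (\<exists>C\<in>\<C>. \<forall>P :: nat \<Rightarrow> ('a, 'r, 'f) lstructure set.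
           disjoint_family_on P {..<k} \<and> (\<Union>i<k. P i) = copies L C A \<longrightarrow>
           (\<exists>B'\<in>copies L C B. \<exists>i<k. copies L B' A \<subseteq> P i)))"

end

theory Submission
  imports Defs "HOL-Library.FuncSet" "HOL-Library.Ramsey"
begin

text \<open>
  The proof is the partite construction of Nesetril and Rodl, performed at two levels. A finite
  structure belongs to the class up to isomorphism as soon as all its irreducible substructures do,
  since a structure that is not irreducible is a free amalgam of proper substructures. Given ordered
  structures \<open>A\<close> and \<open>B\<close>, Ramsey's theorem yields \<open>N\<close> such that colourings of the embeddings of \<open>A\<close>
  into the linear order \<open>{..<N}\<close> are constant on some copy of \<open>B\<close>. One starts from the disjoint
  union of copies of \<open>B\<close> placed over all possible positions, and improves it step by step until the
  colour of a copy of \<open>A\<close> depends only on its positions.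

  A step treats one placement of \<open>A\<close>. If the part of the structure lying over the placement is closed
  and locally isomorphic to \<open>A\<close>, a Hales--Jewett power of this part, with a copy of the whole
  structure freely glued along each combinatorial line, does the job: an irreducible set in a power
  has irreducible coordinate projections. Functions of arity at least two can make that part not
  closed. In this case an inner partite construction is run, whose base is not a linear order but the
  set of Hales--Jewett words of copies of \<open>A\<close>; over this base the required closedness holds.
\<close>

section \<open>The Hales--Jewett theorem\<close>

text \<open>The order is not part of the structures under construction, because free amalgamation
  does not control it. The intermediate structures are unordered and carry a projection; the final
  order sorts the vertices by their projections and breaks ties arbitrarily. An ordered copy is
  determined by its vertex set, so it suffices to colour vertex sets.

  Closedness fails for the following reason. Each section over a placement is closed, and so a union
  of sections is closed under unary functions. A tuple with entries in two sections, however, may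
  have values outside the placement. Replacing the base by words of sections repairs this: within
  one copy, all vertices over a given word lie in one section.

  Powers and gluings have vertices of new types, and \<open>K\<close> need not be closed under
  isomorphism. Each construction therefore ends by passing to an isomorphic member of
  \<open>K\<close>, and the projection is carried over by the inverse isomorphism.\<close>

text \<open>In a template, \<open>None\<close> marks the active coordinates.\<close>

definition fill :: "'l option list \<Rightarrow> 'l \<Rightarrow> 'l list" where
  "fill \<tau> x = map (\<lambda>s. case s of None \<Rightarrow> x | Some c \<Rightarrow> c) \<tau>"

definition templates :: "'l set \<Rightarrow> nat \<Rightarrow> 'l option list set" where
  "templates \<Gamma> n = {\<tau>. length \<tau> = n \<and> set \<tau> \<subseteq> insert None (Some ` \<Gamma>)}"

lemma fill_append: "fill (\<sigma> @ \<tau>) x = fill \<sigma> x @ fill \<tau> x"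
  by (simp add: fill_def)

lemma fill_single: "fill [s] x = [case s of None \<Rightarrow> x | Some c \<Rightarrow> c]"
  by (simp add: fill_def)

lemma fill_map_Some [simp]: "fill (map Some w) x = w"
  by (simp add: fill_def comp_def)

lemma fill_tuples: "\<tau> \<in> templates \<Gamma> n \<Longrightarrow> x \<in> \<Gamma> \<Longrightarrow> fill \<tau> x \<in> tuples \<Gamma> n"
  by (auto simp: fill_def templates_def tuples_def split: option.splits)

lemma finite_tuples: "finite A \<Longrightarrow> finite (tuples A n)"
  unfolding tuples_def by (rule finite_subset[OF _ finite_lists_length_eq[of A n]]) auto

text \<open>Colourings below are bounded functions into the numbers; this code turns colours that
  are themselves functions into such numbers. The bound is a successor so that the default value 0
  off \<open>C\<close> is admissible even when \<open>C\<close> is empty.\<close>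

lemma bounded_code:
  assumes "finite C"
  shows "\<exists>(q :: 'c \<Rightarrow> nat) k. inj_on q C \<and> (\<forall>c. q c < Suc k)"
proof -
  obtain g :: "'c \<Rightarrow> nat" where g: "bij_betw g C {0..<card C}"
    using ex_bij_betw_finite_nat[OF assms] by blast
  show ?thesis
  proof (intro exI[of _ "\<lambda>c. if c \<in> C then g c else 0"] exI[of _ "card C"] conjI allI)
    show "inj_on (\<lambda>c. if c \<in> C then g c else 0) C"
      using g by (auto simp: bij_betw_def inj_on_def)
    show "(if c \<in> C then g c else 0) < Suc (card C)" for c
      using bij_betwE[OF g] by (auto intro: less_SucI)
  qed
qed

text \<open>
  Shelah's insensitivity lemma. The conclusion on templates says that \<open>\<Phi>\<close> maps lines to lines.
\<close>

lemma insensitive_subspace: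
  fixes a b :: 'l
  assumes fin: "finite \<Gamma>" and ab: "a \<in> \<Gamma>" "b \<in> \<Gamma>"
  shows "\<exists>N. \<forall>\<chi> :: 'l list \<Rightarrow> nat. (\<forall>w. \<chi> w < k) \<longrightarrow>
    (\<exists>\<Phi>. (\<forall>\<sigma>\<in>templates \<Gamma> n. \<exists>\<tau>\<in>templates \<Gamma> N. (None \<in> set \<sigma> \<longrightarrow> None \<in> set \<tau>) \<and>
            (\<forall>x. \<Phi> (fill \<sigma> x) = fill \<tau> x)) \<and>
         (\<forall>w\<in>tuples \<Gamma> n. \<chi> (\<Phi> w) = \<chi> (\<Phi> (map (\<lambda>x. if x = a then b else x) w))))"
proof (induction n arbitrary: k)
  case 0
  show ?case
    by (intro exI[of _ 0] allI impI exI[of _ "\<lambda>w. w"]) (auto simp: tuples_def templates_def)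
next
  case (Suc n)
  let ?r = "\<lambda>x. if x = a then b else x"
  have fin_col: "finite (\<Gamma> \<rightarrow>\<^sub>E {..<k})" using fin by (auto intro: finite_PiE)
  obtain q :: "('l \<Rightarrow> nat) \<Rightarrow> nat" and k' where
    q: "inj_on q (\<Gamma> \<rightarrow>\<^sub>E {..<k})" "\<And>c. q c < Suc k'"
    using bounded_code[OF fin_col] by blast
  obtain N where N: "\<forall>\<chi> :: 'l list \<Rightarrow> nat. (\<forall>w. \<chi> w < Suc k') \<longrightarrow>
    (\<exists>\<Phi>. (\<forall>\<sigma>\<in>templates \<Gamma> n. \<exists>\<tau>\<in>templates \<Gamma> N. (None \<in> set \<sigma> \<longrightarrow> None \<in> set \<tau>) \<and>
            (\<forall>x. \<Phi> (fill \<sigma> x) = fill \<tau> x)) \<and>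
         (\<forall>w\<in>tuples \<Gamma> n. \<chi> (\<Phi> w) = \<chi> (\<Phi> (map ?r w))))"
    using Suc.IH[of "Suc k'"] ..
  \<comment> \<open>By the pigeonhole principle, two of the \<open>m + 1\<close> words
    \<open>blk 0\<close>, ..., \<open>blk m\<close> will induce the same colouring of the words of
    length \<open>N\<close>. This is why \<open>N\<close> is fixed before \<open>m\<close>.\<close>
  define m where "m = card (tuples \<Gamma> N \<rightarrow>\<^sub>E {..<k})"
  have fin_ctx: "finite (tuples \<Gamma> N \<rightarrow>\<^sub>E {..<k})"
    using finite_tuples[OF fin] by (auto intro: finite_PiE)
  show ?case
  proof (intro exI[of _ "N + m"] allI impI)
    fix \<chi> :: "'l list \<Rightarrow> nat" assume \<chi>: "\<forall>w. \<chi> w < k"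
    define blk where "blk j = replicate j a @ replicate (m - j) b" for j
    define ctx where "ctx j = (\<lambda>u\<in>tuples \<Gamma> N. \<chi> (u @ blk j))" for j
    have "ctx ` {..m} \<subseteq> tuples \<Gamma> N \<rightarrow>\<^sub>E {..<k}"
      using \<chi> by (auto simp: ctx_def)
    then have "card (ctx ` {..m}) \<le> m"
      unfolding m_def by (intro card_mono fin_ctx)
    then have "\<not> inj_on ctx {..m}" by (auto dest: card_image)
    then obtain i j where ij: "i < j" "j \<le> m" "ctx i = ctx j"
      unfolding inj_on_def by (metis atMost_iff linorder_neqE_nat)
    \<comment> \<open>The line through \<open>blk i\<close> and \<open>blk j\<close>, with
      coordinates \<open>i\<close> to \<open>j - 1\<close> active: letter \<open>a\<close> gives
      \<open>blk j\<close>, letter \<open>b\<close> gives \<open>blk i\<close>.\<close>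
    define l where "l = replicate i (Some a) @ replicate (j - i) None @ replicate (m - j) (Some b)"
    have l: "l \<in> templates \<Gamma> m" "None \<in> set l"
      using ij ab by (auto simp: l_def templates_def)
    have la: "fill l a = blk j"
      using ij replicate_add[of i "j - i" a] by (simp add: l_def fill_def blk_def)
    have lb: "fill l b = blk i"
      using ij replicate_add[of "j - i" "m - j" b] by (simp add: l_def fill_def blk_def)
    have ins: "\<chi> (u @ fill l x) = \<chi> (u @ fill l (?r x))" if "u \<in> tuples \<Gamma> N" for u x
      using fun_cong[OF ij(3), of u] that la lb by (simp add: ctx_def)
    \<comment> \<open>Records the colours for all last letters at once, so that insensitivity of
      \<open>\<chi>'\<close> in the first \<open>n\<close> letters yields that of
      \<open>\<chi>\<close> whatever the last letter is.\<close>
    define \<chi>' where "\<chi>' u = q (\<lambda>x\<in>\<Gamma>. \<chi> (u @ fill l x))" for u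
    have \<chi>'D: "\<chi> (u @ fill l x) = \<chi> (v @ fill l x)" if "\<chi>' u = \<chi>' v" "x \<in> \<Gamma>" for u v x
    proof -
      have "(\<lambda>x\<in>\<Gamma>. \<chi> (u @ fill l x)) = (\<lambda>x\<in>\<Gamma>. \<chi> (v @ fill l x))"
        using that(1) q(1) \<chi> unfolding \<chi>'_def by (elim inj_onD) auto
      then show ?thesis using that(2) by (metis restrict_apply')
    qed
    obtain \<Phi> where \<Phi>: "\<And>\<sigma>. \<sigma> \<in> templates \<Gamma> n \<Longrightarrow> \<exists>\<tau>\<in>templates \<Gamma> N.
        (None \<in> set \<sigma> \<longrightarrow> None \<in> set \<tau>) \<and> (\<forall>x. \<Phi> (fill \<sigma> x) = fill \<tau> x)"
      and \<Phi>i: "\<And>w. w \<in> tuples \<Gamma> n \<Longrightarrow> \<chi>' (\<Phi> w) = \<chi>' (\<Phi> (map ?r w))"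
      using N[rule_format, of \<chi>'] q(2) unfolding \<chi>'_def by blast
    have \<Phi>w: "\<Phi> w \<in> tuples \<Gamma> N" if "w \<in> tuples \<Gamma> n" for w
    proof -
      have "map Some w \<in> templates \<Gamma> n" using that by (auto simp: templates_def tuples_def)
      then obtain \<tau> where "\<tau> \<in> templates \<Gamma> N" "\<And>x. \<Phi> (fill (map Some w) x) = fill \<tau> x"
        using \<Phi> by blast
      then show ?thesis using fill_tuples[of \<tau> \<Gamma> N a] ab by simp
    qed
    define \<Psi> where "\<Psi> w = \<Phi> (butlast w) @ fill l (last w)" for w
    show "\<exists>\<Phi>. (\<forall>\<sigma>\<in>templates \<Gamma> (Suc n). \<exists>\<tau>\<in>templates \<Gamma> (N + m).
            (None \<in> set \<sigma> \<longrightarrow> None \<in> set \<tau>) \<and> (\<forall>x. \<Phi> (fill \<sigma> x) = fill \<tau> x)) \<and>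
         (\<forall>w\<in>tuples \<Gamma> (Suc n). \<chi> (\<Phi> w) = \<chi> (\<Phi> (map ?r w)))"
    proof (intro exI[of _ \<Psi>] conjI ballI)
      fix \<sigma> assume \<sigma>: "\<sigma> \<in> templates \<Gamma> (Suc n)"
      then obtain \<sigma>' s where s: "\<sigma> = \<sigma>' @ [s]" "\<sigma>' \<in> templates \<Gamma> n" "s \<in> insert None (Some ` \<Gamma>)"
        by (cases \<sigma> rule: rev_cases) (auto simp: templates_def)
      obtain \<tau> where \<tau>: "\<tau> \<in> templates \<Gamma> N" "None \<in> set \<sigma>' \<longrightarrow> None \<in> set \<tau>"
        "\<And>x. \<Phi> (fill \<sigma>' x) = fill \<tau> x"
        using \<Phi>[OF s(2)] by blast
      \<comment> \<open>An inactive last letter becomes a constant block, an active one the whole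
        line \<open>l\<close>.\<close>
      define e where "e = (case s of None \<Rightarrow> l | Some c \<Rightarrow> map Some (fill l c))"
      have e: "e \<in> templates \<Gamma> m" "s = None \<longrightarrow> None \<in> set e"
        using l s(3) fill_tuples[OF l(1)]
        by (auto simp: e_def templates_def tuples_def split: option.splits)
      have "\<Psi> (fill \<sigma> x) = fill (\<tau> @ e) x" for x
        by (cases s) (simp_all add: \<Psi>_def s(1) fill_append fill_single \<tau>(3) e_def)
      moreover have "\<tau> @ e \<in> templates \<Gamma> (N + m)" using \<tau>(1) e(1) by (auto simp: templates_def)
      ultimately show "\<exists>\<tau>\<in>templates \<Gamma> (N + m).
          (None \<in> set \<sigma> \<longrightarrow> None \<in> set \<tau>) \<and> (\<forall>x. \<Psi> (fill \<sigma> x) = fill \<tau> x)"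
        using \<tau>(2) e(2) s(1) by (intro bexI[of _ "\<tau> @ e"]) auto
    next
      fix w assume "w \<in> tuples \<Gamma> (Suc n)"
      then obtain w' y where w: "w = w' @ [y]" "w' \<in> tuples \<Gamma> n" "y \<in> \<Gamma>"
        by (cases w rule: rev_cases) (auto simp: tuples_def)
      have "map ?r w' \<in> tuples \<Gamma> n" using w(2) ab by (auto simp: tuples_def)
      then show "\<chi> (\<Psi> w) = \<chi> (\<Psi> (map ?r w))"
        using \<chi>'D[OF \<Phi>i[OF w(2)] w(3)] ins[OF \<Phi>w, of "map ?r w'" y] by (simp add: \<Psi>_def w(1))
    qed
  qed
qed

text \<open>Induction on the alphabet. In a subspace insensitive to exchanging \<open>a\<close> for
  \<open>b\<close>, a line that is monochromatic for the letters of \<open>\<Gamma>\<close> is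
  monochromatic for \<open>a\<close> as well, because its point at \<open>a\<close> has the colour
  of its point at \<open>b\<close>.\<close>

theorem hales_jewett_lists:
  fixes \<Gamma> :: "'l set"
  assumes "finite \<Gamma>"
  shows "\<exists>N. \<forall>\<chi> :: 'l list \<Rightarrow> nat. (\<forall>w. \<chi> w < k) \<longrightarrow>
    (\<exists>\<tau>\<in>templates \<Gamma> N. None \<in> set \<tau> \<and> (\<exists>c. \<forall>x\<in>\<Gamma>. \<chi> (fill \<tau> x) = c))"
  using assms
proof (induction \<Gamma> rule: finite_induct)
  case empty
  show ?case
    by (intro exI[of _ 1] allI impI bexI[of _ "[None]"]) (auto simp: templates_def)
next
  case (insert a \<Gamma>)
  show ?case
  proof (cases "\<Gamma> = {}")
    case True
    show ?thesis
      by (intro exI[of _ 1] allI impI bexI[of _ "[None]"]) (auto simp: True templates_def)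
  next
    case False
    then obtain b where b: "b \<in> \<Gamma>" by blast
    let ?r = "\<lambda>x. if x = a then b else x"
    obtain n where n: "\<forall>\<chi> :: 'l list \<Rightarrow> nat. (\<forall>w. \<chi> w < k) \<longrightarrow>
      (\<exists>\<tau>\<in>templates \<Gamma> n. None \<in> set \<tau> \<and> (\<exists>c. \<forall>x\<in>\<Gamma>. \<chi> (fill \<tau> x) = c))"
      using insert.IH ..
    have "\<exists>N. \<forall>\<chi> :: 'l list \<Rightarrow> nat. (\<forall>w. \<chi> w < k) \<longrightarrow>
    (\<exists>\<Phi>. (\<forall>\<sigma>\<in>templates (insert a \<Gamma>) n. \<exists>\<tau>\<in>templates (insert a \<Gamma>) N.
            (None \<in> set \<sigma> \<longrightarrow> None \<in> set \<tau>) \<and> (\<forall>x. \<Phi> (fill \<sigma> x) = fill \<tau> x)) \<and>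
         (\<forall>w\<in>tuples (insert a \<Gamma>) n. \<chi> (\<Phi> w) = \<chi> (\<Phi> (map ?r w))))"
      using insert.hyps b by (intro insensitive_subspace) auto
    then obtain N where N: "\<forall>\<chi> :: 'l list \<Rightarrow> nat. (\<forall>w. \<chi> w < k) \<longrightarrow>
    (\<exists>\<Phi>. (\<forall>\<sigma>\<in>templates (insert a \<Gamma>) n. \<exists>\<tau>\<in>templates (insert a \<Gamma>) N.
            (None \<in> set \<sigma> \<longrightarrow> None \<in> set \<tau>) \<and> (\<forall>x. \<Phi> (fill \<sigma> x) = fill \<tau> x)) \<and>
         (\<forall>w\<in>tuples (insert a \<Gamma>) n. \<chi> (\<Phi> w) = \<chi> (\<Phi> (map ?r w))))" ..
    show ?thesis
    proof (intro exI[of _ N] allI impI)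
      fix \<chi> :: "'l list \<Rightarrow> nat" assume \<chi>: "\<forall>w. \<chi> w < k"
      obtain \<Phi> where \<Phi>: "\<And>\<sigma>. \<sigma> \<in> templates (insert a \<Gamma>) n \<Longrightarrow> \<exists>\<tau>\<in>templates (insert a \<Gamma>) N.
            (None \<in> set \<sigma> \<longrightarrow> None \<in> set \<tau>) \<and> (\<forall>x. \<Phi> (fill \<sigma> x) = fill \<tau> x)"
        and ins: "\<And>w. w \<in> tuples (insert a \<Gamma>) n \<Longrightarrow> \<chi> (\<Phi> w) = \<chi> (\<Phi> (map ?r w))"
        using N[THEN spec, THEN mp, OF \<chi>] by (elim exE conjE) (rule that; erule (1) bspec)
      obtain \<sigma> c where \<sigma>: "\<sigma> \<in> templates \<Gamma> n" "None \<in> set \<sigma>" "\<And>x. x \<in> \<Gamma> \<Longrightarrow> \<chi> (\<Phi> (fill \<sigma> x)) = c"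
        using n[rule_format, of "\<lambda>w. \<chi> (\<Phi> w)", OF \<chi>[rule_format]] by auto
      have \<sigma>': "\<sigma> \<in> templates (insert a \<Gamma>) n" using \<sigma>(1) by (auto simp: templates_def)
      then obtain \<tau> where \<tau>: "\<tau> \<in> templates (insert a \<Gamma>) N" "None \<in> set \<tau>"
        "\<And>x. \<Phi> (fill \<sigma> x) = fill \<tau> x" using \<Phi> \<sigma>(2) by blast
      \<comment> \<open>No inactive entry of \<open>\<sigma>\<close> is \<open>a\<close>, so the
        replacement affects exactly the active coordinates.\<close>
      have "map ?r (fill \<sigma> a) = fill \<sigma> b"
        using \<sigma>(1) insert.hyps(2) by (auto simp: fill_def templates_def split: option.splits)
      then have "\<chi> (\<Phi> (fill \<sigma> a)) = c"
        using ins[OF fill_tuples[OF \<sigma>', of a]] \<sigma>(3)[OF b] by simp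
      then show "\<exists>\<tau>\<in>templates (insert a \<Gamma>) N.
          None \<in> set \<tau> \<and> (\<exists>c. \<forall>x\<in>insert a \<Gamma>. \<chi> (fill \<tau> x) = c)"
        using \<tau> \<sigma>(3) by (intro bexI[of _ \<tau>] conjI exI[of _ c]) auto
    qed
  qed
qed

text \<open>The values of \<open>u\<close> on the active set \<open>M\<close> play no role, so one line has several names.\<close>

definition line_point :: "nat \<Rightarrow> nat set \<Rightarrow> (nat \<Rightarrow> 'l) \<Rightarrow> 'l \<Rightarrow> nat \<Rightarrow> 'l" where
  "line_point n M u x = (\<lambda>j\<in>{..<n}. if j \<in> M then x else u j)"

definition lines :: "'l set \<Rightarrow> nat \<Rightarrow> (nat set \<times> (nat \<Rightarrow> 'l)) set" where
  "lines \<Gamma> n = {(M, u). M \<subseteq> {..<n} \<and> M \<noteq> {} \<and> u \<in> {..<n} \<rightarrow>\<^sub>E \<Gamma>}"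

lemma finite_lines: "finite \<Gamma> \<Longrightarrow> finite (lines \<Gamma> n)"
  by (rule finite_subset[of _ "Pow {..<n} \<times> ({..<n} \<rightarrow>\<^sub>E \<Gamma>)"]) (auto simp: lines_def intro: finite_PiE)

text \<open>Words become functions on \<open>{..<n}\<close>, the form suited to powers. Positivity
  of \<open>n\<close> provides the coordinate 0, from which projections will be read off.\<close>

theorem hales_jewett:
  fixes \<Gamma> :: "'l set"
  assumes "finite \<Gamma>" "\<Gamma> \<noteq> {}" "k > 0"
  obtains n where "n > 0"
    "\<And>\<chi> :: (nat \<Rightarrow> 'l) \<Rightarrow> nat. (\<And>w. \<chi> w < k) \<Longrightarrow>
      \<exists>(M, u)\<in>lines \<Gamma> n. \<exists>c. \<forall>x\<in>\<Gamma>. \<chi> (line_point n M u x) = c"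
proof -
  obtain a where a: "a \<in> \<Gamma>" using assms(2) by blast
  obtain n where n: "\<forall>\<chi> :: 'l list \<Rightarrow> nat. (\<forall>w. \<chi> w < k) \<longrightarrow>
      (\<exists>\<tau>\<in>templates \<Gamma> n. None \<in> set \<tau> \<and> (\<exists>c. \<forall>x\<in>\<Gamma>. \<chi> (fill \<tau> x) = c))"
    using hales_jewett_lists[OF assms(1)] ..
  show thesis
  proof (rule that[of n])
    obtain \<tau> where "\<tau> \<in> templates \<Gamma> n" "None \<in> set \<tau>"
      using n[rule_format, of "\<lambda>_. 0"] assms(3) by blast
    then show "n > 0" by (auto simp: templates_def)
  next
    fix \<chi> :: "(nat \<Rightarrow> 'l) \<Rightarrow> nat" assume \<chi>: "\<And>w. \<chi> w < k"
    obtain \<tau> c where \<tau>: "\<tau> \<in> templates \<Gamma> n" "None \<in> set \<tau>"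
      "\<And>x. x \<in> \<Gamma> \<Longrightarrow> \<chi> (\<lambda>j\<in>{..<n}. fill \<tau> x ! j) = c"
      using n[rule_format, of "\<lambda>w. \<chi> (\<lambda>j\<in>{..<n}. w ! j)"] \<chi> by blast
    define M where "M = {j. j < n \<and> \<tau> ! j = None}"
    \<comment> \<open>The letter \<open>a\<close> on the active coordinates only makes
      \<open>u\<close> a word over \<open>\<Gamma>\<close>.\<close>
    define u where "u = (\<lambda>j\<in>{..<n}. case \<tau> ! j of None \<Rightarrow> a | Some c \<Rightarrow> c)"
    have len: "length \<tau> = n" using \<tau>(1) by (simp add: templates_def)
    have "M \<noteq> {}" using \<tau>(2) len by (auto simp: M_def in_set_conv_nth)
    moreover have "u j \<in> \<Gamma>" if "j < n" for j
    proof -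
      have "\<tau> ! j \<in> insert None (Some ` \<Gamma>)"
        using that nth_mem[of j \<tau>] \<tau>(1) len unfolding templates_def by blast
      then show ?thesis using a that by (auto simp: u_def)
    qed
    ultimately have "(M, u) \<in> lines \<Gamma> n" by (auto simp: lines_def M_def u_def)
    moreover have "line_point n M u x = (\<lambda>j\<in>{..<n}. fill \<tau> x ! j)" for x
      using len by (auto simp: line_point_def M_def u_def fill_def fun_eq_iff split: option.split)
    ultimately show "\<exists>(M, u)\<in>lines \<Gamma> n. \<exists>c. \<forall>x\<in>\<Gamma>. \<chi> (line_point n M u x) = c"
      using \<tau>(3) by (intro bexI[of _ "(M, u)"]) auto
  qed
qed

section \<open>Irreducible sets and local isomorphisms\<close>

text \<open>
  Structures are empty off their language, so the notions below can quantify over all symbols and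
  over tuples of all lengths, and need not mention the language.
\<close>

definition wf_str :: "('a, 'r, 'f) lstructure \<Rightarrow> bool" where
  "wf_str P \<longleftrightarrow> (\<forall>R t. t \<in> rels P R \<longrightarrow> set t \<subseteq> verts P) \<and>
     (\<forall>F t. \<not> set t \<subseteq> verts P \<longrightarrow> fn P F t = {}) \<and> (\<forall>F t. fn P F t \<subseteq> verts P)"

definition closed_in :: "('a, 'r, 'f) lstructure \<Rightarrow> 'a set \<Rightarrow> bool" where
  "closed_in P T \<longleftrightarrow> T \<subseteq> verts P \<and> (\<forall>F t. set t \<subseteq> T \<longrightarrow> fn P F t \<subseteq> T)"

definition related :: "('a, 'r, 'f) lstructure \<Rightarrow> 'a list \<Rightarrow> bool" where
  "related P t \<longleftrightarrow> (\<exists>R. t \<in> rels P R) \<or> (\<exists>F. fn P F t \<noteq> {})"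

text \<open>Says that the structure on \<open>T1 \<union> T2\<close> is the free amalgam of its two
  parts over \<open>T1 \<inter> T2\<close>. Closedness of the union follows, since a tuple with a
  nonempty value lies in one part.\<close>

definition splitting :: "('a, 'r, 'f) lstructure \<Rightarrow> 'a set \<Rightarrow> 'a set \<Rightarrow> bool" where
  "splitting P T1 T2 \<longleftrightarrow> closed_in P T1 \<and> closed_in P T2 \<and>
     (\<forall>t. related P t \<and> set t \<subseteq> T1 \<union> T2 \<longrightarrow> set t \<subseteq> T1 \<or> set t \<subseteq> T2)"

text \<open>\<open>U\<close> is not assumed closed, so the notion applies to a related tuple with
  its values and to coordinate images of irreducible sets.\<close>

definition irreducible_in :: "('a, 'r, 'f) lstructure \<Rightarrow> 'a set \<Rightarrow> bool" where
  "irreducible_in P U \<longleftrightarrow> U \<subseteq> verts P \<and>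
     (\<forall>T1 T2. splitting P T1 T2 \<and> U \<subseteq> T1 \<union> T2 \<longrightarrow> U \<subseteq> T1 \<or> U \<subseteq> T2)"

text \<open>\<open>U\<close> is not assumed closed: values of functions on tuples of
  \<open>U\<close> must be mapped correctly even where they leave \<open>U\<close>. With
  \<open>U\<close> the whole vertex set this is an embedding.\<close>

definition local_iso ::
  "('a \<Rightarrow> 'b) \<Rightarrow> ('a, 'r, 'f) lstructure \<Rightarrow> 'a set \<Rightarrow> ('b, 'r, 'f) lstructure \<Rightarrow> bool" where
  "local_iso f P U D \<longleftrightarrow> inj_on f U \<and> f ` U \<subseteq> verts D \<and>
     (\<forall>R t. set t \<subseteq> U \<longrightarrow> t \<in> rels P R \<longleftrightarrow> map f t \<in> rels D R) \<and>
     (\<forall>F t. set t \<subseteq> U \<longrightarrow> f ` fn P F t = fn D F (map f t))"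

definition restrict_str :: "('a, 'r, 'f) lstructure \<Rightarrow> 'a set \<Rightarrow> ('a, 'r, 'f) lstructure" where
  "restrict_str P U = \<lparr>verts = U, rels = (\<lambda>R. {t \<in> rels P R. set t \<subseteq> U}),
     fn = (\<lambda>F t. if set t \<subseteq> U then fn P F t else {})\<rparr>"

definition image_str :: "('a \<Rightarrow> 'b) \<Rightarrow> ('a, 'r, 'f) lstructure \<Rightarrow> ('b, 'r, 'f) lstructure" where
  "image_str f D = \<lparr>verts = f ` verts D, rels = (\<lambda>R. map f ` rels D R),
     fn = (\<lambda>F t. \<Union>s\<in>{s. set s \<subseteq> verts D \<and> map f s = t}. f ` fn D F s)\<rparr>"

text \<open>All closed sets share this part, so even copies meant to be disjoint have to be glued
  over it.\<close>

definition constants :: "('a, 'r, 'f) lstructure \<Rightarrow> 'a set" where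
  "constants P = \<Inter>{T. closed_in P T}"

section \<open>Basic properties of closed sets, local isomorphisms and splittings\<close>

lemma restrict_str_simps [simp]:
  "verts (restrict_str P U) = U"
  "rels (restrict_str P U) R = {t \<in> rels P R. set t \<subseteq> U}"
  "fn (restrict_str P U) F t = (if set t \<subseteq> U then fn P F t else {})"
  by (simp_all add: restrict_str_def)

text \<open>Separates what depends on \<open>L\<close>, the symbols and their arities, from the
  language-free part \<open>wf_str\<close> used by the constructions.\<close>

lemma is_structure_iff:
  "is_structure L P \<longleftrightarrow> countable (verts P) \<and> wf_str P \<and>
     (\<forall>R t. t \<in> rels P R \<longrightarrow> R \<in> rel_syms L \<and> length t = rel_arity L R) \<and>
     (\<forall>F t y. y \<in> fn P F t \<longrightarrow> F \<in> fun_syms L \<and> length t = fun_arity L F)"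
  (is "?l \<longleftrightarrow> ?r")
proof
  assume l: ?l
  have R: "R \<in> rel_syms L \<and> t \<in> tuples (verts P) (rel_arity L R)" if "t \<in> rels P R" for R t
    using l that unfolding is_structure_def by (metis empty_iff subsetD)
  have F: "F \<in> fun_syms L \<and> t \<in> tuples (verts P) (fun_arity L F)" if "y \<in> fn P F t" for F t y
    using l that unfolding is_structure_def by (metis empty_iff)
  have "y \<in> verts P" if "y \<in> fn P F t" for F t y
    using l F[OF that] that unfolding is_structure_def by (metis subsetD)
  then have "wf_str P" using R F unfolding wf_str_def tuples_def by blast
  then show ?r using l R F unfolding tuples_def is_structure_def by blast
next
  assume ?r
  then show ?l unfolding is_structure_def tuples_def wf_str_def by blast
qed

lemma is_structure_wf: "is_structure L P \<Longrightarrow> wf_str P"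
  by (simp add: is_structure_iff)

lemma wf_str_rels: "wf_str P \<Longrightarrow> t \<in> rels P R \<Longrightarrow> set t \<subseteq> verts P"
  and wf_str_fn: "wf_str P \<Longrightarrow> fn P F t \<subseteq> verts P"
  and wf_str_fn_arg: "wf_str P \<Longrightarrow> y \<in> fn P F t \<Longrightarrow> set t \<subseteq> verts P"
  by (fastforce simp: wf_str_def)+

lemma related_verts: "wf_str P \<Longrightarrow> related P t \<Longrightarrow> set t \<subseteq> verts P"
  unfolding related_def wf_str_def by blast

lemma closed_in_fn: "closed_in P T \<Longrightarrow> set t \<subseteq> T \<Longrightarrow> fn P F t \<subseteq> T"
  by (auto simp: closed_in_def)

lemma closed_in_verts: "wf_str P \<Longrightarrow> closed_in P (verts P)"
  by (auto simp: closed_in_def wf_str_def)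

lemma closed_in_Int: "closed_in P S \<Longrightarrow> closed_in P T \<Longrightarrow> closed_in P (S \<inter> T)"
  by (auto simp: closed_in_def)

lemma closed_in_constants: "wf_str P \<Longrightarrow> closed_in P (constants P)"
  using closed_in_verts[of P] closed_in_fn[of P] unfolding closed_in_def[of P "constants P"]
  by (auto simp: constants_def le_Inf_iff)

lemma constants_subset: "closed_in P T \<Longrightarrow> constants P \<subseteq> T"
  by (auto simp: constants_def)

lemma wf_restrict_str: "wf_str P \<Longrightarrow> closed_in P U \<Longrightarrow> wf_str (restrict_str P U)"
  by (auto simp: wf_str_def closed_in_def)

lemma is_structure_restrict_str:
  assumes "is_structure L P" "closed_in P U"
  shows "is_structure L (restrict_str P U)"
proof -
  have "countable U" using assms countable_subset by (auto simp: is_structure_def closed_in_def)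
  then show ?thesis
    using assms wf_restrict_str[of P U] by (auto simp: is_structure_iff split: if_splits)
qed

lemma local_isoI:
  assumes "inj_on f U" "\<And>x. x \<in> U \<Longrightarrow> f x \<in> verts D"
    "\<And>R t. set t \<subseteq> U \<Longrightarrow> t \<in> rels P R \<Longrightarrow> map f t \<in> rels D R"
    "\<And>R t. set t \<subseteq> U \<Longrightarrow> map f t \<in> rels D R \<Longrightarrow> t \<in> rels P R"
    "\<And>F t y. set t \<subseteq> U \<Longrightarrow> y \<in> fn P F t \<Longrightarrow> f y \<in> fn D F (map f t)"
    "\<And>F t z. set t \<subseteq> U \<Longrightarrow> z \<in> fn D F (map f t) \<Longrightarrow> z \<in> f ` fn P F t"
  shows "local_iso f P U D"
  unfolding local_iso_def using assms by (intro conjI allI impI) auto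

lemma local_iso_id: "local_iso (\<lambda>x. x) P (verts P) P"
  by (simp add: local_iso_def)

lemma local_isoD:
  assumes "local_iso f P U D"
  shows "inj_on f U" "f ` U \<subseteq> verts D" "x \<in> U \<Longrightarrow> f x \<in> verts D"
    "set t \<subseteq> U \<Longrightarrow> t \<in> rels P R \<longleftrightarrow> map f t \<in> rels D R"
    "set t \<subseteq> U \<Longrightarrow> fn D F (map f t) = f ` fn P F t"
  using assms unfolding local_iso_def by auto

lemma local_iso_mono: "local_iso f P U D \<Longrightarrow> V \<subseteq> U \<Longrightarrow> local_iso f P V D"
  unfolding local_iso_def by (meson inj_on_subset image_mono order_trans)

lemma local_iso_comp:
  assumes "local_iso f P U Q" "local_iso g Q V D" "f ` U \<subseteq> V"
  shows "local_iso (\<lambda>x. g (f x)) P U D"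
proof (rule local_isoI)
  show "inj_on (\<lambda>x. g (f x)) U"
    using comp_inj_on[OF local_isoD(1)[OF assms(1)] inj_on_subset[OF local_isoD(1)[OF assms(2)] assms(3)]]
    by (simp add: comp_def)
  have m: "set (map f t) \<subseteq> V" if "set t \<subseteq> U" for t
    using that assms(3) by auto
  have mm: "map (\<lambda>x. g (f x)) t = map g (map f t)" for t by simp
  show "map (\<lambda>x. g (f x)) t \<in> rels D R" if "set t \<subseteq> U" "t \<in> rels P R" for R t
    unfolding mm using that local_isoD(4)[OF assms(1)] local_isoD(4)[OF assms(2) m] by blast
  show "t \<in> rels P R" if "set t \<subseteq> U" "map (\<lambda>x. g (f x)) t \<in> rels D R" for R t
    using that local_isoD(4)[OF assms(1)] local_isoD(4)[OF assms(2) m] unfolding mm by blast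
  show "g (f y) \<in> fn D F (map (\<lambda>x. g (f x)) t)" if "set t \<subseteq> U" "y \<in> fn P F t" for F t y
    unfolding mm using that by (simp only: local_isoD(5)[OF assms(1)] local_isoD(5)[OF assms(2) m] image_eqI)
  show "z \<in> (\<lambda>x. g (f x)) ` fn P F t" if "set t \<subseteq> U" "z \<in> fn D F (map (\<lambda>x. g (f x)) t)" for F t z
    using that(2) unfolding mm
    by (simp only: local_isoD(5)[OF assms(1) that(1)] local_isoD(5)[OF assms(2) m[OF that(1)]]) blast
  show "g (f x) \<in> verts D" if "x \<in> U" for x
    using that assms by (blast dest: local_isoD(2))
qed

text \<open>The maps must agree on a closed set around \<open>U\<close>, because function values on
  tuples of \<open>U\<close> may leave \<open>U\<close> but stay in \<open>W\<close>.\<close>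

lemma local_iso_cong:
  assumes fg: "\<And>x. x \<in> W \<Longrightarrow> f x = g x" and W: "closed_in P W" "U \<subseteq> W" and f: "local_iso f P U D"
  shows "local_iso g P U D"
proof -
  have m: "map f t = map g t" if "set t \<subseteq> U" for t using that fg W by auto
  have i: "f ` fn P F t = g ` fn P F t" if "set t \<subseteq> U" for F t
    using closed_in_fn[OF W(1) order_trans[OF that W(2)]] fg by (intro image_cong) auto
  have U: "inj_on f U = inj_on g U" "f ` U = g ` U"
    using fg W(2) by (auto intro!: inj_on_cong image_cong)
  show ?thesis using f m i U unfolding local_iso_def by simp
qed

lemma local_iso_restrict_str [simp]: "local_iso f (restrict_str P U) U D \<longleftrightarrow> local_iso f P U D"
  unfolding local_iso_def by (auto cong: conj_cong)

lemma local_iso_restrict_str_subset: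
  "V \<subseteq> U \<Longrightarrow> local_iso f P V D \<Longrightarrow> local_iso f (restrict_str P U) V D"
  unfolding local_iso_def by (auto simp: subset_trans)

lemma local_iso_into_restrict_str:
  assumes "local_iso f P U D" "f ` U \<subseteq> V"
  shows "local_iso f P U (restrict_str D V)"
proof -
  have "set (map f t) \<subseteq> V" if "set t \<subseteq> U" for t using that assms(2) by auto
  then show ?thesis using assms unfolding local_iso_def by (simp add: image_subset_iff)
qed

lemma local_iso_from_restrict_str:
  assumes "local_iso f P U (restrict_str D V)" "V \<subseteq> verts D"
  shows "local_iso f P U D"
proof -
  have "set (map f t) \<subseteq> V" if "set t \<subseteq> U" for t using that local_isoD(2)[OF assms(1)] by auto
  then show ?thesis using assms unfolding local_iso_def by auto
qed

lemma closed_in_image: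
  assumes "local_iso f P U D" "closed_in P U"
  shows "closed_in D (f ` U)"
  unfolding closed_in_def
proof (intro conjI allI impI)
  fix F t assume t: "set t \<subseteq> f ` U"
  obtain s where s: "set s \<subseteq> U" "t = map f s"
  proof (rule that)
    show "set (map (inv_into U f) t) \<subseteq> U" using t by (auto intro: inv_into_into)
    show "t = map f (map (inv_into U f) t)" using t by (auto simp: f_inv_into_f intro!: map_idI[symmetric])
  qed
  show "fn D F t \<subseteq> f ` U"
    unfolding s(2) local_isoD(5)[OF assms(1) s(1)] by (rule image_mono[OF closed_in_fn[OF assms(2) s(1)]])
qed (use local_isoD(2)[OF assms(1)] in auto)

lemma closed_in_vimage:
  assumes "local_iso f P (verts P) D" "closed_in D T" "wf_str P"
  shows "closed_in P {x \<in> verts P. f x \<in> T}"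
  unfolding closed_in_def
proof (intro conjI allI impI)
  fix F t assume t: "set t \<subseteq> {x \<in> verts P. f x \<in> T}"
  then have "set t \<subseteq> verts P" and "set (map f t) \<subseteq> T" by auto
  then have "f ` fn P F t = fn D F (map f t)" "set (map f t) \<subseteq> T"
    using local_isoD(5)[OF assms(1), of t F] by simp_all
  then show "fn P F t \<subseteq> {x \<in> verts P. f x \<in> T}"
    using closed_in_fn[OF assms(2)] wf_str_fn[OF assms(3)] by blast
qed auto

lemma related_image:
  assumes "local_iso f P U D" "set t \<subseteq> U"
  shows "related D (map f t) \<longleftrightarrow> related P t"
  using local_isoD(4,5)[OF assms(1,2)] by (auto simp: related_def)

lemma constants_image:
  assumes "local_iso f P (verts P) D" "wf_str P" "wf_str D"
  shows "f ` constants P = constants D"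
proof
  have "constants P \<subseteq> {x \<in> verts P. f x \<in> constants D}"
    by (rule constants_subset[OF closed_in_vimage[OF assms(1) closed_in_constants[OF assms(3)] assms(2)]])
  then show "f ` constants P \<subseteq> constants D" by auto
  show "constants D \<subseteq> f ` constants P"
    using local_iso_mono[OF assms(1) constants_subset[OF closed_in_verts[OF assms(2)]]]
    by (intro constants_subset closed_in_image[OF _ closed_in_constants[OF assms(2)]])
qed

lemma splitting_image:
  assumes "local_iso f P (verts P) D" "wf_str P" "splitting P T1 T2"
  shows "splitting D (f ` T1) (f ` T2)"
proof -
  have T: "closed_in P T1" "closed_in P T2" "T1 \<subseteq> verts P" "T2 \<subseteq> verts P"
    using assms(3) by (auto simp: splitting_def closed_in_def)
  show ?thesis
    unfolding splitting_def
  proof (intro conjI allI impI)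
    show "closed_in D (f ` T1)" "closed_in D (f ` T2)"
      using T local_iso_mono[OF assms(1)] closed_in_image by blast+
    fix t assume t: "related D t \<and> set t \<subseteq> f ` T1 \<union> f ` T2"
    define s where "s = map (inv_into (T1 \<union> T2) f) t"
    have s: "set s \<subseteq> T1 \<union> T2" "t = map f s"
      using t by (auto simp: s_def image_Un[symmetric] f_inv_into_f intro!: map_idI[symmetric] inv_into_into)
    then have "related P s"
      using t related_image[OF assms(1), of s] T by auto
    then have "set s \<subseteq> T1 \<or> set s \<subseteq> T2" using s assms(3) by (auto simp: splitting_def)
    then show "set t \<subseteq> f ` T1 \<or> set t \<subseteq> f ` T2" using s(2) by auto
  qed
qed

lemma irreducible_inD:
  assumes "irreducible_in P U" "splitting P T1 T2" "U \<subseteq> T1 \<union> T2"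
  shows "U \<subseteq> T1 \<or> U \<subseteq> T2"
  using assms unfolding irreducible_in_def by simp

text \<open>Splittings of \<open>P\<close> are pushed forward by \<open>f\<close>, so irreducibility
  pulls back.\<close>

lemma irreducible_in_vimage:
  assumes "local_iso f P (verts P) D" "wf_str P" "U \<subseteq> verts P" "irreducible_in D (f ` U)"
  shows "irreducible_in P U"
  unfolding irreducible_in_def
proof (intro conjI allI impI assms)
  fix T1 T2 assume T: "splitting P T1 T2 \<and> U \<subseteq> T1 \<union> T2"
  then have "T1 \<subseteq> verts P" "T2 \<subseteq> verts P" by (auto simp: splitting_def closed_in_def)
  moreover have "f ` U \<subseteq> f ` T1 \<or> f ` U \<subseteq> f ` T2"
    using T by (intro irreducible_inD[OF assms(4) splitting_image[OF assms(1,2)]]) auto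
  ultimately show "U \<subseteq> T1 \<or> U \<subseteq> T2"
    using local_isoD(1)[OF assms(1)] assms(3) unfolding inj_on_def by blast
qed

text \<open>The side of a splitting that contains \<open>t\<close> is closed and thus contains the
  values at \<open>t\<close> too.\<close>

lemma irreducible_in_related:
  assumes "wf_str P" "related P t"
  shows "irreducible_in P (set t \<union> fn P F t)"
  unfolding irreducible_in_def splitting_def
proof (intro conjI allI impI)
  show "set t \<union> fn P F t \<subseteq> verts P" using related_verts[OF assms] wf_str_fn[OF assms(1)] by auto
next
  fix T1 T2
  assume "(closed_in P T1 \<and> closed_in P T2 \<and>
    (\<forall>t. related P t \<and> set t \<subseteq> T1 \<union> T2 \<longrightarrow> set t \<subseteq> T1 \<or> set t \<subseteq> T2)) \<and> set t \<union> fn P F t \<subseteq> T1 \<union> T2"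
  then have c: "closed_in P T1" "closed_in P T2" and "set t \<subseteq> T1 \<or> set t \<subseteq> T2" using assms(2) by auto
  then show "set t \<union> fn P F t \<subseteq> T1 \<or> set t \<union> fn P F t \<subseteq> T2"
    using closed_in_fn[OF c(1), of t F] closed_in_fn[OF c(2), of t F] by auto
qed

lemma local_iso_image_str:
  assumes "wf_str D" "inj_on f (verts D)"
  shows "local_iso f D (verts D) (image_str f D)"
proof -
  have m: "s = t" if "set s \<subseteq> verts D" "set t \<subseteq> verts D" "map f s = map f t" for s t
    using that assms(2) by (intro map_inj_on[OF that(3)]) (auto intro: inj_on_subset)
  show ?thesis
  proof (rule local_isoI)
    fix R t assume t: "set t \<subseteq> verts D" "map f t \<in> rels (image_str f D) R"
    then obtain s where "s \<in> rels D R" "map f t = map f s" by (auto simp: image_str_def)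
    then show "t \<in> rels D R" using m[OF t(1) wf_str_rels[OF assms(1)]] by blast
  next
    fix F t z assume t: "set t \<subseteq> verts D" "z \<in> fn (image_str f D) F (map f t)"
    then obtain s where "set s \<subseteq> verts D" "map f s = map f t" "z \<in> f ` fn D F s"
      by (auto simp: image_str_def)
    then show "z \<in> f ` fn D F t" using m[OF _ t(1)] by blast
  qed (use assms in \<open>auto simp: image_str_def\<close>)
qed

lemma wf_image_str:
  assumes "wf_str D"
  shows "wf_str (image_str f D)"
  unfolding wf_str_def
proof (intro conjI allI impI)
  show "set t \<subseteq> verts (image_str f D)" if "t \<in> rels (image_str f D) R" for R t
    using that wf_str_rels[OF assms] by (fastforce simp: image_str_def)
  show "fn (image_str f D) F t = {}" if "\<not> set t \<subseteq> verts (image_str f D)" for F t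
    using that by (fastforce simp: image_str_def)
  show "fn (image_str f D) F t \<subseteq> verts (image_str f D)" for F t
    using wf_str_fn[OF assms] by (fastforce simp: image_str_def)
qed

lemma local_iso_inv:
  assumes "local_iso f D (verts D) E" "wf_str D" "f ` verts D = verts E"
  shows "local_iso (inv_into (verts D) f) E (verts E) D"
proof -
  let ?g = "inv_into (verts D) f"
  have inj: "inj_on f (verts D)" using local_isoD(1)[OF assms(1)] .
  have fg: "map f (map ?g t) = t" "set (map ?g t) \<subseteq> verts D" if "set t \<subseteq> verts E" for t
    using that assms(3) by (auto simp: f_inv_into_f inv_into_into intro!: map_idI)
  have gf: "?g ` f ` X = X" if "X \<subseteq> verts D" for X
    using that inj by (simp add: inv_into_image_cancel)
  show ?thesis unfolding local_iso_def
  proof (intro conjI allI impI)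
    show "inj_on ?g (verts E)" using assms(3) by (auto intro: inj_on_inv_into)
    show "?g ` verts E \<subseteq> verts D" using assms(3) by (auto intro: inv_into_into)
    show "(t \<in> rels E R) = (map ?g t \<in> rels D R)" if "set t \<subseteq> verts E" for R t
      using local_isoD(4)[OF assms(1) fg(2)[OF that]] fg(1)[OF that] by simp
    show "?g ` fn E F t = fn D F (map ?g t)" if "set t \<subseteq> verts E" for F t
      using local_isoD(5)[OF assms(1) fg(2)[OF that]] fg(1)[OF that] gf[OF wf_str_fn[OF assms(2)]]
      by metis
  qed
qed

text \<open>Serves to check a projection of a glued structure copy by copy, after composing it with
  the embedding of the copy.\<close>

lemma local_iso_factor:
  assumes f: "local_iso f P V G" and g: "local_iso (\<lambda>x. \<rho> (f x)) P V E"
  shows "local_iso \<rho> G (f ` V) E"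
proof -
  have ex: "\<exists>s. set s \<subseteq> V \<and> t = map f s" if "set t \<subseteq> f ` V" for t
    using that by (intro exI[of _ "map (inv_into V f) t"])
      (auto simp: f_inv_into_f intro!: map_idI[symmetric] inv_into_into)
  show ?thesis unfolding local_iso_def
  proof (intro conjI allI impI)
    show "inj_on \<rho> (f ` V)" using local_isoD(1)[OF g] by (auto simp: inj_on_def)
    show "\<rho> ` f ` V \<subseteq> verts E" using local_isoD(2)[OF g] by auto
  next
    fix R t assume "set t \<subseteq> f ` V"
    then obtain s where s: "set s \<subseteq> V" "t = map f s" using ex by blast
    show "(t \<in> rels G R) = (map \<rho> t \<in> rels E R)"
      using local_isoD(4)[OF f s(1), of R] local_isoD(4)[OF g s(1), of R] s(2) by (simp add: comp_def)
  next
    fix F t assume "set t \<subseteq> f ` V"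
    then obtain s where s: "set s \<subseteq> V" "t = map f s" using ex by blast
    show "\<rho> ` fn G F t = fn E F (map \<rho> t)"
      using local_isoD(5)[OF f s(1), of F] local_isoD(5)[OF g s(1), of F] s(2)
      by (simp add: comp_def image_image)
  qed
qed

lemma local_iso_inv_into:
  assumes f: "local_iso f P (verts P) G" and wf: "wf_str P" and V: "V \<subseteq> verts P"
  shows "local_iso (inv_into (verts P) f) G (f ` V) P"
proof (rule local_iso_factor)
  show "local_iso f P V G" by (rule local_iso_mono[OF f V])
  have "local_iso (\<lambda>x. inv_into (verts P) f (f x)) P (verts P) P"
  proof (rule local_iso_cong[OF _ closed_in_verts[OF wf] order_refl])
    show "x = inv_into (verts P) f (f x)" if "x \<in> verts P" for x
      using that local_isoD(1)[OF f] by simp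
  qed (simp add: local_iso_def)
  then show "local_iso (\<lambda>x. inv_into (verts P) f (f x)) P V P" by (rule local_iso_mono[OF _ V])
qed

lemma embedding_iff:
  "embedding L f A B \<longleftrightarrow> is_structure L A \<and> is_structure L B \<and> local_iso f A (verts A) B"
proof
  assume e: "embedding L f A B"
  then have st: "is_structure L A" "is_structure L B" by (auto simp: embedding_def)
  have "local_iso f A (verts A) B" unfolding local_iso_def
  proof (intro conjI allI impI)
    fix R t assume t: "set t \<subseteq> verts A"
    show "(t \<in> rels A R) = (map f t \<in> rels B R)"
    proof (cases "R \<in> rel_syms L \<and> length t = rel_arity L R")
      case True
      then show ?thesis using e t by (auto simp: embedding_def tuples_def)
    next
      case False
      then have "t \<notin> rels A R" "map f t \<notin> rels B R" using st unfolding is_structure_iff by (metis length_map)+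
      then show ?thesis by simp
    qed
  next
    fix F t assume t: "set t \<subseteq> verts A"
    show "f ` fn A F t = fn B F (map f t)"
    proof (cases "F \<in> fun_syms L \<and> length t = fun_arity L F")
      case True
      then show ?thesis using e t by (auto simp: embedding_def tuples_def)
    next
      case False
      then have "fn A F t = {}" "fn B F (map f t) = {}" using st unfolding is_structure_iff by (metis all_not_in_conv length_map)+
      then show ?thesis by simp
    qed
  qed (use e in \<open>auto simp: embedding_def\<close>)
  then show "is_structure L A \<and> is_structure L B \<and> local_iso f A (verts A) B" using st by simp
next
  assume "is_structure L A \<and> is_structure L B \<and> local_iso f A (verts A) B"
  then show "embedding L f A B"
    by (auto simp: embedding_def local_iso_def tuples_def)
qed

lemma substructure_restrict_str:
  assumes "is_structure L P" "closed_in P U"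
  shows "substructure L (restrict_str P U) P"
  unfolding substructure_def embedding_iff
  using assms is_structure_restrict_str[OF assms] by (auto simp: local_iso_def closed_in_def)

text \<open>Since the vertex set determines the substructure, partitions of copies become colourings
  of vertex sets.\<close>

lemma substructure_eq_restrict_str:
  assumes "substructure L A B"
  shows "A = restrict_str B (verts A)" "closed_in B (verts A)"
proof -
  have s: "is_structure L A" "is_structure L B" "local_iso (\<lambda>x. x) A (verts A) B"
    using assms by (auto simp: substructure_def embedding_iff)
  then have w: "wf_str A" using is_structure_wf by blast
  have 1: "fn A F t = (if set t \<subseteq> verts A then fn B F t else {})" for F t
    using local_isoD(5)[OF s(3), of t F] w by (auto simp: wf_str_def)
  have 2: "rels A R = {t \<in> rels B R. set t \<subseteq> verts A}" for R
    using local_isoD(4)[OF s(3), of _ R] wf_str_rels[OF w] by auto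
  show "A = restrict_str B (verts A)"
    by (rule lstructure.equality) (auto simp: fun_eq_iff 1 2 restrict_str_def)
  show "closed_in B (verts A)"
    using closed_in_image[OF s(3) closed_in_verts[OF w]] by simp
qed

section \<open>Finite structures representable in the class\<close>

locale free_amalg =
  fixes L :: "('r, 'f) language" and K :: "('a, 'r, 'f) lstructure set"
  assumes free: "free_amalgamation_class L K"
begin

lemma K_structure: "A \<in> K \<Longrightarrow> is_structure L A"
  and K_finite: "A \<in> K \<Longrightarrow> finite (verts A)"
  using free by (auto simp: free_amalgamation_class_def amalgamation_class_def)

lemma K_wf: "A \<in> K \<Longrightarrow> wf_str A"
  using K_structure is_structure_wf by blast

lemma K_restrict: "A \<in> K \<Longrightarrow> closed_in A U \<Longrightarrow> restrict_str A U \<in> K"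
  using free substructure_restrict_str[OF K_structure]
  unfolding free_amalgamation_class_def amalgamation_class_def hereditary_def by blast

lemma K_free_amalgam:
  assumes "A \<in> K" "B1 \<in> K" "B2 \<in> K" "local_iso \<alpha>1 A (verts A) B1" "local_iso \<alpha>2 A (verts A) B2"
  obtains C \<beta>1 \<beta>2 where "C \<in> K" "local_iso \<beta>1 B1 (verts B1) C" "local_iso \<beta>2 B2 (verts B2) C"
    "\<And>x. x \<in> verts A \<Longrightarrow> \<beta>1 (\<alpha>1 x) = \<beta>2 (\<alpha>2 x)"
    "\<And>x1 x2. x1 \<in> verts B1 \<Longrightarrow> x2 \<in> verts B2 \<Longrightarrow> \<beta>1 x1 = \<beta>2 x2 \<Longrightarrow>
       x1 \<in> \<alpha>1 ` verts A \<and> x2 \<in> \<alpha>2 ` verts A"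
    "verts C = \<beta>1 ` verts B1 \<union> \<beta>2 ` verts B2"
    "\<And>t. related C t \<Longrightarrow> set t \<inter> \<beta>1 ` (verts B1 - \<alpha>1 ` verts A) = {} \<or>
       set t \<inter> \<beta>2 ` (verts B2 - \<alpha>2 ` verts A) = {}"
proof -
  have "embedding L \<alpha>1 A B1 \<and> embedding L \<alpha>2 A B2"
    using assms K_structure by (simp add: embedding_iff)
  then obtain C \<beta>1 \<beta>2 where C: "C \<in> K" "free_amalgamation L A B1 B2 \<alpha>1 \<alpha>2 C \<beta>1 \<beta>2"
    using free assms(1-3) unfolding free_amalgamation_class_def free_amalgamation_property_def by blast
  have wf: "wf_str C" using K_wf C(1) .
  have st: "is_structure L C" using K_structure C(1) .
  show thesis
  proof (rule that[OF C(1)])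
    fix t assume t: "related C t"
    have sub: "set t \<subseteq> verts C" using related_verts[OF wf t] .
    show "set t \<inter> \<beta>1 ` (verts B1 - \<alpha>1 ` verts A) = {} \<or> set t \<inter> \<beta>2 ` (verts B2 - \<alpha>2 ` verts A) = {}"
    proof (rule ccontr)
      assume "\<not> ?thesis"
      then have n: "\<forall>R\<in>rel_syms L. t \<notin> rels C R"
        "\<forall>F\<in>fun_syms L. fun_arity L F = length t \<longrightarrow> fn C F t = {}"
        using C(2) sub unfolding free_amalgamation_def by blast+
      from t show False unfolding related_def
      proof
        assume "\<exists>R. t \<in> rels C R"
        then show False using n(1) st unfolding is_structure_iff by blast
      next
        assume "\<exists>F. fn C F t \<noteq> {}"
        then obtain F y where "y \<in> fn C F t" by blast
        moreover have "F \<in> fun_syms L \<and> fun_arity L F = length t"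
          using calculation st unfolding is_structure_iff by metis
        ultimately show False using n(2) by blast
      qed
    qed
  qed (use C(2) in \<open>auto simp: free_amalgamation_def amalgamation_def embedding_iff\<close>)
qed

text \<open>Induction on the size of \<open>T\<close>. Surjectivity of \<open>\<phi>\<close> is
  carried along because projections are later transferred to \<open>C\<close> through its
  inverse.\<close>

lemma representable_closed:
  fixes S :: "('v, 'r, 'f) lstructure"
  assumes wf: "wf_str S" and fin: "finite (verts S)"
    and irr: "\<And>U. closed_in S U \<Longrightarrow> irreducible_in S U \<Longrightarrow> \<exists>A\<in>K. \<exists>f. local_iso f S U A"
  shows "closed_in S T \<Longrightarrow> \<exists>C\<in>K. \<exists>\<phi>. local_iso \<phi> S T C \<and> \<phi> ` T = verts C"
proof (induction "card T" arbitrary: T rule: less_induct)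
  case less
  have TS: "T \<subseteq> verts S" using less.prems by (simp add: closed_in_def)
  show ?case
  proof (cases "irreducible_in S T")
    case True
    then obtain A f where A: "A \<in> K" "local_iso f S T A" using irr less.prems by blast
    show ?thesis
      using K_restrict[OF A(1) closed_in_image[OF A(2) less.prems]]
        local_iso_into_restrict_str[OF A(2) order_refl]
      by (intro bexI[of _ "restrict_str A (f ` T)"] exI[of _ f]) auto
  next
    case False
    then obtain U1 U2 where U: "splitting S U1 U2" "T \<subseteq> U1 \<union> U2" "\<not> T \<subseteq> U1" "\<not> T \<subseteq> U2"
      using TS unfolding irreducible_in_def by blast
    define T1 where "T1 = T \<inter> U1"
    define T2 where "T2 = T \<inter> U2"
    have c: "closed_in S T1" "closed_in S T2"
      using U(1) less.prems closed_in_Int unfolding T1_def T2_def splitting_def by blast+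
    have T12: "T = T1 \<union> T2" using U(2) by (auto simp: T1_def T2_def)
    have rel: "set t \<subseteq> T1 \<or> set t \<subseteq> T2" if "related S t" "set t \<subseteq> T" for t
      using that U(1,2) unfolding splitting_def T1_def T2_def by blast
    have "finite T" using TS fin finite_subset by blast
    moreover have "T1 \<subset> T" "T2 \<subset> T" using U by (auto simp: T1_def T2_def)
    ultimately have "card T1 < card T" "card T2 < card T" by (auto intro: psubset_card_mono)
    then obtain C1 f1 C2 f2 where C: "C1 \<in> K" "local_iso f1 S T1 C1" "f1 ` T1 = verts C1"
        "C2 \<in> K" "local_iso f2 S T2 C2" "f2 ` T2 = verts C2"
      using less.hyps c by meson
    define T0 where "T0 = T1 \<inter> T2"
    have c0: "closed_in S T0" using c closed_in_Int by (auto simp: T0_def)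
    have l1: "local_iso f1 S T0 C1" using C(2) by (rule local_iso_mono) (auto simp: T0_def)
    have l2: "local_iso f2 S T0 C2" using C(5) by (rule local_iso_mono) (auto simp: T0_def)
    \<comment> \<open>The common part as a member of \<open>K\<close>: it sits inside
      \<open>C1\<close> and reaches \<open>C2\<close> by way of \<open>T0\<close>.\<close>
    define A where "A = restrict_str C1 (f1 ` T0)"
    have vA: "verts A = f1 ` T0" by (simp add: A_def)
    have A: "A \<in> K" unfolding A_def using K_restrict[OF C(1) closed_in_image[OF l1 c0]] .
    define g where "g = inv_into T0 f1"
    have gf: "g (f1 x) = x" if "x \<in> T0" for x
      using that local_isoD(1)[OF l1] by (simp add: g_def)
    have lg: "local_iso g A (verts A) (restrict_str S T0)"
    proof -
      have "local_iso f1 (restrict_str S T0) (verts (restrict_str S T0)) A"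
        using local_iso_into_restrict_str[OF l1 order_refl] by (simp add: A_def)
      from local_iso_inv[OF this] show ?thesis
        using wf_restrict_str[OF wf c0] by (simp add: g_def vA)
    qed
    then have lg': "local_iso g A (verts A) S"
      by (rule local_iso_from_restrict_str) (use c0 in \<open>auto simp: closed_in_def\<close>)
    have gA: "g ` verts A = T0" using gf by (force simp: vA)
    have a2: "local_iso (\<lambda>x. f2 (g x)) A (verts A) C2"
      by (rule local_iso_comp[OF lg' l2]) (simp add: gA)
    have a1: "local_iso (\<lambda>x. x) A (verts A) C1"
      using local_isoD(2)[OF l1] by (auto simp: A_def local_iso_def)
    obtain D b1 b2 where D: "D \<in> K" "local_iso b1 C1 (verts C1) D" "local_iso b2 C2 (verts C2) D"
      "\<And>x. x \<in> verts A \<Longrightarrow> b1 x = b2 (f2 (g x))"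
      "\<And>x1 x2. x1 \<in> verts C1 \<Longrightarrow> x2 \<in> verts C2 \<Longrightarrow> b1 x1 = b2 x2 \<Longrightarrow>
         x1 \<in> (\<lambda>x. x) ` verts A \<and> x2 \<in> (\<lambda>x. f2 (g x)) ` verts A"
      "verts D = b1 ` verts C1 \<union> b2 ` verts C2"
      "\<And>t. related D t \<Longrightarrow> set t \<inter> b1 ` (verts C1 - (\<lambda>x. x) ` verts A) = {} \<or>
         set t \<inter> b2 ` (verts C2 - (\<lambda>x. f2 (g x)) ` verts A) = {}"
      by (rule K_free_amalgam[OF A C(1,4) a1 a2]) blast
    have im2: "(\<lambda>x. f2 (g x)) ` verts A = f2 ` T0" by (simp add: gA flip: image_image)
    \<comment> \<open>On \<open>T0\<close> the branches agree, since the amalgam identifies the two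
      images of the common part.\<close>
    define h where "h x = (if x \<in> T1 then b1 (f1 x) else b2 (f2 x))" for x
    have h2: "h x = b2 (f2 x)" if "x \<in> T2" for x
    proof (cases "x \<in> T1")
      case True
      then have "x \<in> T0" using that by (simp add: T0_def)
      then show ?thesis using D(4)[of "f1 x"] gf True by (simp add: h_def vA)
    qed (simp add: h_def)
    have L1: "local_iso h S T1 D"
      by (rule local_iso_cong[OF _ c(1) order_refl local_iso_comp[OF C(2) D(2)]]) (simp_all add: h_def C)
    have L2: "local_iso h S T2 D"
      by (rule local_iso_cong[OF _ c(2) order_refl local_iso_comp[OF C(5) D(3)]]) (simp_all add: h2 C)
    \<comment> \<open>A tuple crossing from \<open>T1\<close> to \<open>T2\<close> is unrelated in
      \<open>S\<close> by the splitting; freeness gives the same in \<open>D\<close>.\<close>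
    have cross: "\<not> related D (map h t)" if t: "set t \<subseteq> T" "\<not> set t \<subseteq> T1" "\<not> set t \<subseteq> T2" for t
    proof
      assume r: "related D (map h t)"
      obtain x y where x: "x \<in> set t" "x \<in> T1" "x \<notin> T0" and y: "y \<in> set t" "y \<in> T2" "y \<notin> T0"
        using t T12 by (auto simp: T0_def)
      have "f1 x \<in> verts C1 - verts A" "f2 y \<in> verts C2 - f2 ` T0"
        using x y C inj_on_image_mem_iff[OF local_isoD(1)[OF C(2)] x(2), of T0]
          inj_on_image_mem_iff[OF local_isoD(1)[OF C(5)] y(2), of T0] by (auto simp: vA T0_def)
      moreover have "h x = b1 (f1 x)" "h y = b2 (f2 y)" using x y h2 by (auto simp: h_def)
      moreover have "h x \<in> set (map h t)" "h y \<in> set (map h t)" using x y by auto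
      ultimately show False using D(7)[OF r] by (auto simp: im2)
    qed
    have inj: "h x \<noteq> h y" if "x \<in> T1" "y \<in> T2" "y \<notin> T1" for x y
    proof
      assume "h x = h y"
      then have "b1 (f1 x) = b2 (f2 y)" using that h2 by (simp add: h_def)
      then have "f2 y \<in> f2 ` T0" using D(5)[of "f1 x" "f2 y"] that C im2 by blast
      then show False
        using that inj_on_image_mem_iff[OF local_isoD(1)[OF C(5)] that(2), of T0] by (auto simp: T0_def)
    qed
    have "local_iso h S T D"
      unfolding local_iso_def
    proof (intro conjI allI impI)
      have "h x \<noteq> h y" if xy: "x \<in> T" "y \<in> T" "x \<noteq> y" for x y
      proof -
        consider "x \<in> T1" "y \<in> T1" | "x \<in> T2" "y \<in> T2" | "x \<in> T1" "y \<in> T2" "y \<notin> T1"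
          | "y \<in> T1" "x \<in> T2" "x \<notin> T1" using xy T12 by blast
        then show ?thesis
          using local_isoD(1)[OF L1] local_isoD(1)[OF L2] inj xy(3) unfolding inj_on_def by cases metis+
      qed
      then show "inj_on h T" unfolding inj_on_def by blast
      show "h ` T \<subseteq> verts D" using local_isoD(2)[OF L1] local_isoD(2)[OF L2] by (simp add: T12 image_Un)
      show "(t \<in> rels S R) = (map h t \<in> rels D R)" if "set t \<subseteq> T" for R t
        using local_isoD(4)[OF L1, of t R] local_isoD(4)[OF L2, of t R] cross[OF that] rel[OF _ that]
        by (auto simp: related_def)
      show "h ` fn S F t = fn D F (map h t)" if "set t \<subseteq> T" for F t
      proof (cases "set t \<subseteq> T1 \<or> set t \<subseteq> T2")
        case True
        then show ?thesis using local_isoD(5)[OF L1, of t F] local_isoD(5)[OF L2, of t F] by metis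
      next
        case False
        then show ?thesis using cross[OF that] rel[OF _ that] by (auto simp: related_def)
      qed
    qed
    moreover have "h ` T = verts D"
    proof -
      have "h ` T1 = b1 ` verts C1" "h ` T2 = b2 ` verts C2"
        using h2 by (auto simp: h_def C(3,6)[symmetric])
      then show ?thesis using D(6) by (simp add: T12 image_Un)
    qed
    ultimately show ?thesis using D(1) by blast
  qed
qed

lemma representable:
  fixes S :: "('v, 'r, 'f) lstructure"
  assumes "wf_str S" "finite (verts S)"
    "\<And>U. closed_in S U \<Longrightarrow> irreducible_in S U \<Longrightarrow> \<exists>A\<in>K. \<exists>f. local_iso f S U A"
  obtains C \<phi> where "C \<in> K" "local_iso \<phi> S (verts S) C" "\<phi> ` verts S = verts C"
  using representable_closed[OF assms closed_in_verts[OF assms(1)]] by blast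

end

section \<open>Gluing copies of a structure\<close>

definition glue_map :: "'a set \<Rightarrow> ('l \<Rightarrow> 'a \<Rightarrow> 'v) \<Rightarrow> 'l \<Rightarrow> 'a \<Rightarrow> 'v + 'l \<times> 'a" where
  "glue_map Y \<psi> l x = (if x \<in> Y then Inl (\<psi> l x) else Inr (l, x))"

text \<open>The free amalgam of copies of \<open>P\<close>, one for each \<open>l\<close>, attached
  to \<open>D\<close> along their parts \<open>Y\<close>; different copies meet only inside
  \<open>D\<close>.\<close>

definition glue ::
  "('v, 'r, 'f) lstructure \<Rightarrow> ('a, 'r, 'f) lstructure \<Rightarrow> 'a set \<Rightarrow> 'l set \<Rightarrow> ('l \<Rightarrow> 'a \<Rightarrow> 'v) \<Rightarrow>
    ('v + 'l \<times> 'a, 'r, 'f) lstructure" where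
  "glue D P Y \<Lambda> \<psi> =
     \<lparr>verts = Inl ` verts D \<union> Inr ` (\<Lambda> \<times> (verts P - Y)),
      rels = (\<lambda>R. map Inl ` rels D R \<union> (\<Union>l\<in>\<Lambda>. map (glue_map Y \<psi> l) ` rels P R)),
      fn = (\<lambda>F t. (\<Union>s\<in>{s. map Inl s = t}. Inl ` fn D F s) \<union>
             (\<Union>l\<in>\<Lambda>. \<Union>s\<in>{s. map (glue_map Y \<psi> l) s = t}. glue_map Y \<psi> l ` fn P F s))\<rparr>"

locale gluing =
  fixes D :: "('v, 'r, 'f) lstructure" and P :: "('a, 'r, 'f) lstructure"
    and Y :: "'a set" and \<Lambda> :: "'l set" and \<psi> :: "'l \<Rightarrow> 'a \<Rightarrow> 'v"
  assumes wfD: "wf_str D" and wfP: "wf_str P" and closedY: "closed_in P Y"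
    and psi: "l \<in> \<Lambda> \<Longrightarrow> local_iso (\<psi> l) P Y D"
begin

abbreviation "G \<equiv> glue D P Y \<Lambda> \<psi>"
abbreviation "gm \<equiv> glue_map Y \<psi>"

lemma verts_glue: "verts G = Inl ` verts D \<union> Inr ` (\<Lambda> \<times> (verts P - Y))"
  by (simp add: glue_def)

lemma finite_verts_glue: "finite (verts D) \<Longrightarrow> finite (verts P) \<Longrightarrow> finite \<Lambda> \<Longrightarrow> finite (verts G)"
  by (simp add: verts_glue)

lemma rels_glueE:
  assumes "t \<in> rels G R"
  obtains s where "s \<in> rels D R" "t = map Inl s"
  | l s where "l \<in> \<Lambda>" "s \<in> rels P R" "t = map (gm l) s"
  using assms by (auto simp: glue_def)

lemma fn_glueE:
  assumes "y \<in> fn G F t"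
  obtains s z where "z \<in> fn D F s" "t = map Inl s" "y = Inl z"
  | l s z where "l \<in> \<Lambda>" "z \<in> fn P F s" "t = map (gm l) s" "y = gm l z"
  using assms by (auto simp: glue_def)

lemma rels_glueI:
  "s \<in> rels D R \<Longrightarrow> map Inl s \<in> rels G R"
  "l \<in> \<Lambda> \<Longrightarrow> u \<in> rels P R \<Longrightarrow> map (gm l) u \<in> rels G R"
  by (auto simp: glue_def)

lemma fn_glueI:
  "z \<in> fn D F s \<Longrightarrow> Inl z \<in> fn G F (map Inl s)"
  "l \<in> \<Lambda> \<Longrightarrow> x \<in> fn P F u \<Longrightarrow> gm l x \<in> fn G F (map (gm l) u)"
  unfolding glue_def lstructure.simps by blast+

lemma glue_map_verts: "l \<in> \<Lambda> \<Longrightarrow> x \<in> verts P \<Longrightarrow> gm l x \<in> verts G"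
  using local_isoD(3)[OF psi] by (auto simp: glue_map_def verts_glue)

lemma inj_on_glue_map: "l \<in> \<Lambda> \<Longrightarrow> inj_on (gm l) (verts P)"
  using local_isoD(1)[OF psi] by (auto simp: glue_map_def inj_on_def)

lemma map_glue_map_Inl:
  assumes "map (gm l) s = map Inl t"
  shows "set s \<subseteq> Y" "t = map (\<psi> l) s"
proof -
  have "gm l x \<in> range Inl" if "x \<in> set s" for x
  proof -
    have "gm l x \<in> set (map (gm l) s)" using that by simp
    then show ?thesis unfolding assms by auto
  qed
  then show s: "set s \<subseteq> Y" by (force simp: glue_map_def split: if_splits)
  then have "map (gm l) s = map Inl (map (\<psi> l) s)" by (auto simp: glue_map_def)
  then show "t = map (\<psi> l) s" using assms by (metis inj_Inl inj_map_eq_map)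
qed

text \<open>An entry outside \<open>Y\<close> carries the name of its copy, so a tuple arising in
  two ways lies over the common part.\<close>

lemma map_glue_map_eq:
  assumes "map (gm l) s = map (gm l') t" "l \<in> \<Lambda>" "l' \<in> \<Lambda>" "set s \<subseteq> verts P" "set t \<subseteq> verts P"
  shows "l = l' \<and> s = t \<or> set s \<subseteq> Y \<and> set t \<subseteq> Y \<and> map (\<psi> l) s = map (\<psi> l') t"
proof (cases "set t \<subseteq> Y")
  case True
  then have "map (gm l') t = map Inl (map (\<psi> l') t)" by (auto simp: glue_map_def)
  then show ?thesis using map_glue_map_Inl[of l s "map (\<psi> l') t"] assms(1) True by simp
next
  case False
  then obtain i where i: "i < length t" "t ! i \<notin> Y" unfolding subset_iff in_set_conv_nth by blast
  have "length s = length t" using assms(1) map_eq_imp_length_eq by blast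
  then have "gm l (s ! i) = gm l' (t ! i)" using i assms(1) by (metis nth_map)
  then have "l = l'" using i by (auto simp: glue_map_def split: if_splits)
  moreover have "inj_on (gm l') (set s \<union> set t)"
    using inj_on_subset[OF inj_on_glue_map[OF assms(3)]] assms(4,5) by simp
  ultimately have "s = t" using map_inj_on[of "gm l'" s t] assms(1) by simp
  with \<open>l = l'\<close> show ?thesis by simp
qed

lemma wf_glue: "wf_str G"
  unfolding wf_str_def
proof (intro conjI allI impI)
  show "set t \<subseteq> verts G" if "t \<in> rels G R" for R t
    using that
  proof (cases rule: rels_glueE)
    case (1 s)
    then show ?thesis using wf_str_rels[OF wfD 1(1)] by (auto simp: verts_glue)
  next
    case (2 l s)
    then show ?thesis using wf_str_rels[OF wfP 2(2)] glue_map_verts[OF 2(1)] by auto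
  qed
next
  fix F t assume n: "\<not> set t \<subseteq> verts G"
  show "fn G F t = {}"
  proof (rule ccontr)
    assume "fn G F t \<noteq> {}"
    then obtain y where "y \<in> fn G F t" by blast
    then have "set t \<subseteq> verts G"
    proof (cases rule: fn_glueE)
      case (1 s z)
      then show ?thesis using wf_str_fn_arg[OF wfD 1(1)] by (auto simp: verts_glue)
    next
      case (2 l s z)
      then show ?thesis using wf_str_fn_arg[OF wfP 2(2)] glue_map_verts[OF 2(1)] by auto
    qed
    then show False using n by simp
  qed
next
  fix F t
  show "fn G F t \<subseteq> verts G"
  proof
    fix y assume "y \<in> fn G F t"
    then show "y \<in> verts G"
    proof (cases rule: fn_glueE)
      case (1 s z)
      then show ?thesis using wf_str_fn[OF wfD] by (auto simp: verts_glue)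
    next
      case (2 l s z)
      then show ?thesis using wf_str_fn[OF wfP] glue_map_verts[OF 2(1)] by auto
    qed
  qed
qed

text \<open>The copies add nothing on \<open>D\<close>: whatever they contribute there comes from
  tuples in the closed set \<open>Y\<close>, and \<open>\<psi> l\<close> transfers these
  exactly.\<close>

lemma local_iso_Inl: "local_iso Inl D (verts D) G"
proof (rule local_isoI)
  fix R t assume t: "set t \<subseteq> verts D" "map Inl t \<in> rels G R"
  from t(2) show "t \<in> rels D R"
  proof (cases rule: rels_glueE)
    case (1 s)
    then show ?thesis by (metis inj_Inl inj_map_eq_map)
  next
    case (2 l s)
    then show ?thesis using map_glue_map_Inl[of l s t] local_isoD(4)[OF psi[OF 2(1)], of s] by simp
  qed
next
  fix F t y assume t: "set t \<subseteq> verts D" "y \<in> fn G F (map Inl t)"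
  from t(2) show "y \<in> Inl ` fn D F t"
  proof (cases rule: fn_glueE)
    case (1 s z)
    then have "t = s" by (metis inj_Inl inj_map_eq_map)
    then show ?thesis using 1 by blast
  next
    case (2 l s z)
    then have s: "set s \<subseteq> Y" "t = map (\<psi> l) s" using map_glue_map_Inl[of l s t] by simp_all
    then have "z \<in> Y" using closed_in_fn[OF closedY s(1)] 2 by blast
    moreover have "\<psi> l z \<in> fn D F t" using local_isoD(5)[OF psi[OF 2(1)] s(1)] s(2) 2(2) by simp
    ultimately show ?thesis using 2 by (simp add: glue_map_def)
  qed
qed (auto simp: verts_glue intro: rels_glueI fn_glueI)

lemma local_iso_glue_map:
  assumes l: "l \<in> \<Lambda>"
  shows "local_iso (gm l) P (verts P) G"
proof (rule local_isoI)
  fix R t assume t: "set t \<subseteq> verts P" "map (gm l) t \<in> rels G R"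
  from t(2) show "t \<in> rels P R"
  proof (cases rule: rels_glueE)
    case (1 s)
    then show ?thesis using map_glue_map_Inl[of l t s] local_isoD(4)[OF psi[OF l]] by blast
  next
    case (2 l' s)
    then show ?thesis
      using map_glue_map_eq[OF _ l 2(1) t(1) wf_str_rels[OF wfP 2(2)]]
        local_isoD(4)[OF psi[OF l], of t R] local_isoD(4)[OF psi[OF 2(1)], of s R] by auto
  qed
next
  fix F t y assume t: "set t \<subseteq> verts P" "y \<in> fn G F (map (gm l) t)"
  from t(2) show "y \<in> gm l ` fn P F t"
  proof (cases rule: fn_glueE)
    case (1 s z)
    then have s: "set t \<subseteq> Y" "s = map (\<psi> l) t" using map_glue_map_Inl[of l t s] by simp_all
    then obtain x where x: "x \<in> fn P F t" "z = \<psi> l x"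
      using 1 local_isoD(5)[OF psi[OF l] s(1)] by auto
    then have "x \<in> Y" using closed_in_fn[OF closedY s(1)] by blast
    then show ?thesis using 1 x by (force simp: glue_map_def)
  next
    case (2 l' s z)
    from map_glue_map_eq[OF 2(3) l 2(1) t(1) wf_str_fn_arg[OF wfP 2(2)]] show ?thesis
    proof (elim disjE conjE)
      assume "l = l'" "t = s" then show ?thesis using 2 by blast
    next
      assume Y: "set t \<subseteq> Y" "set s \<subseteq> Y" "map (\<psi> l) t = map (\<psi> l') s"
      then have "\<psi> l ` fn P F t = \<psi> l' ` fn P F s"
        using local_isoD(5)[OF psi[OF l] Y(1), of F] local_isoD(5)[OF psi[OF 2(1)] Y(2), of F] by simp
      then obtain x where x: "x \<in> fn P F t" "\<psi> l' z = \<psi> l x" using 2(2) by blast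
      then have "x \<in> Y" "z \<in> Y" using closed_in_fn[OF closedY] Y 2(2) by blast+
      then show ?thesis using x 2(4) by (force simp: glue_map_def)
    qed
  qed
qed (use l in \<open>auto intro: rels_glueI fn_glueI glue_map_verts inj_on_glue_map\<close>)

lemma related_glueE:
  assumes "related G t"
  obtains s where "related D s" "t = map Inl s"
  | l s where "l \<in> \<Lambda>" "related P s" "t = map (gm l) s"
proof -
  from assms consider R where "t \<in> rels G R" | F y where "y \<in> fn G F t"
    unfolding related_def by blast
  then show thesis
  proof cases
    case (1 R)
    then show ?thesis
    proof (cases rule: rels_glueE)
      case (1 s)
      then show ?thesis using that(1)[of s] by (auto simp: related_def)
    next
      case (2 l s)
      then show ?thesis using that(2)[of l s] by (auto simp: related_def)
    qed
  next
    case (2 F y)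
    then show ?thesis
    proof (cases rule: fn_glueE)
      case (1 s z)
      then show ?thesis using that(1)[of s] by (auto simp: related_def)
    next
      case (2 l s z)
      then show ?thesis using that(2)[of l s] by (auto simp: related_def)
    qed
  qed
qed

text \<open>If \<open>U\<close> has a vertex private to copy \<open>l\<close>, then this copy and
  the complement of its private part form a splitting. The private vertex excludes the second
  side.\<close>

lemma irreducible_glue:
  assumes U: "irreducible_in G U" and n: "\<not> U \<subseteq> Inl ` verts D"
  obtains l where "l \<in> \<Lambda>" "U \<subseteq> gm l ` verts P"
proof -
  have "U \<subseteq> verts G" using U by (simp add: irreducible_in_def)
  then obtain l z where lz: "Inr (l, z) \<in> U" "l \<in> \<Lambda>" "z \<in> verts P - Y"
    using n unfolding verts_glue by fast
  define T where "T = verts G - Inr ` ({l} \<times> (verts P - Y))"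
  have T1: "closed_in G (gm l ` verts P)"
    using closed_in_image[OF local_iso_glue_map[OF lz(2)] closed_in_verts[OF wfP]] .
  have gmT: "gm l' x \<in> T" if "l' \<in> \<Lambda>" "x \<in> verts P" "l' \<noteq> l \<or> x \<in> Y" for l' x
    using glue_map_verts[OF that(1,2)] that(3) by (auto simp: T_def glue_map_def)
  have T2: "closed_in G T"
    unfolding closed_in_def
  proof (intro conjI allI impI subsetI)
    fix F t y assume t: "set t \<subseteq> T" "y \<in> fn G F t"
    from t(2) show "y \<in> T"
    proof (cases rule: fn_glueE)
      case (1 s z)
      then show ?thesis using wf_str_fn[OF wfD] by (auto simp: T_def verts_glue)
    next
      case (2 l' s z)
      have s: "set s \<subseteq> verts P" "z \<in> verts P"
        using wf_str_fn_arg[OF wfP 2(2)] wf_str_fn[OF wfP] 2(2) by auto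
      have "z \<in> Y" if "l' = l"
      proof -
        have "x \<in> Y" if "x \<in> set s" for x
        proof -
          have "gm l' x \<in> T" using t(1) 2(3) that by auto
          then show ?thesis using \<open>l' = l\<close> that s by (auto simp: T_def glue_map_def split: if_splits)
        qed
        then show ?thesis using closed_in_fn[OF closedY] 2(2) by blast
      qed
      then show ?thesis using gmT[OF 2(1) s(2)] 2(4) by blast
    qed
  qed (auto simp: T_def)
  have "splitting G (gm l ` verts P) T"
    unfolding splitting_def
  proof (intro conjI allI impI T1 T2)
    fix t assume "related G t \<and> set t \<subseteq> gm l ` verts P \<union> T"
    then have "related G t" by simp
    then show "set t \<subseteq> gm l ` verts P \<or> set t \<subseteq> T"
    proof (cases rule: related_glueE)
      case (1 s)
      then show ?thesis using related_verts[OF wfD 1(1)] by (auto simp: T_def verts_glue)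
    next
      case (2 l' s)
      then have "set s \<subseteq> verts P" using related_verts[OF wfP] by blast
      then show ?thesis using 2 gmT[OF 2(1)] by (cases "l' = l") auto
    qed
  qed
  moreover have "U \<subseteq> gm l ` verts P \<union> T"
    using \<open>U \<subseteq> verts G\<close> by (force simp: T_def verts_glue glue_map_def)
  ultimately have "U \<subseteq> gm l ` verts P \<or> U \<subseteq> T" using irreducible_inD[OF U] by blast
  moreover have "Inr (l, z) \<notin> T" using lz by (auto simp: T_def)
  ultimately show thesis using that lz by blast
qed

lemma irreducible_glue_cases:
  assumes U: "irreducible_in G U"
  obtains V where "irreducible_in D V" "U = Inl ` V"
  | l V where "l \<in> \<Lambda>" "irreducible_in P V" "U = gm l ` V"
proof (cases "U \<subseteq> Inl ` verts D")
  case True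
  then obtain V where V: "V \<subseteq> verts D" "U = Inl ` V" by (auto simp: subset_image_iff)
  then show ?thesis using that(1) irreducible_in_vimage[OF local_iso_Inl wfD V(1)] U by blast
next
  case False
  then obtain l where l: "l \<in> \<Lambda>" "U \<subseteq> gm l ` verts P" using irreducible_glue[OF U] by blast
  then obtain V where V: "V \<subseteq> verts P" "U = gm l ` V" by (auto simp: subset_image_iff)
  then show ?thesis
    using that(2)[OF l(1)] irreducible_in_vimage[OF local_iso_glue_map[OF l(1)] wfP V(1)] U by blast
qed

text \<open>Only \<open>D\<close> carries a condition: an irreducible set that is not inside
  \<open>D\<close> lies in a copy of \<open>P\<close>, which is already in \<open>K\<close>.\<close>

lemma representable_glue:
  assumes K: "free_amalg L K" and P: "P \<in> K"
    and D: "\<And>V. irreducible_in D V \<Longrightarrow> \<exists>B\<in>K. \<exists>g. local_iso g D V B"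
    and fin: "finite (verts D)" "finite \<Lambda>"
  obtains Q \<phi> where "Q \<in> K" "local_iso \<phi> G (verts G) Q" "\<phi> ` verts G = verts Q"
proof -
  interpret free_amalg L K by (rule K)
  have "\<exists>C\<in>K. \<exists>h. local_iso h G U C" if U: "irreducible_in G U" for U
    using U
  proof (cases rule: irreducible_glue_cases)
    case (1 V)
    then have V: "V \<subseteq> verts D" by (simp add: irreducible_in_def)
    obtain B g where B: "B \<in> K" "local_iso g D V B" using D[OF 1(1)] by blast
    have li: "local_iso (inv_into (verts D) Inl) G U D"
      unfolding 1(2) by (rule local_iso_inv_into[OF local_iso_Inl wfD V])
    moreover have "inv_into (verts D) Inl ` U = V"
      using V by (simp add: 1(2) inv_into_image_cancel)
    ultimately show ?thesis using local_iso_comp[OF li B(2)] B(1) by blast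
  next
    case (2 l V)
    then have "V \<subseteq> verts P" by (simp add: irreducible_in_def)
    then show ?thesis
      using local_iso_inv_into[OF local_iso_glue_map[OF 2(1)] wfP] P 2(3) by blast
  qed
  then show thesis
    using representable[OF wf_glue finite_verts_glue[OF fin(1) K_finite[OF P] fin(2)]] that by blast
qed

end

section \<open>The partite lemma\<close>

text \<open>
  In the usual partite construction \<open>\<pi>\<close> is a homomorphism-embedding into a base structure. Here
  the base is a mere set, carrying some structures \<open>D\<close> on subsets of it, and the condition
  \<open>partite\<close> is imposed for each of these separately. Sections are the copies of \<open>D\<close> compatible
  with \<open>\<pi>\<close>; colourings are colourings of their vertex sets.
\<close>

definition fibre :: "('a, 'r, 'f) lstructure \<Rightarrow> ('a \<Rightarrow> 'x) \<Rightarrow> ('x, 'r, 'f) lstructure \<Rightarrow> 'a set" where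
  "fibre P \<pi> D = {x \<in> verts P. \<pi> x \<in> verts D}"

definition sections ::
  "('a, 'r, 'f) lstructure \<Rightarrow> ('a \<Rightarrow> 'x) \<Rightarrow> ('x, 'r, 'f) lstructure \<Rightarrow> 'a set set" where
  "sections P \<pi> D = {U. closed_in P U \<and> local_iso \<pi> P U D \<and> \<pi> ` U = verts D}"

definition partite ::
  "('a, 'r, 'f) lstructure \<Rightarrow> ('a \<Rightarrow> 'x) \<Rightarrow> ('x, 'r, 'f) lstructure \<Rightarrow> bool" where
  "partite P \<pi> D \<longleftrightarrow> closed_in P (fibre P \<pi> D) \<and>
     (\<forall>U. irreducible_in P U \<and> U \<subseteq> fibre P \<pi> D \<longrightarrow> local_iso \<pi> P U D)"

lemma partite_closed: "partite P \<pi> D \<Longrightarrow> closed_in P (fibre P \<pi> D)"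
  and partite_local_iso:
    "partite P \<pi> D \<Longrightarrow> irreducible_in P U \<Longrightarrow> U \<subseteq> fibre P \<pi> D \<Longrightarrow> local_iso \<pi> P U D"
  by (simp_all add: partite_def)

text \<open>Lets \<open>partite\<close> be applied tuple by tuple, as a related tuple with its
  values is irreducible.\<close>

lemma partite_related:
  assumes "partite P \<pi> D" "wf_str P" "set t \<subseteq> fibre P \<pi> D" "related P t"
  shows "local_iso \<pi> P (set t \<union> fn P F t) D"
  using irreducible_in_related[OF assms(2,4)] closed_in_fn[OF partite_closed[OF assms(1)] assms(3)] assms(3)
  by (intro partite_local_iso[OF assms(1)]) auto

lemma finite_sections: "finite (verts P) \<Longrightarrow> finite (sections P \<pi> D)"
  by (rule finite_subset[of _ "Pow (verts P)"]) (auto simp: sections_def closed_in_def)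

lemma sections_image:
  assumes "local_iso \<psi> P (verts P) Q" "\<And>x. x \<in> verts P \<Longrightarrow> \<rho> (\<psi> x) = \<pi> x" "U \<in> sections P \<pi> D"
  shows "\<psi> ` U \<in> sections Q \<rho> D"
proof -
  have U: "closed_in P U" "local_iso \<pi> P U D" "\<pi> ` U = verts D" "U \<subseteq> verts P"
    using assms(3) by (auto simp: sections_def closed_in_def)
  have l: "local_iso \<psi> P U Q" by (rule local_iso_mono[OF assms(1) U(4)])
  have "local_iso (\<lambda>x. \<rho> (\<psi> x)) P U D"
    using U by (intro local_iso_cong[OF _ U(1) order_refl U(2)]) (auto simp: assms(2))
  moreover have "\<rho> ` \<psi> ` U = verts D"
    unfolding image_image U(3)[symmetric] using U(4) assms(2) by (intro image_cong) auto
  ultimately show ?thesis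
    using closed_in_image[OF l U(1)] local_iso_factor[OF l] by (simp add: sections_def)
qed

lemma section_inverse:
  assumes "U \<in> sections P \<pi> D" "wf_str P"
  shows "local_iso (inv_into U \<pi>) D (verts D) P"
proof -
  have U: "closed_in P U" "local_iso \<pi> P U D" "\<pi> ` U = verts D" using assms by (auto simp: sections_def)
  have "local_iso (inv_into (verts (restrict_str P U)) \<pi>) D (verts D) (restrict_str P U)"
    using U wf_restrict_str[OF assms(2) U(1)] by (intro local_iso_inv) simp_all
  then show ?thesis
    using U(1) by (intro local_iso_from_restrict_str[of _ D "verts D" P U]) (auto simp: closed_in_def)
qed

lemma section_inv_into:
  assumes "U \<in> sections P \<pi> D"
  shows "x \<in> U \<Longrightarrow> inv_into U \<pi> (\<pi> x) = x"
    and "i \<in> verts D \<Longrightarrow> inv_into U \<pi> i \<in> U"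
    and "i \<in> verts D \<Longrightarrow> \<pi> (inv_into U \<pi> i) = i"
    and "U \<subseteq> fibre P \<pi> D"
  using assms local_isoD(1)[of \<pi> P U D]
  by (auto simp: sections_def inv_into_f_f inv_into_into f_inv_into_f fibre_def closed_in_def)

lemma partite_iso:
  assumes \<phi>: "local_iso \<phi> G (verts G) Q" "\<phi> ` verts G = verts Q" and wf: "wf_str G" "wf_str Q"
    and G: "partite G \<rho> E"
  shows "partite Q (\<lambda>x. \<rho> (inv_into (verts G) \<phi> x)) E"
proof -
  let ?g = "inv_into (verts G) \<phi>"
  have g: "local_iso ?g Q (verts Q) G" using local_iso_inv[OF \<phi>(1) wf(1) \<phi>(2)] .
  have f: "fibre Q (\<lambda>x. \<rho> (?g x)) E = {x \<in> verts Q. ?g x \<in> fibre G \<rho> E}"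
    using local_isoD(3)[OF g] by (auto simp: fibre_def)
  show ?thesis unfolding partite_def
  proof (intro conjI allI impI)
    show "closed_in Q (fibre Q (\<lambda>x. \<rho> (?g x)) E)"
      unfolding f by (rule closed_in_vimage[OF g partite_closed[OF G] wf(2)])
    fix U assume U: "irreducible_in Q U \<and> U \<subseteq> fibre Q (\<lambda>x. \<rho> (?g x)) E"
    then have UQ: "U \<subseteq> verts Q" by (simp add: irreducible_in_def)
    then have "\<phi> ` ?g ` U = U" using \<phi>(2) by (simp add: image_inv_into_cancel)
    moreover have "?g ` U \<subseteq> verts G" using UQ local_isoD(3)[OF g] by auto
    ultimately have "irreducible_in G (?g ` U)"
      using U by (intro irreducible_in_vimage[OF \<phi>(1) wf(1)]) auto
    then have "local_iso \<rho> G (?g ` U) E"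
      using U f by (intro partite_local_iso[OF G]) auto
    then show "local_iso (\<lambda>x. \<rho> (?g x)) Q U E"
      by (rule local_iso_comp[OF local_iso_mono[OF g UQ]]) simp
  qed
qed

section \<open>Fibre powers and the embeddings along lines\<close>

text \<open>The fibre product over \<open>\<pi>\<close> of \<open>n\<close> copies of the part of
  \<open>P\<close> on \<open>Y\<close>. Function values are products of the coordinate values, cut
  down to points with one common projection.\<close>

definition power_str ::
  "nat \<Rightarrow> ('a, 'r, 'f) lstructure \<Rightarrow> ('a \<Rightarrow> 'x) \<Rightarrow> 'a set \<Rightarrow> (nat \<Rightarrow> 'a, 'r, 'f) lstructure" where
  "power_str n P \<pi> Y =
     (let V = {x \<in> {..<n} \<rightarrow>\<^sub>E Y. \<forall>j<n. \<pi> (x j) = \<pi> (x 0)} in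
      \<lparr>verts = V,
       rels = (\<lambda>R. {t. set t \<subseteq> V \<and> (\<forall>j<n. map (\<lambda>x. x j) t \<in> rels P R)}),
       fn = (\<lambda>F t. {y \<in> V. set t \<subseteq> V \<and> (\<forall>j<n. y j \<in> fn P F (map (\<lambda>x. x j) t))})\<rparr>)"

text \<open>A Hales--Jewett line over the alphabet of sections, read as a map on vertices: a fixed
  coordinate moves \<open>x\<close> to the vertex of its section with the same projection.\<close>

definition line_map :: "nat \<Rightarrow> ('a \<Rightarrow> 'x) \<Rightarrow> nat set \<times> (nat \<Rightarrow> 'a set) \<Rightarrow> 'a \<Rightarrow> nat \<Rightarrow> 'a" where
  "line_map n \<pi> l x = (\<lambda>j\<in>{..<n}. if j \<in> fst l then x else inv_into (snd l j) \<pi> (\<pi> x))"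

text \<open>A word of sections spans a section of the power; this parametrises it by the
  base.\<close>

definition word_map :: "nat \<Rightarrow> ('a \<Rightarrow> 'x) \<Rightarrow> (nat \<Rightarrow> 'a set) \<Rightarrow> 'x \<Rightarrow> nat \<Rightarrow> 'a" where
  "word_map n \<pi> w i = (\<lambda>j\<in>{..<n}. inv_into (w j) \<pi> i)"

lemma line_map_section:
  assumes "U \<in> sections P \<pi> D" "x \<in> U"
  shows "line_map n \<pi> (M, u) x = word_map n \<pi> (line_point n M u U) (\<pi> x)"
  using section_inv_into(1)[OF assms]
  by (auto simp: line_map_def word_map_def line_point_def fun_eq_iff)

locale powering =
  fixes P :: "('a, 'r, 'f) lstructure" and \<pi> :: "'a \<Rightarrow> 'x" and D :: "('x, 'r, 'f) lstructure" and n :: nat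
  assumes wfP: "wf_str P" and n: "n > 0" and part: "partite P \<pi> D"
begin

abbreviation "Y \<equiv> fibre P \<pi> D"
abbreviation "W \<equiv> power_str n P \<pi> Y"

lemma verts_W: "x \<in> verts W \<longleftrightarrow> x \<in> {..<n} \<rightarrow>\<^sub>E Y \<and> (\<forall>j<n. \<pi> (x j) = \<pi> (x 0))"
  and rels_W: "t \<in> rels W R \<longleftrightarrow> set t \<subseteq> verts W \<and> (\<forall>j<n. map (\<lambda>x. x j) t \<in> rels P R)"
  and fn_W: "y \<in> fn W F t \<longleftrightarrow> y \<in> verts W \<and> set t \<subseteq> verts W \<and> (\<forall>j<n. y j \<in> fn P F (map (\<lambda>x. x j) t))"
  by (simp_all add: power_str_def Let_def)

lemma W_coord: "x \<in> verts W \<Longrightarrow> j < n \<Longrightarrow> x j \<in> Y"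
  and W_proj: "x \<in> verts W \<Longrightarrow> j < n \<Longrightarrow> \<pi> (x j) = \<pi> (x 0)"
  unfolding verts_W by blast+

lemma wf_W: "wf_str W"
  unfolding wf_str_def using rels_W fn_W by blast

lemma finite_W: "finite (verts P) \<Longrightarrow> finite (verts W)"
  by (rule finite_subset[of _ "{..<n} \<rightarrow>\<^sub>E Y"]) (auto simp only: verts_W, simp add: fibre_def finite_PiE)

lemma closed_in_W:
  assumes "closed_in P T" "j < n"
  shows "closed_in W {x \<in> verts W. x j \<in> T}"
  unfolding closed_in_def
proof (intro conjI allI impI subsetI)
  fix F t y assume t: "set t \<subseteq> {x \<in> verts W. x j \<in> T}" "y \<in> fn W F t"
  then have "set (map (\<lambda>x. x j) t) \<subseteq> T" by auto
  then have "fn P F (map (\<lambda>x. x j) t) \<subseteq> T" by (rule closed_in_fn[OF assms(1)])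
  then show "y \<in> {x \<in> verts W. x j \<in> T}" using t(2) assms(2) by (auto simp: fn_W)
qed auto

lemma related_coord: "related W t \<Longrightarrow> j < n \<Longrightarrow> related P (map (\<lambda>x. x j) t)"
  unfolding related_def using fn_W rels_W by blast

text \<open>A splitting of \<open>P\<close> pulls back along a coordinate to a splitting of the
  power, because related tuples of the power are related in every coordinate.\<close>

lemma irreducible_coord:
  assumes U: "irreducible_in W U" and j: "j < n"
  shows "irreducible_in P ((\<lambda>x. x j) ` U)"
proof -
  have UW: "U \<subseteq> verts W" using U by (simp add: irreducible_in_def)
  show ?thesis unfolding irreducible_in_def
  proof (intro conjI allI impI)
    show "(\<lambda>x. x j) ` U \<subseteq> verts P" using UW W_coord[OF _ j] by (auto simp: fibre_def)
    fix T1 T2 assume T: "splitting P T1 T2 \<and> (\<lambda>x. x j) ` U \<subseteq> T1 \<union> T2"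
    let ?S = "\<lambda>T. {x \<in> verts W. x j \<in> T}"
    have "splitting W (?S T1) (?S T2)"
      unfolding splitting_def
    proof (intro conjI allI impI)
      show "closed_in W (?S T1)" "closed_in W (?S T2)"
        using T closed_in_W[OF _ j] by (simp_all add: splitting_def)
      fix t assume t: "related W t \<and> set t \<subseteq> ?S T1 \<union> ?S T2"
      then have "related P (map (\<lambda>x. x j) t)" "set (map (\<lambda>x. x j) t) \<subseteq> T1 \<union> T2"
        using related_coord[OF _ j] by auto
      then have "set (map (\<lambda>x. x j) t) \<subseteq> T1 \<or> set (map (\<lambda>x. x j) t) \<subseteq> T2"
        using T unfolding splitting_def by blast
      then show "set t \<subseteq> ?S T1 \<or> set t \<subseteq> ?S T2" using t by auto
    qed
    moreover have "U \<subseteq> ?S T1 \<union> ?S T2" using T UW by auto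
    ultimately have "U \<subseteq> ?S T1 \<or> U \<subseteq> ?S T2" by (rule irreducible_inD[OF U])
    then show "(\<lambda>x. x j) ` U \<subseteq> T1 \<or> (\<lambda>x. x j) ` U \<subseteq> T2" by auto
  qed
qed

text \<open>Over \<open>E\<close>, every coordinate image of an irreducible set is irreducible and
  hence mapped isomorphically by \<open>\<pi>\<close>. All coordinates have the same projection, so
  \<open>E\<close> decides all of them alike.\<close>

lemma partite_W:
  assumes E: "partite P \<pi> E"
  shows "partite W (\<lambda>x. \<pi> (x 0)) E"
  unfolding partite_def
proof (intro conjI allI impI)
  have "fibre W (\<lambda>x. \<pi> (x 0)) E = {x \<in> verts W. x 0 \<in> fibre P \<pi> E}"
    using W_coord[OF _ n] by (auto simp: fibre_def)
  then show "closed_in W (fibre W (\<lambda>x. \<pi> (x 0)) E)"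
    using closed_in_W[OF partite_closed[OF E] n] by simp
next
  fix U assume U: "irreducible_in W U \<and> U \<subseteq> fibre W (\<lambda>x. \<pi> (x 0)) E"
  then have UW: "U \<subseteq> verts W" by (simp add: irreducible_in_def)
  have UE: "\<pi> (x j) \<in> verts E" if "x \<in> U" "j < n" for x j
  proof -
    have "x \<in> verts W" "\<pi> (x 0) \<in> verts E" using that U UW by (auto simp: fibre_def)
    then show ?thesis using W_proj[OF _ that(2)] by metis
  qed
  have li: "local_iso \<pi> P ((\<lambda>x. x j) ` U) E" if "j < n" for j
  proof (rule partite_local_iso[OF E])
    show "irreducible_in P ((\<lambda>x. x j) ` U)" using irreducible_coord[OF _ that] U by blast
    show "(\<lambda>x. x j) ` U \<subseteq> fibre P \<pi> E"
      using UE[OF _ that] UW W_coord[OF _ that] by (auto simp: fibre_def)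
  qed
  have mp: "map \<pi> (map (\<lambda>x. x j) t) = map (\<lambda>x. \<pi> (x 0)) t" if "set t \<subseteq> U" "j < n" for t j
  proof -
    have "\<pi> (x j) = \<pi> (x 0)" if "x \<in> set t" for x
      using W_proj[OF _ \<open>j < n\<close>, of x] \<open>set t \<subseteq> U\<close> that UW by blast
    then show ?thesis by simp
  qed
  have sub: "set (map (\<lambda>x. x j) t) \<subseteq> (\<lambda>x. x j) ` U" if "set t \<subseteq> U" for t j
    using that by auto
  show "local_iso (\<lambda>x. \<pi> (x 0)) W U E"
  proof (rule local_isoI)
    show "inj_on (\<lambda>x. \<pi> (x 0)) U"
    proof (rule inj_onI)
      fix x y assume xy: "x \<in> U" "y \<in> U" "\<pi> (x 0) = \<pi> (y 0)"
      have "x j = y j" if "j < n" for j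
      proof -
        have "\<pi> (x j) = \<pi> (y j)"
          using xy UW W_proj[OF _ that, of x] W_proj[OF _ that, of y] by (metis subsetD)
        then show ?thesis using inj_onD[OF local_isoD(1)[OF li[OF that]]] xy by blast
      qed
      moreover have "x \<in> {..<n} \<rightarrow>\<^sub>E Y" "y \<in> {..<n} \<rightarrow>\<^sub>E Y" using xy UW verts_W by blast+
      ultimately show "x = y" by (intro PiE_ext) auto
    qed
    show "\<pi> (x 0) \<in> verts E" if "x \<in> U" for x using UE[OF that n] .
    show "map (\<lambda>x. \<pi> (x 0)) t \<in> rels E R" if "set t \<subseteq> U" "t \<in> rels W R" for R t
    proof -
      have "map (\<lambda>x. x 0) t \<in> rels P R" using that(2) n rels_W by blast
      then have "map \<pi> (map (\<lambda>x. x 0) t) \<in> rels E R"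
        using local_isoD(4)[OF li[OF n] sub[OF that(1)], of R] by blast
      then show ?thesis unfolding mp[OF that(1) n] .
    qed
    show "t \<in> rels W R" if t: "set t \<subseteq> U" "map (\<lambda>x. \<pi> (x 0)) t \<in> rels E R" for R t
      unfolding rels_W
    proof (intro conjI allI impI)
      show "set t \<subseteq> verts W" using t(1) UW by auto
      show "map (\<lambda>x. x j) t \<in> rels P R" if "j < n" for j
        using t(2) unfolding mp[OF t(1) that, symmetric] local_isoD(4)[OF li[OF that] sub[OF t(1)]] .
    qed
    show "\<pi> (y 0) \<in> fn E F (map (\<lambda>x. \<pi> (x 0)) t)" if "set t \<subseteq> U" "y \<in> fn W F t" for F t y
    proof -
      have "y 0 \<in> fn P F (map (\<lambda>x. x 0) t)" using that(2) n fn_W by blast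
      then have "\<pi> (y 0) \<in> fn E F (map \<pi> (map (\<lambda>x. x 0) t))"
        unfolding local_isoD(5)[OF li[OF n] sub[OF that(1)]] by blast
      then show ?thesis unfolding mp[OF that(1) n] .
    qed
    show "z \<in> (\<lambda>x. \<pi> (x 0)) ` fn W F t" if t: "set t \<subseteq> U" "z \<in> fn E F (map (\<lambda>x. \<pi> (x 0)) t)" for F t z
    proof -
      have "\<exists>x. x \<in> fn P F (map (\<lambda>x. x j) t) \<and> \<pi> x = z" if "j < n" for j
        using t(2) unfolding mp[OF t(1) that, symmetric] local_isoD(5)[OF li[OF that] sub[OF t(1)]] by blast
      then obtain g where g: "\<And>j. j < n \<Longrightarrow> g j \<in> fn P F (map (\<lambda>x. x j) t) \<and> \<pi> (g j) = z"
        by metis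
      \<comment> \<open>The preimages of \<open>z\<close> found in the single coordinates form one
        point of the power; they lie in \<open>Y\<close> because the fibre over \<open>D\<close> is
        closed.\<close>
      define y where "y = (\<lambda>j\<in>{..<n}. g j)"
      have "g j \<in> Y" if "j < n" for j
      proof -
        have "set (map (\<lambda>x. x j) t) \<subseteq> Y" using t(1) UW W_coord[OF _ that] by fastforce
        then show ?thesis using closed_in_fn[OF partite_closed[OF part]] g[OF that] by blast
      qed
      then have "y \<in> verts W" using g n by (auto simp: verts_W y_def)
      moreover have "y j \<in> fn P F (map (\<lambda>x. x j) t)" if "j < n" for j using g that by (simp add: y_def)
      ultimately have "y \<in> fn W F t" using t(1) UW fn_W by blast
      moreover have "\<pi> (y 0) = z" using g n by (simp add: y_def)
      ultimately show ?thesis by blast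
    qed
  qed
qed

text \<open>An active coordinate is the identity, which gives injectivity and reflects relations. A
  fixed coordinate is \<open>\<pi>\<close> followed by the inverse of a section; it preserves
  relations because \<open>\<pi>\<close> is exact on related tuples of the fibre.\<close>

lemma local_iso_line_map:
  assumes l: "l \<in> lines (sections P \<pi> D) n"
  shows "local_iso (line_map n \<pi> l) P Y W"
proof -
  obtain M u where Mu: "l = (M, u)" by (cases l)
  obtain m where m: "m \<in> M" "m < n" using l by (auto simp: Mu lines_def)
  have u: "u j \<in> sections P \<pi> D" if "j < n" for j using l that by (auto simp: Mu lines_def)
  define s where "s j = inv_into (u j) \<pi>" for j
  have ls: "local_iso (s j) D (verts D) P" if "j < n" for j
    using section_inverse[OF u[OF that] wfP] by (simp add: s_def)
  have lm: "line_map n \<pi> l x j = (if j \<in> M then x else s j (\<pi> x))" if "j < n" for x j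
    using that by (simp add: line_map_def Mu s_def)
  have s_pi: "\<pi> (s j i) = i" if "j < n" "i \<in> verts D" for i j
    using section_inv_into(3)[OF u[OF that(1)] that(2)] by (simp add: s_def)
  have s_Y: "s j i \<in> Y" if "j < n" "i \<in> verts D" for i j
    using section_inv_into(2,4)[OF u[OF that(1)]] that(2) by (auto simp: s_def)
  have YD: "\<pi> x \<in> verts D" if "x \<in> Y" for x using that by (simp add: fibre_def)
  have co: "map (\<lambda>x. x j) (map (line_map n \<pi> l) t) = (if j \<in> M then t else map (s j) (map \<pi> t))"
    if "j < n" for j t using lm[OF that] by (simp add: comp_def)
  have lW: "line_map n \<pi> l x \<in> verts W" if "x \<in> Y" for x
  proof -
    have "line_map n \<pi> l x j \<in> Y \<and> \<pi> (line_map n \<pi> l x j) = \<pi> x" if "j < n" for j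
      using that \<open>x \<in> Y\<close> s_Y s_pi YD by (simp add: lm)
    then show ?thesis using n by (auto simp: verts_W PiE_def line_map_def)
  qed
  have lW': "set (map (line_map n \<pi> l) t) \<subseteq> verts W" if "set t \<subseteq> Y" for t using lW that by auto
  have tD: "set (map \<pi> t) \<subseteq> verts D" if "set t \<subseteq> Y" for t using that YD by auto
  show ?thesis
  proof (rule local_isoI)
    show "inj_on (line_map n \<pi> l) Y"
      using lm[OF m(2)] m(1) by (intro inj_onI) metis
    show "map (line_map n \<pi> l) t \<in> rels W R" if t: "set t \<subseteq> Y" "t \<in> rels P R" for R t
      unfolding rels_W
    proof (intro conjI allI impI lW'[OF t(1)])
      have "related P t" using t(2) by (auto simp: related_def)
      then have "local_iso \<pi> P (set t \<union> fn P F t) D" for F by (rule partite_related[OF part wfP t(1)])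
      then have "map \<pi> t \<in> rels D R" using local_isoD(4)[of \<pi> P _ D t R] t(2) by blast
      then show "map (\<lambda>x. x j) (map (line_map n \<pi> l) t) \<in> rels P R" if "j < n" for j
        using local_isoD(4)[OF ls[OF that] tD[OF t(1)], of R] t(2) by (simp only: co[OF that]) simp
    qed
    show "t \<in> rels P R" if "set t \<subseteq> Y" "map (line_map n \<pi> l) t \<in> rels W R" for R t
      using that(2) m unfolding rels_W by (metis co)
  next
    fix F t y assume t: "set t \<subseteq> Y" "y \<in> fn P F t"
    then have r: "related P t" by (auto simp: related_def)
    have Yy: "y \<in> Y" using closed_in_fn[OF partite_closed[OF part] t(1)] t(2) by blast
    have "local_iso \<pi> P (set t \<union> fn P F t) D" by (rule partite_related[OF part wfP t(1) r])
    then have "\<pi> y \<in> fn D F (map \<pi> t)" using local_isoD(5)[of \<pi> P _ D t F] t(2) by blast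
    then have sy: "s j (\<pi> y) \<in> fn P F (map (s j) (map \<pi> t))" if "j < n" for j
      using local_isoD(5)[OF ls[OF that] tD[OF t(1)], of F] by auto
    show "line_map n \<pi> l y \<in> fn W F (map (line_map n \<pi> l) t)"
      unfolding fn_W
    proof (intro conjI allI impI lW[OF Yy] lW'[OF t(1)])
      show "line_map n \<pi> l y j \<in> fn P F (map (\<lambda>x. x j) (map (line_map n \<pi> l) t))" if "j < n" for j
        unfolding co[OF that] lm[OF that] using t(2) sy[OF that] by simp
    qed
  next
    fix F t z assume t: "set t \<subseteq> Y" "z \<in> fn W F (map (line_map n \<pi> l) t)"
    then have zW: "z \<in> verts W" by (simp add: fn_W)
    have z: "z j \<in> fn P F (if j \<in> M then t else map (s j) (map \<pi> t))" if "j < n" for j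
      using t(2) fn_W unfolding co[OF that, symmetric] by (metis that)
    have zm: "z m \<in> fn P F t" using z[OF m(2)] m(1) by simp
    then have r: "related P t" by (auto simp: related_def)
    have li: "local_iso \<pi> P (set t \<union> fn P F t) D" by (rule partite_related[OF part wfP t(1) r])
    \<comment> \<open>All coordinates of \<open>z\<close> have one projection. Over it,
      \<open>\<pi>\<close> is injective on the values at \<open>t\<close>, which settles the active
      coordinates, and a fixed coordinate is a point of its section.\<close>
    have eq: "z j = line_map n \<pi> l (z m) j" if j: "j < n" for j
    proof -
      have p: "\<pi> (z j) = \<pi> (z m)" using W_proj[OF zW] j m by metis
      show ?thesis
      proof (cases "j \<in> M")
        case True
        then have "z j \<in> fn P F t" using z[OF j] by simp
        then have "z j = z m" using inj_onD[OF local_isoD(1)[OF li] p] zm by blast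
        then show ?thesis using True j by (simp add: lm)
      next
        case False
        then have "z j \<in> s j ` fn D F (map \<pi> t)"
          using z[OF j] local_isoD(5)[OF ls[OF j] tD[OF t(1)], of F] by simp
        moreover have "fn D F (map \<pi> t) = \<pi> ` fn P F t"
          using local_isoD(5)[OF li, of t F] by blast
        ultimately obtain x where x: "x \<in> fn P F t" "z j = s j (\<pi> x)" by auto
        have "x \<in> Y" using closed_in_fn[OF partite_closed[OF part] t(1)] x(1) by blast
        then have "\<pi> (z j) = \<pi> x" using x(2) s_pi[OF j] YD by simp
        then show ?thesis using False j x(2) p by (simp add: lm)
      qed
    qed
    have "z = line_map n \<pi> l (z m)"
    proof (rule PiE_ext)
      show "z \<in> {..<n} \<rightarrow>\<^sub>E Y" using zW verts_W by blast
      show "line_map n \<pi> l (z m) \<in> {..<n} \<rightarrow>\<^sub>E Y" using lW[OF W_coord[OF zW m(2)]] verts_W by blast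
    qed (use eq in simp)
    then show "z \<in> line_map n \<pi> l ` fn P F t" using zm by blast
  qed (use lW in auto)
qed

end

section \<open>Partition arrows and the partite lemma\<close>

definition homogeneous_copy ::
  "('b set \<Rightarrow> nat) \<Rightarrow> ('a \<Rightarrow> 'b) \<Rightarrow> ('a, 'r, 'f) lstructure \<Rightarrow> ('a \<Rightarrow> 'x) \<Rightarrow>
    ('b, 'r, 'f) lstructure \<Rightarrow> ('b \<Rightarrow> 'x) \<Rightarrow> ('x, 'r, 'f) lstructure set \<Rightarrow> bool" where
  "homogeneous_copy \<chi> \<psi> P \<pi> Q \<rho> \<D> \<longleftrightarrow>
     local_iso \<psi> P (verts P) Q \<and> (\<forall>x\<in>verts P. \<rho> (\<psi> x) = \<pi> x) \<and>
     (\<forall>D\<in>\<D>. \<exists>c. \<forall>U\<in>sections P \<pi> D. \<chi> (\<psi> ` U) = c)"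

definition partition_arrow ::
  "nat \<Rightarrow> ('a, 'r, 'f) lstructure \<Rightarrow> ('a \<Rightarrow> 'x) \<Rightarrow> ('b, 'r, 'f) lstructure \<Rightarrow> ('b \<Rightarrow> 'x) \<Rightarrow>
    ('x, 'r, 'f) lstructure set \<Rightarrow> bool" where
  "partition_arrow k P \<pi> Q \<rho> \<D> \<longleftrightarrow>
     (\<forall>\<chi>. (\<forall>U. \<chi> U < k) \<longrightarrow> (\<exists>\<psi>. homogeneous_copy \<chi> \<psi> P \<pi> Q \<rho> \<D>))"

lemma partition_arrowD:
  assumes "partition_arrow k P \<pi> Q \<rho> \<D>" "\<And>U. \<chi> U < k"
  shows "\<exists>\<psi>. homogeneous_copy \<chi> \<psi> P \<pi> Q \<rho> \<D>"
  using assms by (simp add: partition_arrow_def)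

lemma homogeneous_copyD:
  assumes "homogeneous_copy \<chi> \<psi> P \<pi> Q \<rho> \<D>"
  shows "local_iso \<psi> P (verts P) Q" "x \<in> verts P \<Longrightarrow> \<rho> (\<psi> x) = \<pi> x"
    "D \<in> \<D> \<Longrightarrow> \<exists>c. \<forall>U\<in>sections P \<pi> D. \<chi> (\<psi> ` U) = c"
  using assms by (simp_all add: homogeneous_copy_def)

lemma partition_arrow_refl: "sections P \<pi> D = {} \<Longrightarrow> partition_arrow k P \<pi> P \<pi> {D}"
  unfolding partition_arrow_def homogeneous_copy_def
  by (auto intro!: exI[of _ "\<lambda>x. x"] local_iso_id)

text \<open>First pick a copy of \<open>Q\<close> in \<open>R\<close> homogeneous for
  \<open>\<D>\<close>, then inside it a copy of \<open>P\<close> homogeneous for \<open>D\<close>.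
  The second choice keeps the first homogeneity, since sections of \<open>P\<close> are sent to
  sections of \<open>Q\<close>.\<close>

lemma partition_arrow_compose:
  fixes R :: "('c, 'r, 'f) lstructure"
  assumes "partition_arrow k P \<pi> Q \<rho> {D}" "partition_arrow k Q \<rho> R \<sigma> \<D>"
  shows "partition_arrow k P \<pi> R \<sigma> (insert D \<D>)"
  unfolding partition_arrow_def
proof (intro allI impI)
  fix \<chi> :: "'c set \<Rightarrow> nat" assume \<chi>: "\<forall>U. \<chi> U < k"
  then obtain \<psi> where \<psi>: "homogeneous_copy \<chi> \<psi> Q \<rho> R \<sigma> \<D>"
    using partition_arrowD[OF assms(2)] by metis
  obtain \<phi> where \<phi>: "homogeneous_copy (\<lambda>U. \<chi> (\<psi> ` U)) \<phi> P \<pi> Q \<rho> {D}"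
    using partition_arrowD[OF assms(1), of "\<lambda>U. \<chi> (\<psi> ` U)"] \<chi> by blast
  note \<psi> = homogeneous_copyD[OF \<psi>] and \<phi> = homogeneous_copyD[OF \<phi>]
  show "\<exists>\<theta>. homogeneous_copy \<chi> \<theta> P \<pi> R \<sigma> (insert D \<D>)"
    unfolding homogeneous_copy_def
  proof (intro exI[of _ "\<lambda>x. \<psi> (\<phi> x)"] conjI ballI)
    show "local_iso (\<lambda>x. \<psi> (\<phi> x)) P (verts P) R"
      by (rule local_iso_comp[OF \<phi>(1) \<psi>(1) local_isoD(2)[OF \<phi>(1)]])
    show "\<sigma> (\<psi> (\<phi> x)) = \<pi> x" if "x \<in> verts P" for x
      using that \<phi>(2) \<psi>(2) local_isoD(3)[OF \<phi>(1)] by simp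
    fix E assume "E \<in> insert D \<D>"
    then show "\<exists>c. \<forall>U\<in>sections P \<pi> E. \<chi> ((\<lambda>x. \<psi> (\<phi> x)) ` U) = c"
    proof
      assume "E = D" then show ?thesis using \<phi>(3)[of D] by (simp add: image_image)
    next
      assume "E \<in> \<D>"
      then obtain c where "\<And>U. U \<in> sections Q \<rho> E \<Longrightarrow> \<chi> (\<psi> ` U) = c" using \<psi>(3) by metis
      then have "\<chi> (\<psi> ` \<phi> ` U) = c" if "U \<in> sections P \<pi> E" for U
        using sections_image[OF \<phi>(1,2) that] by simp
      then show ?thesis by (auto simp: image_image)
    qed
  qed
qed

context free_amalg
begin

text \<open>\<open>J\<close> is the invariant that makes the single step available: partiteness in
  the inner construction, \<open>True\<close> in the outer one.\<close>

lemma partition_arrow_iterate: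
  fixes J :: "('a, 'r, 'f) lstructure \<Rightarrow> ('a \<Rightarrow> 'x) \<Rightarrow> bool"
  assumes fin: "finite \<D>"
    and step: "\<And>D P \<pi>. D \<in> \<D> \<Longrightarrow> P \<in> K \<Longrightarrow> J P \<pi> \<Longrightarrow>
      \<exists>Q\<in>K. \<exists>\<rho>. J Q \<rho> \<and> partition_arrow k P \<pi> Q \<rho> {D}"
  shows "P \<in> K \<Longrightarrow> J P \<pi> \<Longrightarrow> \<exists>Q\<in>K. \<exists>\<rho>. partition_arrow k P \<pi> Q \<rho> \<D>"
  using fin step
proof (induction \<D> arbitrary: P \<pi> rule: finite_induct)
  case empty
  then show ?case
    by (intro bexI[of _ P] exI[of _ \<pi>]) (auto simp: partition_arrow_def homogeneous_copy_def intro!: exI[of _ "\<lambda>x. x"] local_iso_id)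
next
  case (insert D \<D>)
  obtain Q \<rho> where Q: "Q \<in> K" "J Q \<rho>" "partition_arrow k P \<pi> Q \<rho> {D}"
    using insert.prems(3)[of D P \<pi>] insert.prems(1,2) by blast
  obtain R \<sigma> where "R \<in> K" "partition_arrow k Q \<rho> R \<sigma> \<D>"
    using insert.IH[OF Q(1,2)] insert.prems(3) by blast
  then show ?case using partition_arrow_compose[OF Q(3)] by blast
qed

text \<open>The colour is made constant for \<open>D\<close> only, but partiteness is kept for every
  member of \<open>\<D>\<close>, so the step can be repeated for the others.\<close>

lemma partite_step:
  fixes \<pi> :: "'a \<Rightarrow> 'x"
  assumes P: "P \<in> K" and part: "\<And>E. E \<in> \<D> \<Longrightarrow> partite P \<pi> E" and D: "D \<in> \<D>"
    and A: "A \<in> K" "local_iso f D (verts D) A" and k: "k > 0"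
  shows "\<exists>Q\<in>K. \<exists>\<rho>. (\<forall>E\<in>\<D>. partite Q \<rho> E) \<and> partition_arrow k P \<pi> Q \<rho> {D}"
proof (cases "sections P \<pi> D = {}")
  case True
  then show ?thesis using P part partition_arrow_refl by blast
next
  case False
  have wfP: "wf_str P" and finP: "finite (verts P)" using P K_wf K_finite by auto
  have partD: "partite P \<pi> D" using part D by blast
  have fin: "finite (sections P \<pi> D)" using finP by (rule finite_sections)
  obtain n where n: "n > 0" and HJ: "\<And>\<chi> :: (nat \<Rightarrow> 'a set) \<Rightarrow> nat. (\<And>w. \<chi> w < k) \<Longrightarrow>
      \<exists>(M, u)\<in>lines (sections P \<pi> D) n. \<exists>c. \<forall>x\<in>sections P \<pi> D. \<chi> (line_point n M u x) = c"
    using hales_jewett[OF fin False k] by blast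
  interpret pw: powering P \<pi> D n using wfP n partD by unfold_locales
  let ?\<Lambda> = "lines (sections P \<pi> D) n"
  interpret gl: gluing pw.W P pw.Y ?\<Lambda> "line_map n \<pi>"
    using pw.wf_W wfP partite_closed[OF partD] pw.local_iso_line_map by unfold_locales
  let ?G = "gl.G"
  \<comment> \<open>All coordinates of a point of the power have the same projection, so coordinate
    0 can represent it.\<close>
  define \<rho>0 where "\<rho>0 v = (case v of Inl x \<Rightarrow> \<pi> (x 0) | Inr (l, z) \<Rightarrow> \<pi> z)"
    for v :: "(nat \<Rightarrow> 'a) + (nat set \<times> (nat \<Rightarrow> 'a set)) \<times> 'a"
  have \<rho>_gm: "\<rho>0 (gl.gm l x) = \<pi> x" if "l \<in> ?\<Lambda>" "x \<in> verts P" for l x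
  proof (cases "x \<in> pw.Y")
    case True
    have "snd l 0 \<in> sections P \<pi> D" using that(1) n by (auto simp: lines_def)
    then have "\<pi> (inv_into (snd l 0) \<pi> (\<pi> x)) = \<pi> x"
      by (rule section_inv_into(3)) (use True in \<open>simp add: fibre_def\<close>)
    then show ?thesis using True n by (simp add: glue_map_def \<rho>0_def line_map_def)
  qed (simp add: glue_map_def \<rho>0_def)
  have \<rho>_Inl: "(\<lambda>x. \<rho>0 (Inl x)) = (\<lambda>x. \<pi> (x 0))" by (simp add: \<rho>0_def)
  have partG: "partite ?G \<rho>0 E" if "E \<in> \<D>" for E
    unfolding partite_def
  proof (intro conjI allI impI)
    have pE: "partite P \<pi> E" using part that by blast
    have pW: "partite pw.W (\<lambda>x. \<pi> (x 0)) E" using pw.partite_W[OF pE] .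
    show "closed_in ?G (fibre ?G \<rho>0 E)"
      unfolding closed_in_def
    proof (intro conjI allI impI subsetI)
      fix F t y assume t: "set t \<subseteq> fibre ?G \<rho>0 E" "y \<in> fn ?G F t"
      have yG: "y \<in> verts ?G" using wf_str_fn[OF gl.wf_glue] t(2) by blast
      from t(2) have "\<rho>0 y \<in> verts E"
      proof (cases rule: gl.fn_glueE)
        case (1 s z)
        have "set s \<subseteq> fibre pw.W (\<lambda>x. \<pi> (x 0)) E"
          using t(1) 1 wf_str_fn_arg[OF pw.wf_W 1(1)] by (auto simp: fibre_def \<rho>0_def)
        then have "z \<in> fibre pw.W (\<lambda>x. \<pi> (x 0)) E"
          using closed_in_fn[OF partite_closed[OF pW]] 1(1) by blast
        then show ?thesis using 1 by (simp add: fibre_def \<rho>0_def)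
      next
        case (2 l s z)
        have s: "set s \<subseteq> verts P" using wf_str_fn_arg[OF wfP 2(2)] .
        have "set s \<subseteq> fibre P \<pi> E"
        proof
          fix x assume x: "x \<in> set s"
          then have "gl.gm l x \<in> fibre ?G \<rho>0 E" using t(1) 2(3) by auto
          then show "x \<in> fibre P \<pi> E" using x s \<rho>_gm[OF 2(1)] by (auto simp: fibre_def)
        qed
        then have "z \<in> fibre P \<pi> E" using closed_in_fn[OF partite_closed[OF pE]] 2(2) by blast
        then show ?thesis using \<rho>_gm[OF 2(1)] 2(4) by (simp add: fibre_def)
      qed
      then show "y \<in> fibre ?G \<rho>0 E" using yG by (simp add: fibre_def)
    qed (auto simp: fibre_def)
    fix U assume U: "irreducible_in ?G U \<and> U \<subseteq> fibre ?G \<rho>0 E"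
    then have "irreducible_in ?G U" by simp
    then show "local_iso \<rho>0 ?G U E"
    proof (cases rule: gl.irreducible_glue_cases)
      case (1 V)
      then have V: "V \<subseteq> verts pw.W" by (simp add: irreducible_in_def)
      have "V \<subseteq> fibre pw.W (\<lambda>x. \<pi> (x 0)) E" using V U 1(2) by (auto simp: fibre_def \<rho>0_def)
      then have "local_iso (\<lambda>x. \<rho>0 (Inl x)) pw.W V E"
        unfolding \<rho>_Inl using partite_local_iso[OF pW 1(1)] by blast
      then show ?thesis unfolding 1(2)
        by (rule local_iso_factor[OF local_iso_mono[OF gl.local_iso_Inl V]])
    next
      case (2 l V)
      then have V: "V \<subseteq> verts P" by (simp add: irreducible_in_def)
      have VE: "V \<subseteq> fibre P \<pi> E"
      proof
        fix x assume x: "x \<in> V"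
        then have "gl.gm l x \<in> fibre ?G \<rho>0 E" using U 2(3) by auto
        then show "x \<in> fibre P \<pi> E" using x V \<rho>_gm[OF 2(1)] by (auto simp: fibre_def)
      qed
      have "local_iso (\<lambda>x. \<rho>0 (gl.gm l x)) P V E"
        by (rule local_iso_cong[OF _ closed_in_verts[OF wfP] V partite_local_iso[OF pE 2(2) VE]])
          (simp add: \<rho>_gm[OF 2(1)])
      then show ?thesis unfolding 2(3)
        by (intro local_iso_factor[OF local_iso_mono[OF gl.local_iso_glue_map[OF 2(1)] V]])
    qed
  qed
  obtain Q \<phi> where Q: "Q \<in> K" "local_iso \<phi> ?G (verts ?G) Q" "\<phi> ` verts ?G = verts Q"
  proof (rule gl.representable_glue[OF free_amalg_axioms P])
    fix V assume V: "irreducible_in pw.W V"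
    then have "V \<subseteq> verts pw.W" by (simp add: irreducible_in_def)
    then have W: "x \<in> verts pw.W" if "x \<in> V" for x using that by blast
    \<comment> \<open>The whole power lies over \<open>D\<close>, so an irreducible set in it embeds
      into \<open>D\<close> and further into \<open>A\<close>.\<close>
    have "V \<subseteq> fibre pw.W (\<lambda>x. \<pi> (x 0)) D"
      using pw.W_coord[OF W n] W by (auto simp: fibre_def)
    then have li: "local_iso (\<lambda>x. \<pi> (x 0)) pw.W V D"
      by (rule partite_local_iso[OF pw.partite_W[OF partD] V])
    show "\<exists>B\<in>K. \<exists>g. local_iso g pw.W V B"
      using local_iso_comp[OF li A(2) local_isoD(2)[OF li]] A(1) by blast
  qed (use that pw.finite_W[OF finP] finite_lines[OF fin] in auto)
  define \<rho> where "\<rho> x = \<rho>0 (inv_into (verts ?G) \<phi> x)" for x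
  have "partite Q \<rho> E" if "E \<in> \<D>" for E
    using partite_iso[OF Q(2,3) gl.wf_glue K_wf[OF Q(1)] partG[OF that]] by (simp add: \<rho>_def[abs_def])
  moreover have "partition_arrow k P \<pi> Q \<rho> {D}"
    unfolding partition_arrow_def
  proof (intro allI impI)
    fix \<chi> :: "'a set \<Rightarrow> nat" assume \<chi>: "\<forall>U. \<chi> U < k"
    \<comment> \<open>A word gets the colour of the section that it spans in the power, as seen in
      \<open>Q\<close>.\<close>
    obtain M u c where Mu: "(M, u) \<in> ?\<Lambda>"
      and c: "\<And>U. U \<in> sections P \<pi> D \<Longrightarrow>
        \<chi> (\<phi> ` Inl ` word_map n \<pi> (line_point n M u U) ` verts D) = c"
      using HJ[of "\<lambda>w. \<chi> (\<phi> ` Inl ` word_map n \<pi> w ` verts D)"] \<chi> by blast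
    let ?\<psi> = "\<lambda>x. \<phi> (gl.gm (M, u) x)"
    show "\<exists>\<psi>. homogeneous_copy \<chi> \<psi> P \<pi> Q \<rho> {D}"
      unfolding homogeneous_copy_def
    proof (intro exI[of _ ?\<psi>] conjI ballI)
      have gm: "local_iso (gl.gm (M, u)) P (verts P) ?G" using gl.local_iso_glue_map[OF Mu] .
      show "local_iso ?\<psi> P (verts P) Q" by (rule local_iso_comp[OF gm Q(2) local_isoD(2)[OF gm]])
      show "\<rho> (?\<psi> x) = \<pi> x" if "x \<in> verts P" for x
        using that local_isoD(1)[OF Q(2)] local_isoD(3)[OF gm that] \<rho>_gm[OF Mu] by (simp add: \<rho>_def)
      fix D' assume "D' \<in> {D}"
      have "?\<psi> ` U = \<phi> ` Inl ` word_map n \<pi> (line_point n M u U) ` verts D" if U: "U \<in> sections P \<pi> D" for U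
      proof -
        have "gl.gm (M, u) x = Inl (word_map n \<pi> (line_point n M u U) (\<pi> x))" if "x \<in> U" for x
          using line_map_section[OF U that] section_inv_into(4)[OF U] that by (auto simp: glue_map_def)
        moreover have "verts D = \<pi> ` U" using U by (simp add: sections_def)
        ultimately show ?thesis by (simp add: image_image cong: image_cong_simp)
      qed
      then show "\<exists>c. \<forall>U\<in>sections P \<pi> D'. \<chi> (?\<psi> ` U) = c" using c \<open>D' \<in> {D}\<close> by auto
    qed
  qed
  ultimately show ?thesis using Q(1) by blast
qed

lemma partite_ramsey:
  fixes \<pi> :: "'a \<Rightarrow> 'x"
  assumes "P \<in> K" "finite \<D>" "k > 0" "\<And>D. D \<in> \<D> \<Longrightarrow> partite P \<pi> D"
    and "\<And>D. D \<in> \<D> \<Longrightarrow> \<exists>A\<in>K. \<exists>f. local_iso f D (verts D) A"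
  shows "\<exists>Q\<in>K. \<exists>\<rho>. partition_arrow k P \<pi> Q \<rho> \<D>"
proof (rule partition_arrow_iterate[where J = "\<lambda>P \<pi>. \<forall>E\<in>\<D>. partite P \<pi> E"])
  fix D P and \<pi> :: "'a \<Rightarrow> 'x"
  assume D: "D \<in> \<D>" and P: "P \<in> K" "\<forall>E\<in>\<D>. partite P \<pi> E"
  obtain A f where "A \<in> K" "local_iso f D (verts D) A" using assms(5)[OF D] by blast
  then show "\<exists>Q\<in>K. \<exists>\<rho>. (\<forall>E\<in>\<D>. partite Q \<rho> E) \<and> partition_arrow k P \<pi> Q \<rho> {D}"
    using partite_step[OF P(1) _ D] P(2) assms(3) by blast
qed (use assms in auto)
end

section \<open>Sections over an arbitrary projection\<close>

text \<open>The instance of gluing that replaces a disjoint union: the copies share exactly the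
  constants.\<close>

lemma gluing_constants:
  assumes "wf_str P"
  shows "gluing (restrict_str P (constants P)) P (constants P) \<Lambda> (\<lambda>_ x. x)"
proof
  have c: "closed_in P (constants P)" by (rule closed_in_constants[OF assms])
  then show "wf_str (restrict_str P (constants P))" by (rule wf_restrict_str[OF assms])
  show "local_iso (\<lambda>x. x) P (constants P) (restrict_str P (constants P))"
    by (rule local_iso_into_restrict_str[OF local_iso_mono[OF local_iso_id]])
      (use c in \<open>auto simp: closed_in_def\<close>)
qed (use assms closed_in_constants in auto)

context free_amalg
begin

lemma representable_glue_constants:
  assumes P: "P \<in> K" and fin: "finite \<Lambda>"
  defines "G \<equiv> glue (restrict_str P (constants P)) P (constants P) \<Lambda> (\<lambda>_ x. x)"
  obtains Q \<phi> where "Q \<in> K" "local_iso \<phi> G (verts G) Q" "\<phi> ` verts G = verts Q"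
proof -
  let ?C = "constants P"
  interpret gl: gluing "restrict_str P ?C" P ?C \<Lambda> "\<lambda>_ x. x"
    by (rule gluing_constants[OF K_wf[OF P]])
  have CP: "?C \<subseteq> verts P" using closed_in_constants[OF K_wf[OF P]] by (simp add: closed_in_def)
  show thesis
  proof (rule gl.representable_glue[OF free_amalg_axioms P])
    fix V assume "irreducible_in (restrict_str P ?C) V"
    then have "V \<subseteq> ?C" by (simp add: irreducible_in_def)
    then show "\<exists>B\<in>K. \<exists>g. local_iso g (restrict_str P ?C) V B"
      using local_iso_restrict_str_subset local_iso_mono[OF local_iso_id, of V P] CP P by blast
  next
    show "finite (verts (restrict_str P ?C))" using CP K_finite[OF P] finite_subset by auto
  qed (use fin that in \<open>simp_all add: G_def\<close>)
qed

text \<open>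
  Without \<open>partite\<close>, the fibre over \<open>D\<close> need not be closed, so the partite lemma does not apply to
  \<open>\<pi>\<close> itself. Instead, take disjoint copies of \<open>P\<close>, one for each Hales--Jewett line over the
  alphabet of sections, and project each copy to the set of words along its line. Every word \<open>w\<close>
  spans an image \<open>Dw w\<close> of \<open>D\<close>, and in each copy the fibre over \<open>Dw w\<close> lies in a single section,
  where it is an equalizer of isomorphisms and hence closed. The iterated partite lemma then makes
  the colour of a section depend on its word alone.
\<close>

lemma section_ramsey:
  fixes \<pi> :: "'a \<Rightarrow> 'x"
  assumes P: "P \<in> K" and wfD: "wf_str D" and A: "A \<in> K" "local_iso f D (verts D) A" and k: "k > 0"
  shows "\<exists>Q\<in>K. \<exists>\<rho>. partition_arrow k P \<pi> Q \<rho> {D}"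
proof (cases "sections P \<pi> D = {}")
  case True
  then show ?thesis using P partition_arrow_refl by blast
next
  case False
  have wfP: "wf_str P" and finP: "finite (verts P)" using P K_wf K_finite by auto
  let ?S = "sections P \<pi> D"
  have fin: "finite ?S" using finP by (rule finite_sections)
  obtain n where n: "n > 0" and HJ: "\<And>\<chi> :: (nat \<Rightarrow> 'a set) \<Rightarrow> nat. (\<And>w. \<chi> w < k) \<Longrightarrow>
      \<exists>(M, u)\<in>lines ?S n. \<exists>c. \<forall>x\<in>?S. \<chi> (line_point n M u x) = c"
    using hales_jewett[OF fin False k] by blast
  let ?\<Lambda> = "lines ?S n" and ?C = "constants P"
  have cC: "closed_in P ?C" by (rule closed_in_constants[OF wfP])
  then have CP: "?C \<subseteq> verts P" by (simp add: closed_in_def)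
  interpret gl: gluing "restrict_str P ?C" P ?C ?\<Lambda> "\<lambda>_ x. x"
    by (rule gluing_constants[OF wfP])
  let ?G = "gl.G"
  have inv_sec: "\<pi> (inv_into U \<pi> i) = i" "inv_into U \<pi> i \<in> U" if "U \<in> ?S" "i \<in> verts D" for U i
    using section_inv_into(2,3)[OF that] by auto
  \<comment> \<open>Vertices not over \<open>D\<close> keep their projection under the tag
    \<open>Inr\<close> and thus avoid every \<open>Dw w\<close>.\<close>
  define \<beta> where "\<beta> l x = (if \<pi> x \<in> verts D then Inl (line_map n \<pi> l x) else Inr (\<pi> x))"
    for l :: "nat set \<times> (nat \<Rightarrow> 'a set)" and x
  \<comment> \<open>A constant lies in every section, so each line map sends it to the same constant
    word; its projection is the same in all copies.\<close>
  define \<pi>1 where "\<pi>1 v = (case v of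
      Inl x \<Rightarrow> if \<pi> x \<in> verts D then Inl (\<lambda>j\<in>{..<n}. x) else Inr (\<pi> x) | Inr (l, z) \<Rightarrow> \<beta> l z)"
    for v :: "'a + (nat set \<times> (nat \<Rightarrow> 'a set)) \<times> 'a"
  have \<pi>1_gm: "\<pi>1 (gl.gm l x) = \<beta> l x" if "l \<in> ?\<Lambda>" for l x
  proof (cases "x \<in> ?C \<and> \<pi> x \<in> verts D")
    case True
    have "inv_into (snd l j) \<pi> (\<pi> x) = x" if "j < n" for j
    proof -
      have "snd l j \<in> ?S" using \<open>l \<in> ?\<Lambda>\<close> that by (auto simp: lines_def)
      moreover have "x \<in> snd l j" using calculation True constants_subset by (auto simp: sections_def)
      ultimately show ?thesis by (rule section_inv_into(1))
    qed
    then have "line_map n \<pi> l x = (\<lambda>j\<in>{..<n}. x)" by (auto simp: line_map_def fun_eq_iff)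
    then show ?thesis using True by (simp add: glue_map_def \<pi>1_def \<beta>_def)
  qed (auto simp: glue_map_def \<pi>1_def \<beta>_def)
  define words where "words = {..<n} \<rightarrow>\<^sub>E ?S"
  define e where "e w i = (Inl (word_map n \<pi> w i) :: (nat \<Rightarrow> 'a) + 'x)" for w i
  define Dw where "Dw w = image_str (e w) D" for w
  have pi_e: "\<pi> (word_map n \<pi> w i 0) = i" if "w \<in> words" "i \<in> verts D" for w i
    using that n inv_sec(1)[of "w 0" i] by (auto simp: words_def word_map_def)
  have inj_e: "inj_on (e w) (verts D)" if "w \<in> words" for w
    by (rule inj_onI) (metis pi_e[OF that] e_def sum.inject(1))
  have iso_e: "local_iso (e w) D (verts D) (Dw w)" if "w \<in> words" for w
    unfolding Dw_def by (rule local_iso_image_str[OF wfD inj_e[OF that]])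
  have verts_Dw: "verts (Dw w) = e w ` verts D" for w by (simp add: Dw_def image_str_def)
  \<comment> \<open>The part of copy \<open>l\<close> over the word \<open>w\<close>. For
    \<open>x\<close> in it, an active coordinate \<open>j\<close> says that \<open>x\<close> is the
    vertex of \<open>w j\<close> over \<open>\<pi> x\<close>; a fixed one says that the inverses of
    \<open>snd l j\<close> and \<open>w j\<close> agree at \<open>\<pi> x\<close>.\<close>
  define H where "H l w = {x \<in> verts P. \<beta> l x \<in> verts (Dw w)}" for l w
  have H_eq: "\<pi> x \<in> verts D" "line_map n \<pi> l x = word_map n \<pi> w (\<pi> x)" "\<beta> l x = e w (\<pi> x)"
    if x: "x \<in> H l w" and l: "l \<in> ?\<Lambda>" and w: "w \<in> words" for x l w
  proof -
    obtain i where i: "i \<in> verts D" "\<beta> l x = e w i" using x by (auto simp: H_def verts_Dw)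
    then show p: "\<pi> x \<in> verts D" by (auto simp: \<beta>_def e_def split: if_splits)
    then have lw: "line_map n \<pi> l x = word_map n \<pi> w i" using i(2) by (simp add: \<beta>_def e_def)
    have "snd l 0 \<in> ?S" using l n by (auto simp: lines_def)
    then have "\<pi> (line_map n \<pi> l x 0) = \<pi> x" using n inv_sec(1)[OF _ p] by (simp add: line_map_def)
    then have "i = \<pi> x" using lw pi_e[OF w i(1)] by simp
    then show "line_map n \<pi> l x = word_map n \<pi> w (\<pi> x)" "\<beta> l x = e w (\<pi> x)" using lw i(2) by simp_all
  qed
  have H_sub: "x = inv_into (w j) \<pi> (\<pi> x)" "x \<in> w j"
    if x: "x \<in> H (M, u) w" and l: "(M, u) \<in> ?\<Lambda>" and w: "w \<in> words" and j: "j \<in> M" for x M u w j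
  proof -
    have jn: "j < n" using l j by (auto simp: lines_def)
    show "x = inv_into (w j) \<pi> (\<pi> x)"
      using fun_cong[OF H_eq(2)[OF x l w], of j] jn j by (simp add: line_map_def word_map_def)
    then show "x \<in> w j" using inv_sec(2)[OF _ H_eq(1)[OF x l w], of "w j"] w jn by (auto simp: words_def)
  qed
  have closed_H: "closed_in P (H l w)" if l: "l \<in> ?\<Lambda>" and w: "w \<in> words" for l w
    unfolding closed_in_def
  proof (intro conjI allI impI subsetI)
    fix F t y assume t: "set t \<subseteq> H l w" "y \<in> fn P F t"
    obtain M u where Mu: "l = (M, u)" by (cases l)
    have lMu: "(M, u) \<in> ?\<Lambda>" using l Mu by simp
    obtain m where m: "m \<in> M" "m < n" using lMu by (auto simp: lines_def)
    have secw: "w j \<in> ?S" if "j < n" for j using w that by (auto simp: words_def)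
    have secu: "u j \<in> ?S" if "j < n" for j using lMu that by (auto simp: lines_def)
    have tw: "set t \<subseteq> w j" if "j \<in> M" for j using t(1) H_sub(2)[OF _ lMu w that] Mu by blast
    have tD: "set (map \<pi> t) \<subseteq> verts D" using t(1) H_eq(1)[OF _ l w] by auto
    have yw: "y \<in> w j" if "j \<in> M" for j
    proof -
      have "j < n" using lMu that by (auto simp: lines_def)
      then have "closed_in P (w j)" using secw by (simp add: sections_def)
      from closed_in_fn[OF this tw[OF that]] show ?thesis using t(2) by blast
    qed
    have "local_iso \<pi> P (w m) D" using secw[OF m(2)] by (simp add: sections_def)
    from local_isoD(5)[OF this tw[OF m(1)], of F] have piy: "\<pi> y \<in> fn D F (map \<pi> t)"
      using t(2) by simp
    then have yD: "\<pi> y \<in> verts D" using wf_str_fn[OF wfD] by blast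
    have "line_map n \<pi> l y = word_map n \<pi> w (\<pi> y)"
    proof
      fix j
      consider "\<not> j < n" | "j < n" "j \<in> M" | "j < n" "j \<notin> M" by blast
      then show "line_map n \<pi> l y j = word_map n \<pi> w (\<pi> y) j"
      proof cases
        case 1 then show ?thesis by (simp add: line_map_def word_map_def)
      next
        case 2 then show ?thesis
          using section_inv_into(1)[OF secw[OF 2(1)] yw[OF 2(2)]] by (simp add: line_map_def word_map_def Mu)
      next
        case 3
        let ?s = "map (inv_into (u j) \<pi>) (map \<pi> t)"
        have iu: "local_iso (inv_into (u j) \<pi>) D (verts D) P"
          and iw: "local_iso (inv_into (w j) \<pi>) D (verts D) P"
          using section_inverse secu secw 3(1) wfP by blast+
        have eq: "inv_into (u j) \<pi> (\<pi> x) = inv_into (w j) \<pi> (\<pi> x)" if "x \<in> set t" for x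
          using fun_cong[OF H_eq(2)[OF _ l w], of x j] t(1) that 3 by (auto simp: line_map_def word_map_def Mu)
        then have s: "?s = map (inv_into (w j) \<pi>) (map \<pi> t)" by simp
        \<comment> \<open>The two inverses agree on the arguments, so both images of
          \<open>\<pi> y\<close> lie in one value set. This set is inside \<open>u j\<close>, where
          \<open>\<pi>\<close> is injective.\<close>
        have "inv_into (u j) \<pi> (\<pi> y) \<in> fn P F ?s"
          unfolding local_isoD(5)[OF iu tD] using piy by blast
        moreover have "inv_into (w j) \<pi> (\<pi> y) \<in> fn P F ?s"
          unfolding s local_isoD(5)[OF iw tD] using piy by blast
        moreover have "fn P F ?s \<subseteq> u j"
        proof (rule closed_in_fn)
          show "closed_in P (u j)" using secu[OF 3(1)] by (simp add: sections_def)
          show "set ?s \<subseteq> u j" using tD inv_sec(2)[OF secu[OF 3(1)]] by auto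
        qed
        moreover have "inj_on \<pi> (u j)" using secu[OF 3(1)] local_isoD(1) by (auto simp: sections_def)
        ultimately have "inv_into (u j) \<pi> (\<pi> y) = inv_into (w j) \<pi> (\<pi> y)"
          using inv_sec(1)[OF secu[OF 3(1)] yD] inv_sec(1)[OF secw[OF 3(1)] yD]
          by (metis inj_onD subsetD)
        then show ?thesis using 3 by (simp add: line_map_def word_map_def Mu)
      qed
    qed
    then have "\<beta> l y \<in> verts (Dw w)" using yD by (auto simp: \<beta>_def e_def verts_Dw)
    then show "y \<in> H l w" using wf_str_fn[OF wfP] t(2) by (auto simp: H_def)
  qed (auto simp: H_def)
  have iso_H: "local_iso (\<lambda>x. \<pi>1 (gl.gm l x)) P (H l w) (Dw w)" if l: "l \<in> ?\<Lambda>" and w: "w \<in> words" for l w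
  proof -
    obtain M u where Mu: "l = (M, u)" by (cases l)
    obtain m where m: "m \<in> M" "m < n" using l Mu by (auto simp: lines_def)
    have "local_iso \<pi> P (w m) D" using w m by (auto simp: words_def sections_def)
    moreover have "H l w \<subseteq> w m" using H_sub(2)[OF _ _ w m(1)] l unfolding Mu by blast
    ultimately have "local_iso \<pi> P (H l w) D" by (rule local_iso_mono)
    note li = local_iso_comp[OF this iso_e[OF w] local_isoD(2)[OF this]]
    show ?thesis
      by (rule local_iso_cong[OF _ closed_H[OF l w] order_refl li]) (simp add: \<pi>1_gm[OF l] H_eq(3)[OF _ l w])
  qed
  have fib: "gl.gm l x \<in> fibre ?G \<pi>1 (Dw w) \<longleftrightarrow> x \<in> H l w" if "l \<in> ?\<Lambda>" "x \<in> verts P" for l x w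
    using gl.glue_map_verts[OF that] that(2) by (simp add: fibre_def H_def \<pi>1_gm[OF that(1)])
  \<comment> \<open>With one line at hand, the common part can be treated as part of a copy.\<close>
  obtain l0 where l0: "l0 \<in> ?\<Lambda>"
  proof -
    obtain U0 where "U0 \<in> ?S" using False by blast
    then have "({0}, \<lambda>j\<in>{..<n}. U0) \<in> ?\<Lambda>" using n by (auto simp: lines_def)
    then show thesis using that by blast
  qed
  have gm_C: "gl.gm l0 x = Inl x" if "x \<in> ?C" for x using that by (simp add: glue_map_def)
  have part: "partite ?G \<pi>1 (Dw w)" if w: "w \<in> words" for w
    unfolding partite_def
  proof (intro conjI allI impI)
    show "closed_in ?G (fibre ?G \<pi>1 (Dw w))"
      unfolding closed_in_def
    proof (intro conjI allI impI subsetI)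
      fix F t y assume t: "set t \<subseteq> fibre ?G \<pi>1 (Dw w)" "y \<in> fn ?G F t"
      have "\<exists>l\<in>?\<Lambda>. \<exists>s z. z \<in> fn P F s \<and> t = map (gl.gm l) s \<and> y = gl.gm l z"
        using t(2)
      proof (cases rule: gl.fn_glueE)
        case (1 s z)
        then have s: "set s \<subseteq> ?C" "z \<in> fn P F s" by (auto split: if_splits)
        then have "z \<in> ?C" using closed_in_fn[OF cC] by blast
        moreover have "map Inl s = map (gl.gm l0) s" using s(1) gm_C by auto
        ultimately show ?thesis using 1 s l0 gm_C by metis
      qed blast
      then obtain l s z where l: "l \<in> ?\<Lambda>" and z: "z \<in> fn P F s" "t = map (gl.gm l) s" "y = gl.gm l z" by blast
      have "set s \<subseteq> H l w"
      proof
        fix x assume "x \<in> set s"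
        then have "gl.gm l x \<in> fibre ?G \<pi>1 (Dw w)" "x \<in> verts P"
          using t(1) z(2) wf_str_fn_arg[OF wfP z(1)] by auto
        then show "x \<in> H l w" using fib[OF l] by blast
      qed
      then have "z \<in> H l w" using closed_in_fn[OF closed_H[OF l w]] z(1) by blast
      then show "y \<in> fibre ?G \<pi>1 (Dw w)" using fib[OF l] z(3) by (auto simp: H_def)
    qed (auto simp: fibre_def)
    fix U assume U: "irreducible_in ?G U \<and> U \<subseteq> fibre ?G \<pi>1 (Dw w)"
    then have "irreducible_in ?G U" by simp
    then have "\<exists>l\<in>?\<Lambda>. \<exists>V\<subseteq>verts P. U = gl.gm l ` V"
    proof (cases rule: gl.irreducible_glue_cases)
      case (1 V)
      then have V: "V \<subseteq> ?C" by (simp add: irreducible_in_def)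
      then have "U = gl.gm l0 ` V" unfolding 1(2) using gm_C by (intro image_cong) auto
      then show ?thesis using l0 V CP by blast
    next
      case (2 l V)
      then show ?thesis by (auto simp: irreducible_in_def)
    qed
    then obtain l V where l: "l \<in> ?\<Lambda>" and V: "V \<subseteq> verts P" "U = gl.gm l ` V" by blast
    have "V \<subseteq> H l w" using fib[OF l] V U by blast
    then have "local_iso (\<lambda>x. \<pi>1 (gl.gm l x)) P V (Dw w)" by (rule local_iso_mono[OF iso_H[OF l w]])
    then show "local_iso \<pi>1 ?G U (Dw w)" unfolding V(2)
      by (rule local_iso_factor[OF local_iso_mono[OF gl.local_iso_glue_map[OF l] V(1)]])
  qed
  obtain Q0 \<phi> where Q0: "Q0 \<in> K" "local_iso \<phi> ?G (verts ?G) Q0" "\<phi> ` verts ?G = verts Q0"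
    using representable_glue_constants[OF P finite_lines[OF fin]] .
  define \<pi>2 where "\<pi>2 x = \<pi>1 (inv_into (verts ?G) \<phi> x)" for x
  have part2: "partite Q0 \<pi>2 (Dw w)" if "w \<in> words" for w
    using partite_iso[OF Q0(2,3) gl.wf_glue K_wf[OF Q0(1)] part[OF that]] by (simp add: \<pi>2_def[abs_def])
  have \<pi>2: "\<pi>2 (\<phi> v) = \<pi>1 v" if "v \<in> verts ?G" for v
    using that local_isoD(1)[OF Q0(2)] by (simp add: \<pi>2_def)
  have "\<exists>B\<in>K. \<exists>g. local_iso g (Dw w) (verts (Dw w)) B" if w: "w \<in> words" for w
  proof -
    have li: "local_iso (inv_into (verts D) (e w)) (Dw w) (verts (Dw w)) D"
      using local_iso_inv[OF iso_e[OF w] wfD] verts_Dw by simp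
    show ?thesis using local_iso_comp[OF li A(2) local_isoD(2)[OF li]] A(1) by blast
  qed
  moreover have "finite (Dw ` words)" using fin by (auto simp: words_def intro: finite_PiE)
  ultimately obtain Q \<rho>1 where Q: "Q \<in> K" "partition_arrow k Q0 \<pi>2 Q \<rho>1 (Dw ` words)"
    using partite_ramsey[OF Q0(1) _ k, of "Dw ` words" \<pi>2] part2 by blast
  \<comment> \<open>Recovers the original projection from the refined one.\<close>
  define out where "out v = (case v of Inl x \<Rightarrow> \<pi> (x 0) | Inr i \<Rightarrow> i)" for v :: "(nat \<Rightarrow> 'a) + 'x"
  have out: "out (\<beta> l x) = \<pi> x" if "l \<in> ?\<Lambda>" for l x
  proof -
    have "snd l 0 \<in> ?S" using that n by (auto simp: lines_def)
    then show ?thesis using n inv_sec(1) by (auto simp: out_def \<beta>_def line_map_def)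
  qed
  have "partition_arrow k P \<pi> Q (\<lambda>x. out (\<rho>1 x)) {D}"
    unfolding partition_arrow_def
  proof (intro allI impI)
    fix \<chi> :: "'a set \<Rightarrow> nat" assume \<chi>: "\<forall>U. \<chi> U < k"
    then obtain \<psi> where "homogeneous_copy \<chi> \<psi> Q0 \<pi>2 Q \<rho>1 (Dw ` words)"
      using partition_arrowD[OF Q(2)] by metis
    note \<psi> = homogeneous_copyD[OF this]
    have "\<forall>w\<in>words. \<exists>c. \<forall>U\<in>sections Q0 \<pi>2 (Dw w). \<chi> (\<psi> ` U) = c" using \<psi>(3) by blast
    then obtain c where c: "\<And>w U. w \<in> words \<Longrightarrow> U \<in> sections Q0 \<pi>2 (Dw w) \<Longrightarrow> \<chi> (\<psi> ` U) = c w"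
      by (metis bchoice)
    \<comment> \<open>If no section lies over \<open>Dw w\<close>, then \<open>c w\<close> is
      arbitrary; it is reset to 0 to stay below \<open>k\<close>.\<close>
    define c' where "c' w = (if c w < k then c w else 0)" for w
    have "c' w < k" for w using k by (simp add: c'_def)
    \<comment> \<open>Words are now coloured by the common colour of the sections over them. In the
      copy along the monochromatic line, a section \<open>U\<close> becomes a section over the word
      with \<open>U\<close> at the active coordinates.\<close>
    from HJ[of c', OF this] obtain M u c0 where Mu: "(M, u) \<in> ?\<Lambda>"
      and c0: "\<And>U. U \<in> ?S \<Longrightarrow> c' (line_point n M u U) = c0" by blast
    let ?\<psi> = "\<lambda>x. \<psi> (\<phi> (gl.gm (M, u) x))"
    have gm: "local_iso (gl.gm (M, u)) P (verts P) ?G" using gl.local_iso_glue_map[OF Mu] .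
    have gm2: "local_iso (\<lambda>x. \<phi> (gl.gm (M, u) x)) P (verts P) Q0"
      by (rule local_iso_comp[OF gm Q0(2) local_isoD(2)[OF gm]])
    have v2: "\<pi>2 (\<phi> (gl.gm (M, u) x)) = \<beta> (M, u) x" if "x \<in> verts P" for x
      using \<pi>2[OF local_isoD(3)[OF gm that]] \<pi>1_gm[OF Mu] by simp
    show "\<exists>\<psi>. homogeneous_copy \<chi> \<psi> P \<pi> Q (\<lambda>x. out (\<rho>1 x)) {D}"
      unfolding homogeneous_copy_def
    proof (intro exI[of _ ?\<psi>] conjI ballI)
      show "local_iso ?\<psi> P (verts P) Q" by (rule local_iso_comp[OF gm2 \<psi>(1) local_isoD(2)[OF gm2]])
      show "out (\<rho>1 (?\<psi> x)) = \<pi> x" if "x \<in> verts P" for x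
        using \<psi>(2)[OF local_isoD(3)[OF gm2 that]] v2[OF that] out[OF Mu] by simp
      fix D' assume "D' \<in> {D}"
      have "\<chi> (?\<psi> ` U) = c0" if U: "U \<in> ?S" for U
      proof -
        let ?w = "line_point n M u U"
        have w: "?w \<in> words" using U Mu by (auto simp: words_def line_point_def lines_def split: if_splits)
        have UP: "U \<subseteq> verts P" "closed_in P U" and piU: "\<pi> ` U = verts D" "local_iso \<pi> P U D"
          using U by (auto simp: sections_def closed_in_def)
        have be: "\<pi>2 (\<phi> (gl.gm (M, u) x)) = e ?w (\<pi> x)" if "x \<in> U" for x
        proof -
          have "x \<in> verts P" "\<pi> x \<in> verts D" using that UP piU(1) by auto
          then show ?thesis using v2[of x] line_map_section[OF U that] by (simp add: \<beta>_def e_def)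
        qed
        have "local_iso (\<lambda>x. \<pi>2 (\<phi> (gl.gm (M, u) x))) P U (Dw ?w)"
          by (rule local_iso_cong[OF _ UP(2) order_refl
                local_iso_comp[OF piU(2) iso_e[OF w] local_isoD(2)[OF piU(2)]]]) (simp add: be)
        moreover have "(\<lambda>x. \<pi>2 (\<phi> (gl.gm (M, u) x))) ` U = verts (Dw ?w)"
          unfolding verts_Dw piU(1)[symmetric] image_image using be by (intro image_cong) auto
        ultimately have "U \<in> sections P (\<lambda>x. \<pi>2 (\<phi> (gl.gm (M, u) x))) (Dw ?w)"
          using UP by (simp add: sections_def)
        then have "(\<lambda>x. \<phi> (gl.gm (M, u) x)) ` U \<in> sections Q0 \<pi>2 (Dw ?w)"
          by (rule sections_image[OF gm2 refl])
        from c[OF w this] have "\<chi> (?\<psi> ` U) = c ?w" by (simp add: image_image)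
        then show ?thesis using c0[OF U] \<chi> by (metis c'_def)
      qed
      then show "\<exists>c. \<forall>U\<in>sections P \<pi> D'. \<chi> (?\<psi> ` U) = c" using \<open>D' \<in> {D}\<close> by auto
    qed
  qed
  then show ?thesis using Q(1) by blast
qed

lemma sections_ramsey:
  fixes \<pi> :: "'a \<Rightarrow> 'x"
  assumes "P \<in> K" "finite \<D>" "k > 0"
    and "\<And>D. D \<in> \<D> \<Longrightarrow> wf_str D \<and> (\<exists>A\<in>K. \<exists>f. local_iso f D (verts D) A)"
  shows "\<exists>Q\<in>K. \<exists>\<rho>. partition_arrow k P \<pi> Q \<rho> \<D>"
proof (rule partition_arrow_iterate[where J = "\<lambda>_ _. True"])
  fix D P and \<pi> :: "'a \<Rightarrow> 'x"
  assume "D \<in> \<D>" "P \<in> K"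
  then show "\<exists>Q\<in>K. \<exists>\<rho>. True \<and> partition_arrow k P \<pi> Q \<rho> {D}"
    using section_ramsey[OF _ _ _ _ assms(3)] assms(4) by blast
qed (use assms in auto)

end

section \<open>Orderings\<close>

lemma sorted_list_of_set_nth_card:
  fixes T :: "nat set"
  assumes "finite T" "t \<in> T"
  shows "sorted_list_of_set T ! card {y \<in> T. y < t} = t"
proof -
  let ?l = "sorted_list_of_set T"
  have l: "set ?l = T" "sorted ?l" "distinct ?l" using assms(1) by auto
  obtain i where i: "i < length ?l" "?l ! i = t" using assms l(1) by (metis in_set_conv_nth)
  have "{y \<in> T. y < t} = (\<lambda>j. ?l ! j) ` {..<i}"
  proof (intro equalityI subsetI)
    fix y assume y: "y \<in> {y \<in> T. y < t}"
    then obtain j where j: "j < length ?l" "?l ! j = y" using l(1) by (metis in_set_conv_nth mem_Collect_eq)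
    then have "j < i" using y i l(2) by (metis (no_types, lifting) mem_Collect_eq not_less sorted_nth_mono)
    then show "y \<in> (\<lambda>j. ?l ! j) ` {..<i}" using j by auto
  next
    fix y assume "y \<in> (\<lambda>j. ?l ! j) ` {..<i}"
    then obtain j where j: "j < i" "y = ?l ! j" by auto
    then have "y \<le> t" "y \<noteq> t" "y \<in> T"
      using i l(1) sorted_nth_mono[OF l(2), of j i] nth_eq_iff_index_eq[OF l(3), of j i] nth_mem[of j ?l]
      by auto
    then show "y \<in> {y \<in> T. y < t}" by simp
  qed
  moreover have "inj_on (\<lambda>j. ?l ! j) {..<i}"
    using i(1) l(3) by (auto simp: inj_on_def nth_eq_iff_index_eq)
  ultimately have "card {y \<in> T. y < t} = i" by (simp add: card_image)
  then show ?thesis using i(2) by simp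
qed

definition below :: "('a, 'r option, 'f) lstructure \<Rightarrow> 'a \<Rightarrow> 'a \<Rightarrow> bool" where
  "below A x y \<longleftrightarrow> [x, y] \<in> rels A None \<and> x \<noteq> y"

lemma is_ordering_simps:
  assumes "is_ordering L A A'"
  shows "verts A' = verts A" "rels A' (Some R) = rels A R" "fn A' = fn A"
    "is_structure (ordered_language L) A'"
  using assms by (auto simp: is_ordering_def)

lemma ordering_rels_None:
  assumes "is_ordering L A A'" "t \<in> rels A' None"
  shows "length t = 2"
  using is_ordering_simps(4)[OF assms(1)] assms(2) by (auto simp: is_structure_iff ordered_language_def)

lemma is_ordering_order:
  assumes "is_ordering L A A'"
  shows "x \<in> verts A \<Longrightarrow> [x, x] \<in> rels A' None"
    and "[x, y] \<in> rels A' None \<Longrightarrow> x \<in> verts A \<and> y \<in> verts A"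
    and "[x, y] \<in> rels A' None \<Longrightarrow> [y, x] \<in> rels A' None \<Longrightarrow> x = y"
    and "[x, y] \<in> rels A' None \<Longrightarrow> [y, z] \<in> rels A' None \<Longrightarrow> [x, z] \<in> rels A' None"
    and "x \<in> verts A \<Longrightarrow> y \<in> verts A \<Longrightarrow> x = y \<or> below A' x y \<or> below A' y x"
proof -
  have l: "linear_order_on (verts A) {(x, y). [x, y] \<in> rels A' None}"
    using assms by (simp add: is_ordering_def)
  have wf: "wf_str A'" using assms is_structure_wf by (auto simp: is_ordering_def)
  show "x \<in> verts A \<Longrightarrow> [x, x] \<in> rels A' None"
    using l unfolding order_on_defs refl_on_def by blast
  show "[x, y] \<in> rels A' None \<Longrightarrow> x \<in> verts A \<and> y \<in> verts A"
    using wf_str_rels[OF wf, of "[x, y]" None] is_ordering_simps(1)[OF assms] by simp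
  show "[x, y] \<in> rels A' None \<Longrightarrow> [y, x] \<in> rels A' None \<Longrightarrow> x = y"
    using l unfolding order_on_defs antisym_def by blast
  show "[x, y] \<in> rels A' None \<Longrightarrow> [y, z] \<in> rels A' None \<Longrightarrow> [x, z] \<in> rels A' None"
    using l unfolding order_on_defs trans_def by blast
  show "x \<in> verts A \<Longrightarrow> y \<in> verts A \<Longrightarrow> x = y \<or> below A' x y \<or> below A' y x"
    using l unfolding order_on_defs total_on_def below_def by blast
qed

lemma ordering_local_iso_iff:
  assumes A: "is_ordering L A A'" and C: "is_ordering L C C'"
  shows "local_iso f A' (verts A) C' \<longleftrightarrow> local_iso f A (verts A) C \<and>
    (\<forall>x\<in>verts A. \<forall>y\<in>verts A. [x, y] \<in> rels A' None \<longleftrightarrow> [f x, f y] \<in> rels C' None)"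
    (is "?l \<longleftrightarrow> ?r")
proof
  assume l: ?l
  have "(t \<in> rels A R) = (map f t \<in> rels C R)" if "set t \<subseteq> verts A" for t R
    using local_isoD(4)[OF l that, of "Some R"] is_ordering_simps(2)[OF A] is_ordering_simps(2)[OF C] by simp
  moreover have "f ` fn A F t = fn C F (map f t)" if "set t \<subseteq> verts A" for t F
    using local_isoD(5)[OF l that, of F] is_ordering_simps(3)[OF A] is_ordering_simps(3)[OF C] by simp
  ultimately have "local_iso f A (verts A) C"
    using local_isoD(1,2)[OF l] is_ordering_simps(1)[OF C] by (simp add: local_iso_def)
  moreover have "[x, y] \<in> rels A' None \<longleftrightarrow> [f x, f y] \<in> rels C' None" if "x \<in> verts A" "y \<in> verts A" for x y
    using local_isoD(4)[OF l, of "[x, y]" None] that by simp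
  ultimately show ?r by blast
next
  assume r: ?r
  then have li: "local_iso f A (verts A) C" by blast
  have "(t \<in> rels A' R) = (map f t \<in> rels C' R)" if t: "set t \<subseteq> verts A" for t R
  proof (cases R)
    case None
    show ?thesis
    proof (cases "length t = 2")
      case True
      then obtain x y where "t = [x, y]" by (auto simp: length_Suc_conv numeral_2_eq_2)
      then show ?thesis using r t None by simp
    next
      case False
      then show ?thesis
        using ordering_rels_None[OF A, of t] ordering_rels_None[OF C, of "map f t"] None by auto
    qed
  next
    case (Some R')
    then show ?thesis
      using local_isoD(4)[OF li t, of R'] is_ordering_simps(2)[OF A] is_ordering_simps(2)[OF C] by simp
  qed
  moreover have "f ` fn A' F t = fn C' F (map f t)" if "set t \<subseteq> verts A" for t F
    using local_isoD(5)[OF li that, of F] is_ordering_simps(3)[OF A] is_ordering_simps(3)[OF C] by simp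
  ultimately show ?l
    using local_isoD(1,2)[OF li] is_ordering_simps(1)[OF C] by (simp add: local_iso_def)
qed

text \<open>Both orders are linear, so a monotone injection also reflects the order.\<close>

lemma ordering_local_isoI:
  assumes A: "is_ordering L A A'" and C: "is_ordering L C C'" and f: "local_iso f A (verts A) C"
    and mono: "\<And>x y. below A' x y \<Longrightarrow> [f x, f y] \<in> rels C' None"
  shows "local_iso f A' (verts A) C'"
  unfolding ordering_local_iso_iff[OF A C]
proof (intro conjI f ballI)
  fix x y assume xy: "x \<in> verts A" "y \<in> verts A"
  show "[x, y] \<in> rels A' None \<longleftrightarrow> [f x, f y] \<in> rels C' None"
  proof (cases "x = y")
    case True
    then show ?thesis
      using is_ordering_order(1)[OF A xy(1)] is_ordering_order(1)[OF C local_isoD(3)[OF f xy(1)]] by simp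
  next
    case False
    then have "f x \<noteq> f y" using inj_onD[OF local_isoD(1)[OF f]] xy by blast
    then show ?thesis
      using is_ordering_order(5)[OF A xy] mono False is_ordering_order(3)[OF A, of x y]
        is_ordering_order(3)[OF C, of "f x" "f y"] by (auto simp: below_def)
  qed
qed

text \<open>Ties are broken by an enumeration of the vertices. The copies of \<open>B\<close> used
  at the end have at most one vertex at each position.\<close>

definition ordering_by :: "('a \<Rightarrow> nat) \<Rightarrow> ('a, 'r, 'f) lstructure \<Rightarrow> ('a, 'r option, 'f) lstructure" where
  "ordering_by \<rho> Q = (let i = to_nat_on (verts Q) in
     \<lparr>verts = verts Q,
      rels = case_option {[x, y] | x y. x \<in> verts Q \<and> y \<in> verts Q \<and> (\<rho> x < \<rho> y \<or> \<rho> x = \<rho> y \<and> i x \<le> i y)} (rels Q),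
      fn = fn Q\<rparr>)"

lemma is_ordering_ordering_by:
  assumes "is_structure L Q"
  shows "is_ordering L Q (ordering_by \<rho> Q)"
proof -
  let ?i = "to_nat_on (verts Q)"
  let ?O = "ordering_by \<rho> Q"
  have c: "countable (verts Q)" using assms by (simp add: is_structure_def)
  have rel: "[x, y] \<in> rels ?O None \<longleftrightarrow> x \<in> verts Q \<and> y \<in> verts Q \<and> (\<rho> x < \<rho> y \<or> \<rho> x = \<rho> y \<and> ?i x \<le> ?i y)" for x y
    by (simp add: ordering_by_def Let_def)
  have O: "verts ?O = verts Q" "fn ?O = fn Q" "\<And>R. rels ?O (Some R) = rels Q R"
    by (simp_all add: ordering_by_def Let_def)
  have None2: "\<exists>x\<in>verts Q. \<exists>y\<in>verts Q. t = [x, y]" if "t \<in> rels ?O None" for t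
    using that by (auto simp: ordering_by_def Let_def)
  have wf: "wf_str Q" using assms is_structure_wf by blast
  have "set t \<subseteq> verts Q \<and> R \<in> rel_syms (ordered_language L) \<and> length t = rel_arity (ordered_language L) R"
    if t: "t \<in> rels ?O R" for R t
  proof (cases R)
    case None
    then show ?thesis using None2[of t] t by (auto simp: ordered_language_def)
  next
    case (Some R')
    then show ?thesis
      using t O(3) wf_str_rels[OF wf] assms by (auto simp: ordered_language_def is_structure_iff)
  qed
  then have "is_structure (ordered_language L) ?O"
    using assms unfolding is_structure_iff wf_str_def O(1,2) ordered_language_def by auto
  moreover have "linear_order_on (verts Q) {(x, y). [x, y] \<in> rels ?O None}"
  proof -
    let ?r = "{(x, y). [x, y] \<in> rels ?O None}"
    have "?r \<subseteq> verts Q \<times> verts Q" "refl_on (verts Q) ?r" by (auto simp: rel refl_on_def)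
    moreover have "trans ?r" by (rule transI) (auto simp: rel)
    moreover have "antisym ?r"
    proof (rule antisymI)
      fix x y assume "(x, y) \<in> ?r" "(y, x) \<in> ?r"
      then have "x \<in> verts Q" "y \<in> verts Q" "?i x = ?i y" by (auto simp: rel)
      then show "x = y" by (metis inj_onD[OF inj_on_to_nat_on[OF c]])
    qed
    moreover have "total_on (verts Q) ?r" by (auto simp: rel total_on_def)
    ultimately show ?thesis by (simp add: order_on_defs)
  qed
  ultimately show ?thesis
    by (simp add: is_ordering_def O)
qed

lemma ordering_by_less:
  "x \<in> verts Q \<Longrightarrow> y \<in> verts Q \<Longrightarrow> \<rho> x < \<rho> y \<Longrightarrow> [x, y] \<in> rels (ordering_by \<rho> Q) None"
  by (simp add: ordering_by_def Let_def)

section \<open>Positions of ordered structures\<close>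

text \<open>
  All copies of a structure share its constants (the closure of the empty set), so these must get
  the same position in every copy. The number of constants below a vertex is therefore the leading
  part of its position, and \<open>T\<close> only distributes the remaining vertices within the gaps.
\<close>

definition gap :: "('a, 'r option, 'f) lstructure \<Rightarrow> 'a \<Rightarrow> nat" where
  "gap A x = card {c \<in> constants A. [c, x] \<in> rels A None}"

definition rank :: "('a, 'r option, 'f) lstructure \<Rightarrow> 'a \<Rightarrow> nat" where
  "rank A x = card {y \<in> verts A - constants A. below A y x}"

text \<open>A two-digit number in base \<open>N + 1\<close> with the gap as leading digit. The gap
  count is reflexive, so a constant opens its own block with second digit 0; for
  \<open>T \<subseteq> {..<N}\<close> the other vertices get digits from 1 to
  \<open>N\<close>.\<close>

definition position :: "nat \<Rightarrow> ('a, 'r option, 'f) lstructure \<Rightarrow> nat set \<Rightarrow> 'a \<Rightarrow> nat" where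
  "position N A T x = gap A x * Suc N +
     (if x \<in> constants A then 0 else Suc (sorted_list_of_set T ! rank A x))"

lemma constants_ordering:
  assumes "is_ordering L A A'"
  shows "constants A' = constants A"
  using is_ordering_simps[OF assms] by (simp add: constants_def closed_in_def)

context
  fixes L :: "('r, 'f) language" and A :: "('a, 'r, 'f) lstructure" and A'
  assumes A: "is_ordering L A A'" and fin: "finite (verts A)"
begin

private lemma wfA': "wf_str A'"
  using is_ordering_simps(4)[OF A] is_structure_wf by blast

private lemma CA: "constants A' \<subseteq> verts A"
  using constants_subset[OF closed_in_verts[OF wfA']] is_ordering_simps(1)[OF A] by simp

private lemma vA: "verts A' = verts A" using is_ordering_simps(1)[OF A] .

lemma below_trans: "below A' x y \<Longrightarrow> below A' y z \<Longrightarrow> below A' x z"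
  unfolding below_def using is_ordering_order(3,4)[OF A] by metis

lemma below_verts: "below A' x y \<Longrightarrow> x \<in> verts A \<and> y \<in> verts A"
  unfolding below_def using is_ordering_order(2)[OF A] by blast

lemma rank_less_card:
  assumes "x \<in> verts A - constants A'"
  shows "rank A' x < card (verts A - constants A')"
  unfolding rank_def vA
  by (rule psubset_card_mono) (use fin assms in \<open>auto simp: below_def\<close>)

lemma rank_strict_mono:
  assumes "below A' x y" "x \<notin> constants A'"
  shows "rank A' x < rank A' y"
  unfolding rank_def vA
proof (rule psubset_card_mono)
  show "finite {z \<in> verts A - constants A'. below A' z y}" using fin by simp
  have "x \<in> verts A" using below_verts assms(1) by blast
  then show "{z \<in> verts A - constants A'. below A' z x} \<subset> {z \<in> verts A - constants A'. below A' z y}"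
  proof -
    have "\<not> below A' x x" by (simp add: below_def)
    then show ?thesis using assms below_trans[OF _ assms(1)] \<open>x \<in> verts A\<close> by blast
  qed
qed

lemma nth_rank:
  assumes "T \<subseteq> {..<N :: nat}" "card T = card (verts A - constants A')" "x \<in> verts A - constants A'"
  shows "sorted_list_of_set T ! rank A' x \<in> T"
proof -
  have "finite T" using assms(1) finite_subset by blast
  then have "sorted_list_of_set T ! rank A' x \<in> set (sorted_list_of_set T)"
    using rank_less_card[OF assms(3)] assms(2) by (intro nth_mem) simp
  then show ?thesis using \<open>finite T\<close> by simp
qed

lemma nth_rank_strict_mono:
  assumes "T \<subseteq> {..<N :: nat}" "card T = card (verts A - constants A')"
    "below A' x y" "x \<notin> constants A'" "y \<notin> constants A'"
  shows "sorted_list_of_set T ! rank A' x < sorted_list_of_set T ! rank A' y"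
proof -
  have "finite T" using assms(1) finite_subset by blast
  have "rank A' y < card T" using rank_less_card[of y] below_verts[OF assms(3)] assms by simp
  then show ?thesis
    using rank_strict_mono[OF assms(3,4)] \<open>finite T\<close>
    by (intro sorted_wrt_nth_less[OF strict_sorted_list_of_set]) auto
qed

lemma position_strict_mono:
  assumes T: "T \<subseteq> {..<N}" "card T = card (verts A - constants A')" and xy: "below A' x y"
  shows "position N A' T x < position N A' T y"
proof -
  let ?g = "\<lambda>x. {c \<in> constants A'. [c, x] \<in> rels A' None}"
  have fC: "finite (constants A')" using CA fin finite_subset by blast
  have xyA: "x \<in> verts A" "y \<in> verts A" using below_verts[OF xy] by auto
  have "[x, y] \<in> rels A' None" using xy by (simp add: below_def)
  then have sub: "?g x \<subseteq> ?g y" using is_ordering_order(4)[OF A] by blast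
  then have le: "gap A' x \<le> gap A' y" unfolding gap_def using fC by (intro card_mono) auto
  show ?thesis
  proof (cases "gap A' x < gap A' y")
    case True
    have "position N A' T x \<le> gap A' x * Suc N + N"
      using nth_rank[OF T, of x] xyA T(1) by (auto simp: position_def Suc_le_eq)
    also have "\<dots> < Suc (gap A' x) * Suc N" by simp
    also have "\<dots> \<le> gap A' y * Suc N" using True by (intro mult_le_mono1) simp
    also have "\<dots> \<le> position N A' T y" by (simp add: position_def)
    finally show ?thesis .
  next
    case False
    \<comment> \<open>A constant counts itself in its gap, so its gap exceeds that of every smaller
      vertex.\<close>
    have "y \<notin> constants A'"
    proof
      assume y: "y \<in> constants A'"
      have "y \<notin> ?g x" using xy is_ordering_order(3)[OF A, of x y] by (auto simp: below_def)
      moreover have "y \<in> ?g y" using y is_ordering_order(1)[OF A xyA(2)] by simp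
      ultimately have "?g x \<subset> ?g y" using sub by blast
      then have "gap A' x < gap A' y" unfolding gap_def using fC by (intro psubset_card_mono) auto
      then show False using False by simp
    qed
    then show ?thesis
      using False le nth_rank_strict_mono[OF T xy] by (auto simp: position_def)
  qed
qed

lemma inj_on_position:
  assumes "T \<subseteq> {..<N :: nat}" "card T = card (verts A - constants A')"
  shows "inj_on (position N A' T) (verts A)"
proof (rule inj_onI)
  fix x y assume xy: "x \<in> verts A" "y \<in> verts A" "position N A' T x = position N A' T y"
  then show "x = y"
    using is_ordering_order(5)[OF A xy(1,2)] position_strict_mono[OF assms, of x y]
      position_strict_mono[OF assms, of y x] by auto
qed

end

text \<open>\<open>T\<close> consists of the entries of \<open>H\<close> occupied by the images of
  the nonconstant vertices. Gaps are preserved because \<open>h\<close> respects the order and maps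
  the constants onto the constants.\<close>

lemma position_embedding:
  assumes A: "is_ordering L A A'" and B: "is_ordering L B B'" and fin: "finite (verts B)"
    and h: "local_iso h A' (verts A) B'"
    and H: "H \<subseteq> {..<N}" "card H = card (verts B - constants B')"
  obtains T where "T \<subseteq> H" "card T = card (verts A - constants A')"
    "\<And>a. a \<in> verts A \<Longrightarrow> position N B' H (h a) = position N A' T a"
proof -
  have vA: "verts A' = verts A" and vB: "verts B' = verts B" using is_ordering_simps(1) A B by auto
  have wf: "wf_str A'" "wf_str B'"
    by (rule is_structure_wf[OF is_ordering_simps(4)[OF A]] is_structure_wf[OF is_ordering_simps(4)[OF B]])+
  have h': "local_iso h A' (verts A') B'" using h vA by simp
  have hC: "h ` constants A' = constants B'" by (rule constants_image[OF h' wf])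
  have inj: "inj_on h (verts A)" using local_isoD(1)[OF h] .
  have hv: "h ` verts A \<subseteq> verts B" using local_isoD(2)[OF h] vB by simp
  have CA: "constants A' \<subseteq> verts A" using constants_subset[OF closed_in_verts[OF wf(1)]] vA by simp
  have hCiff: "h a \<in> constants B' \<longleftrightarrow> a \<in> constants A'" if "a \<in> verts A" for a
    using inj_on_image_mem_iff[OF inj that CA] hC by simp
  have ord: "[x, y] \<in> rels A' None \<longleftrightarrow> [h x, h y] \<in> rels B' None" if "x \<in> verts A" "y \<in> verts A" for x y
    using h that unfolding ordering_local_iso_iff[OF A B] by blast
  have bel: "below A' x y \<longleftrightarrow> below B' (h x) (h y)" if "x \<in> verts A" "y \<in> verts A" for x y
    using ord[OF that] inj_on_eq_iff[OF inj that] by (simp add: below_def)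
  let ?N = "verts A - constants A'"
  define s where "s b = sorted_list_of_set H ! rank B' b" for b
  define T where "T = (\<lambda>a. s (h a)) ` ?N"
  have finH: "finite H" using H(1) finite_subset by blast
  have hN: "h a \<in> verts B - constants B'" if "a \<in> ?N" for a using that hv hCiff by auto
  have sm: "s (h a) < s (h b)" if "a \<in> ?N" "b \<in> ?N" "below A' a b" for a b
    unfolding s_def using that bel hCiff hN
    by (intro nth_rank_strict_mono[OF B fin H]) auto
  have smi: "below A' a b \<longleftrightarrow> s (h a) < s (h b)" if "a \<in> ?N" "b \<in> ?N" for a b
    using sm[OF that] sm[OF that(2,1)] is_ordering_order(5)[OF A, of a b] that by (auto simp: below_def)
  have injs: "inj_on (\<lambda>a. s (h a)) ?N"
  proof (rule inj_onI)
    fix a b assume ab: "a \<in> ?N" "b \<in> ?N" "s (h a) = s (h b)"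
    then show "a = b" using is_ordering_order(5)[OF A, of a b] sm[of a b] sm[of b a] by auto
  qed
  show thesis
  proof (rule that[of T])
    show TH: "T \<subseteq> H" using nth_rank[OF B fin H hN] by (auto simp: T_def s_def)
    show "card T = card ?N" unfolding T_def by (rule card_image[OF injs])
    fix a assume a: "a \<in> verts A"
    have "gap B' (h a) = gap A' a"
    proof -
      have "{c \<in> constants B'. [c, h a] \<in> rels B' None} = h ` {c \<in> constants A'. [c, a] \<in> rels A' None}"
        using ord[OF _ a] CA unfolding hC[symmetric] by auto
      then show ?thesis unfolding gap_def using inj CA
        by (simp add: card_image inj_on_subset[of h "verts A"] subset_iff)
    qed
    moreover have "sorted_list_of_set T ! rank A' a = s (h a)" if "a \<notin> constants A'"
    proof -
      have aN: "a \<in> ?N" using a that by simp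
      \<comment> \<open>Being increasing, \<open>a \<mapsto> s (h a)\<close> matches the rank of
        \<open>a\<close> with the index of its entry in \<open>T\<close>.\<close>
      have "{y \<in> T. y < s (h a)} = (\<lambda>a. s (h a)) ` {b \<in> ?N. below A' b a}"
        using smi[OF _ aN] by (auto simp: T_def)
      then have "card {y \<in> T. y < s (h a)} = rank A' a"
        unfolding rank_def vA using card_image[OF inj_on_subset[OF injs, of "{b \<in> ?N. below A' b a}"]] by (simp add: subset_iff)
      moreover have "s (h a) \<in> T" using aN by (simp add: T_def)
      moreover have "finite T" using TH finH finite_subset by blast
      ultimately show ?thesis using sorted_list_of_set_nth_card by metis
    qed
    ultimately show "position N B' H (h a) = position N A' T a"
      using hCiff[OF a] by (simp add: position_def s_def)
  qed
qed


section \<open>The Ramsey property of the ordered class\<close>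

theorem theorem1p3:
  fixes L :: "('r, 'f) language" and K :: "('a, 'r, 'f) lstructure set"
  assumes "free_amalgamation_class L K"
  shows "ramsey_class (ordered_language L) (orderings L K)"
  unfolding ramsey_class_def
proof (intro ballI allI impI)
  interpret free_amalg L K using assms by unfold_locales
  let ?L = "ordered_language L"
  fix A' B' and k :: nat
  assume "A' \<in> orderings L K" "B' \<in> orderings L K" and k: "k > 0"
  then obtain A B where A: "A \<in> K" "is_ordering L A A'" and B: "B \<in> K" "is_ordering L B B'"
    by (auto simp: orderings_def)
  have wfA: "wf_str A" and wfB: "wf_str B" and finB: "finite (verts B)" using A B K_wf K_finite by auto
  define nA where "nA = card (verts A - constants A')"
  define nB where "nB = card (verts B - constants B')"
  \<comment> \<open>The places of the constants are fixed, so placements of \<open>A\<close> and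
    \<open>B\<close> are sets of \<open>nA\<close> and \<open>nB\<close> numbers below
    \<open>N\<close>.\<close>
  obtain N :: nat where N: "partn_lst {..<N} (replicate k nB) nA" using ramsey_full by blast
  define \<Lambda> where "\<Lambda> = {H. H \<subseteq> {..<N} \<and> card H = nB}"
  interpret gl: gluing "restrict_str B (constants B)" B "constants B" \<Lambda> "\<lambda>_ x. x"
    by (rule gluing_constants[OF wfB])
  have "finite \<Lambda>" unfolding \<Lambda>_def by (rule finite_subset[of _ "Pow {..<N}"]) auto
  then obtain P \<phi> where P: "P \<in> K" "local_iso \<phi> gl.G (verts gl.G) P"
    by (rule representable_glue_constants[OF B(1)]) (rule that)
  \<comment> \<open>A constant has second digit 0 in every copy, so its position is independent of
    \<open>H\<close>.\<close>
  define \<pi>0 where "\<pi>0 v = (case v of Inl x \<Rightarrow> gap B' x * Suc N | Inr (H, x) \<Rightarrow> position N B' H x)"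
    for v :: "'a + nat set \<times> 'a"
  have \<pi>0: "\<pi>0 (gl.gm H x) = position N B' H x" for H x
    using constants_ordering[OF B(2)] by (simp add: glue_map_def \<pi>0_def position_def)
  define \<pi> where "\<pi> x = \<pi>0 (inv_into (verts gl.G) \<phi> x)" for x
  \<comment> \<open>\<open>A\<close> transported to its positions; sections over \<open>D T\<close>
    are the copies of \<open>A\<close> placed at \<open>T\<close>.\<close>
  define D where "D T = image_str (position N A' T) A" for T
  define \<T> where "\<T> = {T. T \<subseteq> {..<N} \<and> card T = nA}"
  have iso_D: "local_iso (position N A' T) A (verts A) (D T)" "wf_str (D T)"
    "verts (D T) = position N A' T ` verts A" if "T \<in> \<T>" for T
  proof -
    have inj: "inj_on (position N A' T) (verts A)"
      using that inj_on_position[OF A(2) K_finite[OF A(1)]] by (auto simp: \<T>_def nA_def)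
    show "local_iso (position N A' T) A (verts A) (D T)"
      unfolding D_def by (rule local_iso_image_str[OF wfA inj])
    show "wf_str (D T)" unfolding D_def by (rule wf_image_str[OF wfA])
    show "verts (D T) = position N A' T ` verts A" by (simp add: D_def image_str_def)
  qed
  have "finite (D ` \<T>)"
    unfolding \<T>_def by (rule finite_imageI, rule finite_subset[of _ "Pow {..<N}"]) auto
  moreover have "wf_str E \<and> (\<exists>A\<in>K. \<exists>f. local_iso f E (verts E) A)" if E: "E \<in> D ` \<T>" for E
  proof -
    obtain T where T: "T \<in> \<T>" "E = D T" using E by blast
    have "local_iso (inv_into (verts A) (position N A' T)) E (verts E) A"
      unfolding T(2) by (rule local_iso_inv[OF iso_D(1)[OF T(1)] wfA iso_D(3)[OF T(1), symmetric]])
    then show ?thesis using iso_D(2)[OF T(1)] A(1) T(2) by blast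
  qed
  ultimately obtain Q \<rho> where Q: "Q \<in> K" "partition_arrow k P \<pi> Q \<rho> (D ` \<T>)"
    using sections_ramsey[OF P(1) _ k, of "D ` \<T>" \<pi>] by blast
  define Q' where "Q' = ordering_by \<rho> Q"
  have Q': "is_ordering L Q Q'" unfolding Q'_def by (rule is_ordering_ordering_by[OF K_structure[OF Q(1)]])
  have stQ': "is_structure ?L Q'" and vQ': "verts Q' = verts Q" using is_ordering_simps[OF Q'] by auto
  have wfQ': "wf_str Q'" using is_structure_wf[OF stQ'] .
  show "\<exists>C\<in>orderings L K. \<forall>Pt :: nat \<Rightarrow> ('a, 'r option, 'f) lstructure set.
      disjoint_family_on Pt {..<k} \<and> (\<Union>i<k. Pt i) = copies ?L C A' \<longrightarrow>
      (\<exists>B''\<in>copies ?L C B'. \<exists>i<k. copies ?L B'' A' \<subseteq> Pt i)"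
  proof (rule bexI[of _ Q'], intro allI impI)
    show "Q' \<in> orderings L K" using Q(1) Q' by (auto simp: orderings_def)
  next
    fix Pt :: "nat \<Rightarrow> ('a, 'r option, 'f) lstructure set"
    assume Pt: "disjoint_family_on Pt {..<k} \<and> (\<Union>i<k. Pt i) = copies ?L Q' A'"
    \<comment> \<open>The index of the class containing the substructure on \<open>U\<close>, and 0
      if no class contains it.\<close>
    define \<chi> where "\<chi> U = (if \<exists>i<k. restrict_str Q' U \<in> Pt i
      then SOME i. i < k \<and> restrict_str Q' U \<in> Pt i else 0)" for U
    have \<chi>_eq: "\<chi> U = i" if i: "i < k" "restrict_str Q' U \<in> Pt i" for U i
    proof -
      have "j = i" if j: "j < k" "restrict_str Q' U \<in> Pt j" for j
      proof (rule ccontr)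
        assume "j \<noteq> i"
        then have "Pt j \<inter> Pt i = {}"
          using Pt i(1) j(1) by (intro disjoint_family_onD[of Pt "{..<k}"]) auto
        then show False using i(2) j(2) by blast
      qed
      then have "(SOME i. i < k \<and> restrict_str Q' U \<in> Pt i) = i"
        using i by (intro some_equality) blast+
      then show ?thesis using i by (auto simp: \<chi>_def)
    qed
    have "\<chi> U < k" for U
    proof (cases "\<exists>i<k. restrict_str Q' U \<in> Pt i")
      case True
      then show ?thesis using \<chi>_eq by blast
    next
      case False
      then have "\<chi> U = 0" unfolding \<chi>_def by (rule if_not_P)
      then show ?thesis using k by simp
    qed
    then obtain \<psi> where "homogeneous_copy \<chi> \<psi> P \<pi> Q \<rho> (D ` \<T>)"
      using partition_arrowD[OF Q(2)] by blast
    note \<psi> = homogeneous_copyD[OF this]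
    have "\<forall>T\<in>\<T>. \<exists>c. \<forall>U\<in>sections P \<pi> (D T). \<chi> (\<psi> ` U) = c" using \<psi>(3) by blast
    then obtain c where c: "\<And>T U. T \<in> \<T> \<Longrightarrow> U \<in> sections P \<pi> (D T) \<Longrightarrow> \<chi> (\<psi> ` U) = c T"
      by (metis bchoice)
    \<comment> \<open>A placement without sections leaves \<open>c T\<close> arbitrary, so it is
      forced below \<open>k\<close> before Ramsey's theorem is applied.\<close>
    define c' where "c' T = (if c T < k then c T else 0)" for T
    have "c' \<in> nsets {..<N} nA \<rightarrow> {..<length (replicate k nB)}" using k by (auto simp: c'_def)
    then obtain i H where i: "i < k" and H: "H \<in> nsets {..<N} nB" "c' ` nsets H nA \<subseteq> {i}"
      using N unfolding partn_lst_def monochromatic_def by (metis length_replicate nth_replicate)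
    have HL: "H \<in> \<Lambda>" "H \<subseteq> {..<N}" "card H = card (verts B - constants B')"
      using H(1) by (auto simp: nsets_def \<Lambda>_def nB_def)
    have gm: "local_iso (gl.gm H) B (verts B) gl.G" using gl.local_iso_glue_map[OF HL(1)] .
    define \<eta> where "\<eta> x = \<phi> (gl.gm H x)" for x
    have \<eta>: "local_iso \<eta> B (verts B) P"
      unfolding \<eta>_def by (rule local_iso_comp[OF gm P(2) local_isoD(2)[OF gm]])
    have \<pi>\<eta>: "\<pi> (\<eta> x) = position N B' H x" if "x \<in> verts B" for x
      using inv_into_f_f[OF local_isoD(1)[OF P(2)] local_isoD(3)[OF gm that]]
      by (simp add: \<pi>_def \<eta>_def \<pi>0)
    define \<theta> where "\<theta> x = \<psi> (\<eta> x)" for x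
    have \<theta>: "local_iso \<theta> B (verts B) Q"
      unfolding \<theta>_def by (rule local_iso_comp[OF \<eta> \<psi>(1) local_isoD(2)[OF \<eta>]])
    have \<rho>\<theta>: "\<rho> (\<theta> x) = position N B' H x" if "x \<in> verts B" for x
      using \<psi>(2)[OF local_isoD(3)[OF \<eta> that]] \<pi>\<eta>[OF that] by (simp add: \<theta>_def)
    have vB': "verts B' = verts B" and stB': "is_structure ?L B'" and vA': "verts A' = verts A"
      using is_ordering_simps[OF B(2)] is_ordering_simps[OF A(2)] by auto
    have wfB': "wf_str B'" using is_structure_wf[OF stB'] .
    have \<theta>': "local_iso \<theta> B' (verts B') Q'"
      unfolding vB'
    \<comment> \<open>Positions increase strictly along \<open>B'\<close>, so on this copy the order
      of \<open>Q'\<close> is decided by positions alone.\<close>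
    proof (rule ordering_local_isoI[OF B(2) Q' \<theta>])
      fix x y assume xy: "below B' x y"
      have "x \<in> verts B" "y \<in> verts B" using below_verts[OF B(2) finB xy] by auto
      then show "[\<theta> x, \<theta> y] \<in> rels Q' None"
        using position_strict_mono[OF B(2) finB HL(2,3) xy] \<rho>\<theta> local_isoD(3)[OF \<theta>]
        unfolding Q'_def by (intro ordering_by_less) auto
    qed
    define B'' where "B'' = restrict_str Q' (\<theta> ` verts B')"
    have cl: "closed_in Q' (\<theta> ` verts B')"
      by (rule closed_in_image[OF \<theta>' closed_in_verts[OF wfB']])
    have sub: "substructure ?L B'' Q'" unfolding B''_def by (rule substructure_restrict_str[OF stQ' cl])
    then have stB'': "is_structure ?L B''" by (simp add: substructure_def embedding_iff)
    have \<theta>'': "local_iso \<theta> B' (verts B') B''"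
      unfolding B''_def by (rule local_iso_into_restrict_str[OF \<theta>' order_refl])
    have "isomorphic ?L B' B''"
      unfolding isomorphic_def embedding_iff bij_betw_def
      using \<theta>'' stB' stB'' local_isoD(1)[OF \<theta>''] by (auto simp: B''_def)
    then have "B'' \<in> copies ?L Q' B'" using sub by (simp add: copies_def)
    moreover have "copies ?L B'' A' \<subseteq> Pt i"
    proof
      fix A'' assume "A'' \<in> copies ?L B'' A'"
      then obtain f where subA: "substructure ?L A'' B''" and isoA: "isomorphic ?L A' A''"
        and f: "local_iso f A' (verts A') A''" "f ` verts A' = verts A''"
        by (auto simp: copies_def isomorphic_def embedding_iff bij_betw_def)
      have idA: "local_iso (\<lambda>x. x) A'' (verts A'') B''" and stA'': "is_structure ?L A''"
        using subA by (auto simp: substructure_def embedding_iff)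
      have idB: "local_iso (\<lambda>x. x) B'' (verts B'') Q'" using sub by (auto simp: substructure_def embedding_iff)
      have "local_iso (\<lambda>x. x) A'' (verts A'') Q'"
        using local_iso_comp[OF idA idB local_isoD(2)[OF idA]] .
      then have subAQ: "substructure ?L A'' Q'" using stA'' stQ' by (simp add: substructure_def embedding_iff)
      then have "A'' \<in> copies ?L Q' A'" using isoA by (simp add: copies_def)
      then obtain i' where i': "i' < k" "A'' \<in> Pt i'" using Pt by blast
      have \<chi>A: "\<chi> (verts A'') = i'"
        using \<chi>_eq[OF i'(1), of "verts A''"] i'(2) substructure_eq_restrict_str(1)[OF subAQ] by simp
      \<comment> \<open>Pulls \<open>A''\<close> back to an embedding of \<open>A'\<close> into
        \<open>B'\<close>. Its placement is then some \<open>T \<subseteq> H\<close>, and the colour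
        depends only on \<open>T\<close>.\<close>
      define h where "h a = inv_into (verts B') \<theta> (f a)" for a
      have inv: "local_iso (inv_into (verts B') \<theta>) B'' (verts B'') B'"
        by (rule local_iso_inv[OF \<theta>'' wfB']) (simp add: B''_def)
      have fB: "local_iso f A' (verts A') B''"
        using local_iso_comp[OF f(1) idA local_isoD(2)[OF f(1)]] .
      have h': "local_iso h A' (verts A) B'"
        using local_iso_comp[OF fB inv local_isoD(2)[OF fB]] by (simp add: h_def[abs_def] vA')
      have \<theta>h: "\<theta> (h a) = f a" if "a \<in> verts A" for a
        using local_isoD(3)[OF fB] that by (auto simp: h_def B''_def vA' f_inv_into_f)
      obtain T where T: "T \<subseteq> H" "card T = nA"
        "\<And>a. a \<in> verts A \<Longrightarrow> position N B' H (h a) = position N A' T a"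
        using position_embedding[OF A(2) B(2) finB h' HL(2,3)] unfolding nA_def by blast
      have TT: "T \<in> \<T>" using T(1,2) HL(2) by (auto simp: \<T>_def)
      have h: "local_iso h A (verts A) B" using h' ordering_local_iso_iff[OF A(2) B(2)] by blast
      have "verts A \<in> sections A (position N A' T) (D T)"
        using closed_in_verts[OF wfA] iso_D[OF TT] by (simp add: sections_def)
      moreover have \<eta>h: "local_iso (\<lambda>a. \<eta> (h a)) A (verts A) P"
        by (rule local_iso_comp[OF h \<eta> local_isoD(2)[OF h]])
      moreover have "\<pi> (\<eta> (h a)) = position N A' T a" if "a \<in> verts A" for a
        using \<pi>\<eta>[OF local_isoD(3)[OF h that]] T(3)[OF that] by simp
      ultimately have "(\<lambda>a. \<eta> (h a)) ` verts A \<in> sections P \<pi> (D T)"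
        by (intro sections_image)
      from c[OF TT this] have "\<chi> ((\<lambda>a. \<theta> (h a)) ` verts A) = c T"
        by (simp add: image_image \<theta>_def)
      moreover have "(\<lambda>a. \<theta> (h a)) ` verts A = verts A''"
        using \<theta>h f(2) vA' by (simp cong: image_cong_simp)
      ultimately have "c T = i'" using \<chi>A by simp
      moreover have "finite T" using finite_subset[OF order_trans[OF T(1) HL(2)]] by simp
      then have "T \<in> nsets H nA" using T(1,2) by (simp add: nsets_def)
      then have "c' T = i" using H(2) by blast
      ultimately have "i' = i" using i'(1) by (simp add: c'_def)
      then show "A'' \<in> Pt i" using i'(2) by simp
    qed
    ultimately show "\<exists>B''\<in>copies ?L Q' B'. \<exists>i<k. copies ?L B'' A' \<subseteq> Pt i" using i by blast
  qed
qed

end
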